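(* Let $\delta>2$ be an integer and let $G$ be a $2$-connected multigraph. Then the following are equivalent: (1) $G$ satisfies $(\spadesuit)_\delta$; (2) $G$ can be obtained from $\delta$-cycles $C_\delta$ by (repeated) applications of Construction A, Construction B and Construction C (all with parameter $\delta$), i.e. $G$ belongs to the smallest class of multigraphs containing $C_\delta$ and closed under these three constructions.
   Context: Multigraphs are finite, undirected, loop-free, and may have parallel edges. $C_\delta$ is the cycle with $\delta$ vertices and $\delta$ edges. For a multigraph $G=(V,E)$ and $S\subseteq V$, $E(S)$ denotes the set of edges with both endpoints in $S$, $G|_S$ the induced sub-multigraph on $S$, and $G/E(S)$ the result of contracting $E(S)$. A good flat of a $2$-connected multigraph $G=(V,E)$ is a subset $S\subsetneq V$ such that both $G|_S$ and $G/E(S)$ are $2$-connected. Weight function: for a $2$-connected multigraph $G=(V,E)$, $w\colon E\to\{1,\delta-1\}$ is given by $w(e)=1$ if $G\setminus e$ (deletion) is $2$-connected and $w(e)=\delta-1$ if $G/e$ (contraction) is $2$-connected; $w(F)=\sum_{e\in F}w(e)$. $G$ satisfies $(\spadesuit)_\delta$ if it possesses such a weight function and (1) $w(E)=\delta(|V|-1)$ and (2) $w(E(S))+1=\delta(|S|-1)$ for every good flat $S$. Construction A: given $2$-connected multigraphs $G_1,G_2$ and edges $e_1$ of $G_1$ with $w(e_1)=1$ and $e_2$ of $G_2$ with $w(e_2)=\delta-1$ (weights in the respective graphs), take the disjoint union, identify the endpoints of $e_1$ with those of $e_2$ (so that $e_1,e_2$ become one glued edge), and delete the glued edge. Construction B: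 given $2$-connected multigraphs $G_1,G_2$ and edges $e_1$ of $G_1$, $e_2$ of $G_2$ with $w(e_1)=w(e_2)=\delta-1$, take the disjoint union, identify the endpoints of $e_1$ with those of $e_2$, and replace the glued edge by $\delta-2$ parallel edges. Construction C: given a $2$-connected multigraph $G$ with vertices $v_1,v_2$ joined by a path of $\delta-1$ edges whose interior vertices all have degree $2$, replace this path by a single edge between $v_1$ and $v_2$. *)

theory Defs
  imports Main
begin

text \<open>
  The endpoints of an edge form a set of one (loop) or two vertices. Loops are tolerated in the raw
  record because contracting one of several parallel edges creates them; the predicate
  \<open>multigraph\<close> excludes them.
\<close>

record ('v, 'e) pre_multigraph =
  verts :: "'v set"
  edges :: "'e set"
  ends :: "'e \<Rightarrow> 'v set"

definition multigraph :: "('v, 'e) pre_multigraph \<Rightarrow> bool" where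
  "multigraph G \<longleftrightarrow> finite (verts G) \<and> finite (edges G) \<and>
     (\<forall>e\<in>edges G. ends G e \<subseteq> verts G \<and> card (ends G e) = 2)"

definition multigraph_iso ::
  "('v, 'e) pre_multigraph \<Rightarrow> ('w, 'f) pre_multigraph \<Rightarrow> bool" (infix \<open>\<simeq>\<^sub>m\<close> 50) where
  "G \<simeq>\<^sub>m H \<longleftrightarrow> (\<exists>f g. bij_betw f (verts G) (verts H) \<and> bij_betw g (edges G) (edges H) \<and>
     (\<forall>e\<in>edges G. ends H (g e) = f ` ends G e))"

definition degree :: "('v, 'e) pre_multigraph \<Rightarrow> 'v \<Rightarrow> nat" where
  "degree G v = card {e \<in> edges G. v \<in> ends G e}"

definition edges_within :: "('v, 'e) pre_multigraph \<Rightarrow> 'v set \<Rightarrow> 'e set" where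
  "edges_within G S = {e \<in> edges G. ends G e \<subseteq> S}"

definition induced :: "('v, 'e) pre_multigraph \<Rightarrow> 'v set \<Rightarrow> ('v, 'e) pre_multigraph" where
  "induced G S = \<lparr>verts = S, edges = edges_within G S, ends = ends G\<rparr>"

definition delete_edges :: "('v, 'e) pre_multigraph \<Rightarrow> 'e set \<Rightarrow> ('v, 'e) pre_multigraph" where
  "delete_edges G F = \<lparr>verts = verts G, edges = edges G - F, ends = ends G\<rparr>"

definition adjacency :: "('v, 'e) pre_multigraph \<Rightarrow> 'e set \<Rightarrow> ('v \<times> 'v) set" where
  "adjacency G F = {(u, v). \<exists>e\<in>F. ends G e = {u, v}}"

text \<open>The vertices of the contraction are the connected components of the graph
  \<open>(verts G, F)\<close>.\<close>

definition contract :: "('v, 'e) pre_multigraph \<Rightarrow> 'e set \<Rightarrow> ('v set, 'e) pre_multigraph" where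
  "contract G F =
     (let cls = (\<lambda>v. (adjacency G F)\<^sup>* `` {v})
      in \<lparr>verts = cls ` verts G, edges = edges G - F, ends = (\<lambda>e. cls ` ends G e)\<rparr>)"

definition connected_multigraph :: "('v, 'e) pre_multigraph \<Rightarrow> bool" where
  "connected_multigraph G \<longleftrightarrow> verts G \<noteq> {} \<and>
     (\<forall>u\<in>verts G. \<forall>v\<in>verts G. (u, v) \<in> (adjacency G (edges G))\<^sup>*)"

text \<open>
  Neither a cut vertex nor a bridge. With at least three vertices the absence of bridges follows
  from the absence of cut vertices. With two vertices it demands at least two parallel edges: the
  digon is 2-connected, a single edge and a single vertex are not.
\<close>

definition two_connected :: "('v, 'e) pre_multigraph \<Rightarrow> bool" where
  "two_connected G \<longleftrightarrow> multigraph G \<and> 2 \<le> card (verts G) \<and> connected_multigraph G \<and>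
     (\<forall>v\<in>verts G. connected_multigraph (induced G (verts G - {v}))) \<and>
     (\<forall>e\<in>edges G. connected_multigraph (delete_edges G {e}))"

definition good_flat :: "('v, 'e) pre_multigraph \<Rightarrow> 'v set \<Rightarrow> bool" where
  "good_flat G S \<longleftrightarrow> S \<subset> verts G \<and> two_connected (induced G S) \<and>
     two_connected (contract G (edges_within G S))"

definition weight_function :: "nat \<Rightarrow> ('v, 'e) pre_multigraph \<Rightarrow> ('e \<Rightarrow> nat) \<Rightarrow> bool" where
  "weight_function \<delta> G w \<longleftrightarrow> (\<forall>e\<in>edges G. w e \<in> {1, \<delta> - 1} \<and>
     (two_connected (delete_edges G {e}) \<longrightarrow> w e = 1) \<and>
     (two_connected (contract G {e}) \<longrightarrow> w e = \<delta> - 1))"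

definition spade :: "nat \<Rightarrow> ('v, 'e) pre_multigraph \<Rightarrow> bool" where
  "spade \<delta> G \<longleftrightarrow> (\<exists>w. weight_function \<delta> G w \<and>
     (\<Sum>e\<in>edges G. w e) = \<delta> * (card (verts G) - 1) \<and>
     (\<forall>S. good_flat G S \<longrightarrow> (\<Sum>e\<in>edges_within G S. w e) + 1 = \<delta> * (card S - 1)))"

definition cycle_multigraph :: "nat \<Rightarrow> (nat, nat) pre_multigraph" where
  "cycle_multigraph n = \<lparr>verts = {..<n}, edges = {..<n}, ends = (\<lambda>i. {i, Suc i mod n})\<rparr>"

definition disjoint_union ::
  "('v, 'e) pre_multigraph \<Rightarrow> ('w, 'f) pre_multigraph \<Rightarrow> ('v + 'w, 'e + 'f) pre_multigraph" where
  "disjoint_union G H =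
     \<lparr>verts = Inl ` verts G \<union> Inr ` verts H,
      edges = Inl ` edges G \<union> Inr ` edges H,
      ends = case_sum (\<lambda>e. Inl ` ends G e) (\<lambda>f. Inr ` ends H f)\<rparr>"

definition identify_vertices ::
  "('v \<Rightarrow> 'w) \<Rightarrow> ('v, 'e) pre_multigraph \<Rightarrow> ('w, 'e) pre_multigraph" where
  "identify_vertices f G =
     \<lparr>verts = f ` verts G, edges = edges G, ends = (\<lambda>e. f ` ends G e)\<rparr>"

definition add_parallel_edges ::
  "nat \<Rightarrow> 'v \<Rightarrow> 'v \<Rightarrow> ('v, 'e) pre_multigraph \<Rightarrow> ('v, 'e + nat) pre_multigraph" where
  "add_parallel_edges k x y G =
     \<lparr>verts = verts G, edges = Inl ` edges G \<union> Inr ` {..<k},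
      ends = case_sum (ends G) (\<lambda>_. {x, y})\<rparr>"

text \<open>Disjoint union with \<open>x\<^sub>2\<close> identified with \<open>x\<^sub>1\<close> and \<open>y\<^sub>2\<close> with \<open>y\<^sub>1\<close>.\<close>

definition glue ::
  "('v, 'e) pre_multigraph \<Rightarrow> 'v \<Rightarrow> 'v \<Rightarrow> ('w, 'f) pre_multigraph \<Rightarrow> 'w \<Rightarrow> 'w \<Rightarrow>
   ('v + 'w, 'e + 'f) pre_multigraph" where
  "glue G\<^sub>1 x\<^sub>1 y\<^sub>1 G\<^sub>2 x\<^sub>2 y\<^sub>2 =
     identify_vertices (id(Inr x\<^sub>2 := Inl x\<^sub>1, Inr y\<^sub>2 := Inl y\<^sub>1)) (disjoint_union G\<^sub>1 G\<^sub>2)"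

definition has_weight :: "nat \<Rightarrow> ('v, 'e) pre_multigraph \<Rightarrow> 'e \<Rightarrow> nat \<Rightarrow> bool" where
  "has_weight \<delta> G e k \<longleftrightarrow> (\<exists>w. weight_function \<delta> G w \<and> w e = k)"

text \<open>Both copies \<open>Inl e\<^sub>1\<close> and \<open>Inr e\<^sub>2\<close> of the glued edge are removed. The order in which the
  endpoints are named is free, so both ways of gluing the edges are covered.\<close>

definition construction_A ::
  "nat \<Rightarrow> ('v, 'e) pre_multigraph \<Rightarrow> ('w, 'f) pre_multigraph \<Rightarrow>
   ('v + 'w, 'e + 'f) pre_multigraph \<Rightarrow> bool" where
  "construction_A \<delta> G\<^sub>1 G\<^sub>2 H \<longleftrightarrow> two_connected G\<^sub>1 \<and> two_connected G\<^sub>2 \<and>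
     (\<exists>e\<^sub>1\<in>edges G\<^sub>1. \<exists>e\<^sub>2\<in>edges G\<^sub>2. \<exists>x\<^sub>1 y\<^sub>1 x\<^sub>2 y\<^sub>2.
        has_weight \<delta> G\<^sub>1 e\<^sub>1 1 \<and> has_weight \<delta> G\<^sub>2 e\<^sub>2 (\<delta> - 1) \<and>
        ends G\<^sub>1 e\<^sub>1 = {x\<^sub>1, y\<^sub>1} \<and> ends G\<^sub>2 e\<^sub>2 = {x\<^sub>2, y\<^sub>2} \<and>
        H = delete_edges (glue G\<^sub>1 x\<^sub>1 y\<^sub>1 G\<^sub>2 x\<^sub>2 y\<^sub>2) {Inl e\<^sub>1, Inr e\<^sub>2})"

definition construction_B ::
  "nat \<Rightarrow> ('v, 'e) pre_multigraph \<Rightarrow> ('w, 'f) pre_multigraph \<Rightarrow>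
   ('v + 'w, ('e + 'f) + nat) pre_multigraph \<Rightarrow> bool" where
  "construction_B \<delta> G\<^sub>1 G\<^sub>2 H \<longleftrightarrow> two_connected G\<^sub>1 \<and> two_connected G\<^sub>2 \<and>
     (\<exists>e\<^sub>1\<in>edges G\<^sub>1. \<exists>e\<^sub>2\<in>edges G\<^sub>2. \<exists>x\<^sub>1 y\<^sub>1 x\<^sub>2 y\<^sub>2.
        has_weight \<delta> G\<^sub>1 e\<^sub>1 (\<delta> - 1) \<and> has_weight \<delta> G\<^sub>2 e\<^sub>2 (\<delta> - 1) \<and>
        ends G\<^sub>1 e\<^sub>1 = {x\<^sub>1, y\<^sub>1} \<and> ends G\<^sub>2 e\<^sub>2 = {x\<^sub>2, y\<^sub>2} \<and>
        H = add_parallel_edges (\<delta> - 2) (Inl x\<^sub>1) (Inl y\<^sub>1)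
              (delete_edges (glue G\<^sub>1 x\<^sub>1 y\<^sub>1 G\<^sub>2 x\<^sub>2 y\<^sub>2) {Inl e\<^sub>1, Inr e\<^sub>2}))"

definition is_path :: "('v, 'e) pre_multigraph \<Rightarrow> 'v list \<Rightarrow> 'e list \<Rightarrow> bool" where
  "is_path G vs es \<longleftrightarrow> length vs = Suc (length es) \<and> distinct vs \<and> set vs \<subseteq> verts G \<and>
     set es \<subseteq> edges G \<and> (\<forall>i<length es. ends G (es ! i) = {vs ! i, vs ! Suc i})"

definition construction_C ::
  "nat \<Rightarrow> ('v, 'e) pre_multigraph \<Rightarrow> ('v, 'e + nat) pre_multigraph \<Rightarrow> bool" where
  "construction_C \<delta> G H \<longleftrightarrow> two_connected G \<and>
     (\<exists>vs es. is_path G vs es \<and> length es = \<delta> - 1 \<and>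
        (let interior = set vs - {hd vs, last vs}
         in (\<forall>v\<in>interior. degree G v = 2) \<and>
            H = add_parallel_edges 1 (hd vs) (last vs)
                  (delete_edges (induced G (verts G - interior)) (set es))))"

text \<open>
  The smallest class, closed under isomorphism, that contains the \<open>\<delta>\<close>-cycle and is closed under the
  three constructions. Vertices and edges are natural numbers so that every finite multigraph has
  an isomorphic copy in the type.
\<close>

inductive constructible :: "nat \<Rightarrow> (nat, nat) pre_multigraph \<Rightarrow> bool" for \<delta> :: nat where
  cycle: "G \<simeq>\<^sub>m cycle_multigraph \<delta> \<Longrightarrow> constructible \<delta> G"
| A: "constructible \<delta> G\<^sub>1 \<Longrightarrow> constructible \<delta> G\<^sub>2 \<Longrightarrow> construction_A \<delta> G\<^sub>1 G\<^sub>2 H \<Longrightarrow> G \<simeq>\<^sub>m H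
     \<Longrightarrow> constructible \<delta> G"
| B: "constructible \<delta> G\<^sub>1 \<Longrightarrow> constructible \<delta> G\<^sub>2 \<Longrightarrow> construction_B \<delta> G\<^sub>1 G\<^sub>2 H \<Longrightarrow> G \<simeq>\<^sub>m H
     \<Longrightarrow> constructible \<delta> G"
| C: "constructible \<delta> G\<^sub>1 \<Longrightarrow> construction_C \<delta> G\<^sub>1 H \<Longrightarrow> G \<simeq>\<^sub>m H \<Longrightarrow> constructible \<delta> G"

definition obtainable_from_cycles :: "nat \<Rightarrow> ('v, 'e) pre_multigraph \<Rightarrow> bool" where
  "obtainable_from_cycles \<delta> G \<longleftrightarrow> (\<exists>H. constructible \<delta> H \<and> G \<simeq>\<^sub>m H)"

end

theory Submission
  imports Defs
begin

text \<open>
  A weight function whose total and whose good flats satisfy the two equations of the spade property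
  is called balanced. Suppose a two-connected graph \<open>G\<close> with balanced weights has at least three
  vertices. If \<open>G - x\<close> is two-connected for all \<open>x\<close>, then all these sets are good flats and counting
  weights around the vertices leaves only three vertices. Otherwise a two-vertex cut exists, and \<open>G\<close> is
  a cycle or contains a proper two-connected induced subgraph attached to the rest at only two
  vertices; a maximal one is a good flat. Replacing either side of such a flat by a virtual edge, of
  weight \<open>1\<close> inside and \<open>\<delta> - 1\<close> outside, gives two smaller balanced graphs of which \<open>G\<close> is the result
  under construction A. So by induction \<open>G\<close> arises by construction A from \<open>\<delta>\<close>-cycles, digons and bonds
  of \<open>\<delta>\<close> parallel edges; digons and bonds come from constructions C and B.

  Conversely, the good flats and the deletable and contractible edges of a 2-sum are determined by
  those of its two summands, so construction A preserves the spade property. Construction B is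
  construction A after an edge of weight \<open>\<delta> - 1\<close> has been thickened to \<open>\<delta> - 1\<close> parallel
  edges. For construction C, every block in a cyclic chain of blocks has weight one less than \<open>\<delta>\<close>
  times its rank, so that the chain has exactly \<open>\<delta>\<close> blocks; hence the complement of the path is a
  good flat or a single edge, and construction C undoes construction A with a \<open>\<delta>\<close>-cycle.
\<close>

section \<open>Connected vertex sets\<close>

lemma verts_induced [simp]: "verts (induced G S) = S"
  and edges_induced [simp]: "edges (induced G S) = edges_within G S"
  and ends_induced [simp]: "ends (induced G S) = ends G"
  by (simp_all add: induced_def)

lemma verts_delete_edges [simp]: "verts (delete_edges G F) = verts G"
  and edges_delete_edges [simp]: "edges (delete_edges G F) = edges G - F"
  and ends_delete_edges [simp]: "ends (delete_edges G F) = ends G"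
  by (simp_all add: delete_edges_def)

lemma edges_within_subset: "edges_within G S \<subseteq> edges G"
  by (auto simp: edges_within_def)

definition adj :: "('v, 'e) pre_multigraph \<Rightarrow> 'v \<Rightarrow> 'v \<Rightarrow> bool" where
  "adj G u v \<longleftrightarrow> (\<exists>e\<in>edges G. ends G e = {u, v})"

definition connected_on :: "('v, 'e) pre_multigraph \<Rightarrow> 'v set \<Rightarrow> bool" where
  "connected_on G X \<longleftrightarrow> connected_multigraph (induced G X)"

definition disconnection :: "('v, 'e) pre_multigraph \<Rightarrow> 'v set \<Rightarrow> 'v set \<Rightarrow> 'v set \<Rightarrow> bool" where
  "disconnection G X A B \<longleftrightarrow> A \<union> B = X \<and> A \<inter> B = {} \<and> A \<noteq> {} \<and> B \<noteq> {} \<and>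
     (\<forall>a\<in>A. \<forall>b\<in>B. \<not> adj G a b)"

lemma adjI: "e \<in> edges G \<Longrightarrow> ends G e = {u, v} \<Longrightarrow> adj G u v"
  by (auto simp: adj_def)

lemma adj_commute: "adj G u v \<longleftrightarrow> adj G v u"
  by (auto simp: adj_def insert_commute)

lemma disconnection_commute: "disconnection G X A B \<longleftrightarrow> disconnection G X B A"
  unfolding disconnection_def using adj_commute[of G] by blast

lemma adj_induced: "adj (induced G S) u v \<longleftrightarrow> adj G u v \<and> u \<in> S \<and> v \<in> S"
  by (auto simp: adj_def edges_within_def)

lemma adj_delete_edge: "adj G u v \<Longrightarrow> ends G e \<noteq> {u, v} \<Longrightarrow> adj (delete_edges G {e}) u v"
  by (auto simp: adj_def)

lemma connected_on_iff_reachable: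
  "connected_on G X \<longleftrightarrow>
     X \<noteq> {} \<and> (\<forall>u\<in>X. \<forall>v\<in>X. (u, v) \<in> {(a, b). adj G a b \<and> a \<in> X \<and> b \<in> X}\<^sup>*)"
proof -
  have "adjacency (induced G X) (edges (induced G X)) = {(a, b). adj G a b \<and> a \<in> X \<and> b \<in> X}"
    by (auto simp: adjacency_def adj_def edges_within_def)
  then show ?thesis by (simp add: connected_on_def connected_multigraph_def)
qed

lemma connected_on_nonempty: "connected_on G X \<Longrightarrow> X \<noteq> {}"
  by (simp add: connected_on_iff_reachable)

lemma connected_on_closed_subset:
  assumes "connected_on G X" and "C \<inter> X \<noteq> {}"
    and "\<And>a b. a \<in> C \<Longrightarrow> a \<in> X \<Longrightarrow> b \<in> X \<Longrightarrow> adj G a b \<Longrightarrow> b \<in> C"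
  shows "X \<subseteq> C"
proof
  fix v assume "v \<in> X"
  obtain u where u: "u \<in> C" "u \<in> X" using assms(2) by blast
  then have "(u, v) \<in> {(a, b). adj G a b \<and> a \<in> X \<and> b \<in> X}\<^sup>*"
    using assms(1) \<open>v \<in> X\<close> by (simp add: connected_on_iff_reachable)
  then show "v \<in> C"
    by (induction rule: rtrancl_induct) (use u assms(3) in auto)
qed

lemma connected_onI:
  assumes "X \<noteq> {}"
    and closed: "\<And>C. C \<subseteq> X \<Longrightarrow> C \<noteq> {} \<Longrightarrow>
      (\<And>a b. a \<in> C \<Longrightarrow> b \<in> X \<Longrightarrow> adj G a b \<Longrightarrow> b \<in> C) \<Longrightarrow> X \<subseteq> C"
  shows "connected_on G X"
  unfolding connected_on_iff_reachable
proof (intro conjI ballI)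
  fix u v assume "u \<in> X" "v \<in> X"
  let ?R = "{(a, b). adj G a b \<and> a \<in> X \<and> b \<in> X}"
  have "X \<subseteq> {b \<in> X. (u, b) \<in> ?R\<^sup>*}"
    by (rule closed) (use \<open>u \<in> X\<close> in \<open>auto intro: rtrancl_into_rtrancl\<close>)
  then show "(u, v) \<in> ?R\<^sup>*" using \<open>v \<in> X\<close> by blast
qed (rule assms(1))

lemma connected_on_crossing:
  assumes "connected_on G X" "C \<subseteq> X" "C \<noteq> {}" "C \<noteq> X"
  obtains a b where "a \<in> C" "b \<in> X - C" "adj G a b"
  using connected_on_closed_subset[OF assms(1), of C] assms(2-4) by blast

lemma connected_on_disjoint_or_subset:
  assumes "connected_on G X" and "\<And>a b. a \<in> C \<Longrightarrow> b \<in> X \<Longrightarrow> adj G a b \<Longrightarrow> b \<in> C"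
  shows "X \<subseteq> C \<or> C \<inter> X = {}"
  using connected_on_closed_subset[OF assms(1), of C] assms(2) by blast

lemma connected_on_singleton [simp]: "connected_on G {x}"
  by (rule connected_onI) auto

lemma connected_on_adj: "adj G a b \<Longrightarrow> connected_on G {a, b}"
  by (rule connected_onI) (use adj_commute[of G a b] in blast)+

lemma connected_on_neighbour:
  assumes "connected_on G X" "v \<in> X" "X \<noteq> {v}"
  obtains b where "b \<in> X - {v}" "adj G v b"
  using connected_on_crossing[OF assms(1), of "{v}"] assms(2,3) by auto

text \<open>Edges of \<open>G\<close> may be replaced in \<open>H\<close> by connected detours through \<open>Y\<close>.\<close>

lemma connected_on_detours:
  assumes G: "connected_on G X" and "X \<subseteq> Y"
    and edge: "\<And>a b. a \<in> X \<Longrightarrow> b \<in> X \<Longrightarrow> adj G a b \<Longrightarrow> \<exists>C\<subseteq>Y. connected_on H C \<and> a \<in> C \<and> b \<in> C"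
    and vertex: "\<And>y. y \<in> Y \<Longrightarrow> \<exists>C\<subseteq>Y. connected_on H C \<and> y \<in> C \<and> C \<inter> X \<noteq> {}"
  shows "connected_on H Y"
proof (rule connected_onI)
  show "Y \<noteq> {}" using connected_on_nonempty[OF G] \<open>X \<subseteq> Y\<close> by blast
  fix K assume K: "K \<subseteq> Y" "K \<noteq> {}" "\<And>a b. a \<in> K \<Longrightarrow> b \<in> Y \<Longrightarrow> adj H a b \<Longrightarrow> b \<in> K"
  have absorb: "C \<subseteq> K" if "connected_on H C" "C \<subseteq> Y" "C \<inter> K \<noteq> {}" for C
    using connected_on_disjoint_or_subset[OF that(1), of K] K(3) that(2,3) by blast
  obtain k where "k \<in> K" using K(2) by blast
  then obtain C where "C \<subseteq> Y" "connected_on H C" "k \<in> C" "C \<inter> X \<noteq> {}"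
    using vertex[of k] K(1) by blast
  then have "K \<inter> X \<noteq> {}" using absorb[of C] \<open>k \<in> K\<close> by blast
  have "X \<subseteq> K"
  proof (rule connected_on_closed_subset[OF G])
    fix a b assume "a \<in> K" "a \<in> X" "b \<in> X" "adj G a b"
    then obtain C where "C \<subseteq> Y" "connected_on H C" "a \<in> C" "b \<in> C" using edge by meson
    then show "b \<in> K" using absorb[of C] \<open>a \<in> K\<close> by blast
  qed (rule \<open>K \<inter> X \<noteq> {}\<close>)
  show "Y \<subseteq> K"
  proof
    fix y assume "y \<in> Y"
    then obtain C where "C \<subseteq> Y" "connected_on H C" "y \<in> C" "C \<inter> X \<noteq> {}"
      using vertex by meson
    then show "y \<in> K" using absorb[of C] \<open>X \<subseteq> K\<close> by blast
  qed
qed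

lemma connected_on_mono:
  assumes "connected_on G X" "\<And>a b. a \<in> X \<Longrightarrow> b \<in> X \<Longrightarrow> adj G a b \<Longrightarrow> adj H a b"
  shows "connected_on H X"
proof (rule connected_on_detours[OF assms(1) subset_refl])
  show "\<exists>C\<subseteq>X. connected_on H C \<and> a \<in> C \<and> b \<in> C" if "a \<in> X" "b \<in> X" "adj G a b" for a b
    by (rule exI[of _ "{a, b}"]) (use that connected_on_adj[OF assms(2)[OF that]] in simp)
  show "\<exists>C\<subseteq>X. connected_on H C \<and> y \<in> C \<and> C \<inter> X \<noteq> {}" if "y \<in> X" for y
    by (rule exI[of _ "{y}"]) (use that in auto)
qed

lemma connected_on_cong:
  assumes "\<And>a b. a \<in> X \<Longrightarrow> b \<in> X \<Longrightarrow> adj G a b \<longleftrightarrow> adj H a b"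
  shows "connected_on G X \<longleftrightarrow> connected_on H X"
  using assms connected_on_mono[of G X H] connected_on_mono[of H X G] by blast

lemma connected_on_induced: "X \<subseteq> S \<Longrightarrow> connected_on (induced G S) X \<longleftrightarrow> connected_on G X"
  by (rule connected_on_cong) (auto simp: adj_induced)

lemma connected_on_Un:
  assumes "connected_on G X" "connected_on G Y" "X \<inter> Y \<noteq> {}"
  shows "connected_on G (X \<union> Y)"
proof (rule connected_onI)
  fix C assume C: "C \<subseteq> X \<union> Y" "C \<noteq> {}"
    "\<And>a b. a \<in> C \<Longrightarrow> b \<in> X \<union> Y \<Longrightarrow> adj G a b \<Longrightarrow> b \<in> C"
  have "X \<subseteq> C \<or> C \<inter> X = {}" "Y \<subseteq> C \<or> C \<inter> Y = {}"
    using connected_on_disjoint_or_subset[of G _ C] assms(1,2) C(3) by blast+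
  then show "X \<union> Y \<subseteq> C" using assms(3) C(1,2) by blast
qed (use assms(3) in blast)

lemma connected_on_Un_adj:
  assumes "connected_on G X" "connected_on G Y" "a \<in> X" "b \<in> Y" "adj G a b"
  shows "connected_on G (X \<union> Y)"
proof -
  have "connected_on G (X \<union> {a, b})"
    by (rule connected_on_Un) (use assms connected_on_adj in auto)
  then have "connected_on G (X \<union> {a, b} \<union> Y)"
    by (rule connected_on_Un) (use assms in auto)
  moreover have "X \<union> {a, b} \<union> Y = X \<union> Y" using assms(3,4) by blast
  ultimately show ?thesis by simp
qed

lemma connected_on_Un_closed:
  assumes X: "connected_on G X" and D: "connected_on G D" "D \<subseteq> X" and "W \<subseteq> X"
    and closed: "\<And>a b. a \<in> W \<Longrightarrow> b \<in> X \<Longrightarrow> adj G a b \<Longrightarrow> b \<in> W \<union> D"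
  shows "connected_on G (D \<union> W)"
proof (rule connected_onI)
  show "D \<union> W \<noteq> {}" using connected_on_nonempty[OF D(1)] by blast
  fix C assume C: "C \<subseteq> D \<union> W" "C \<noteq> {}"
    "\<And>a b. a \<in> C \<Longrightarrow> b \<in> D \<union> W \<Longrightarrow> adj G a b \<Longrightarrow> b \<in> C"
  have "C \<inter> D \<noteq> {}"
  proof
    assume "C \<inter> D = {}"
    then have "C \<subseteq> W" using C(1) by blast
    have "X \<subseteq> C"
      by (rule connected_on_closed_subset[OF X])
        (use C \<open>C \<subseteq> W\<close> \<open>W \<subseteq> X\<close> closed in blast)+
    then show False using \<open>C \<inter> D = {}\<close> D connected_on_nonempty by blast
  qed
  then have "D \<subseteq> C" using connected_on_disjoint_or_subset[OF D(1), of C] C(3) by blast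
  have "W \<subseteq> C"
  proof (rule ccontr)
    assume "\<not> W \<subseteq> C"
    have "X \<subseteq> W - C"
    proof (rule connected_on_closed_subset[OF X])
      fix a b assume "a \<in> W - C" "b \<in> X" "adj G a b"
      then show "b \<in> W - C"
        using closed[of a b] C(3)[of b a] \<open>D \<subseteq> C\<close> adj_commute[of G a b] by blast
    qed (use \<open>\<not> W \<subseteq> C\<close> \<open>W \<subseteq> X\<close> in blast)
    then show False using \<open>D \<subseteq> C\<close> D connected_on_nonempty by blast
  qed
  with \<open>D \<subseteq> C\<close> show "D \<union> W \<subseteq> C" by blast
qed

lemma connected_on_image:
  assumes "connected_on G X"
    and "\<And>a b. a \<in> X \<Longrightarrow> b \<in> X \<Longrightarrow> adj G a b \<Longrightarrow> h a = h b \<or> adj H (h a) (h b)"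
  shows "connected_on H (h ` X)"
proof (rule connected_onI)
  show "h ` X \<noteq> {}" using connected_on_nonempty[OF assms(1)] by blast
  fix C assume C: "C \<subseteq> h ` X" "C \<noteq> {}"
    "\<And>a b. a \<in> C \<Longrightarrow> b \<in> h ` X \<Longrightarrow> adj H a b \<Longrightarrow> b \<in> C"
  have "X \<subseteq> h -` C"
  proof (rule connected_on_closed_subset[OF assms(1)])
    fix a b assume "a \<in> h -` C" "a \<in> X" "b \<in> X" "adj G a b"
    then show "b \<in> h -` C" using assms(2)[of a b] C(3)[of "h a" "h b"] by auto
  qed (use C(1,2) in blast)
  then show "h ` X \<subseteq> C" by blast
qed

lemma not_connected_onE:
  assumes "\<not> connected_on G X" "X \<noteq> {}"
  obtains A B where "disconnection G X A B"
proof -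
  obtain C where C: "C \<subseteq> X" "C \<noteq> {}" "\<not> X \<subseteq> C" "\<And>a b. a \<in> C \<Longrightarrow> b \<in> X \<Longrightarrow> adj G a b \<Longrightarrow> b \<in> C"
    using connected_onI[of X G] assms by blast
  then have "disconnection G X C (X - C)" by (auto simp: disconnection_def)
  then show thesis by (rule that)
qed

section \<open>Two-connected multigraphs\<close>

lemma multigraph_finite:
  assumes "multigraph G"
  shows "finite (verts G)" "finite (edges G)" "finite (edges_within G S)"
  using assms finite_subset[OF edges_within_subset] by (auto simp: multigraph_def)

lemma multigraph_ends:
  assumes "multigraph G" "e \<in> edges G"
  shows "ends G e \<subseteq> verts G" "card (ends G e) = 2"
  using assms by (auto simp: multigraph_def)

lemma multigraph_endsE:
  assumes "multigraph G" "e \<in> edges G"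
  obtains a b where "ends G e = {a, b}" "a \<noteq> b" "a \<in> verts G" "b \<in> verts G"
  using multigraph_ends[OF assms] by (metis card_2_iff insert_subset)

lemma multigraph_ends_eq:
  assumes "multigraph G" "e \<in> edges G" "ends G e \<subseteq> {a, b}"
  shows "ends G e = {a, b}"
  using assms(3) multigraph_ends(2)[OF assms(1,2)]
  by (intro card_seteq) (simp_all add: card_insert_if)

lemma multigraph_other_end:
  assumes "multigraph G" "e \<in> edges G" "p \<in> ends G e"
  obtains c where "ends G e = {p, c}" "c \<noteq> p" "c \<in> verts G"
proof -
  obtain a b where "ends G e = {a, b}" "a \<noteq> b" "a \<in> verts G" "b \<in> verts G"
    by (rule multigraph_endsE[OF assms(1,2)])
  then show thesis using that[of a] that[of b] assms(3) by (auto simp: insert_commute)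
qed

lemma multigraph_ends_two_verts:
  assumes "multigraph G" "card (verts G) = 2" "e \<in> edges G"
  shows "ends G e = verts G"
  using assms by (metis card_subset_eq multigraph_ends multigraph_finite(1))

lemma multigraph_adj:
  assumes "multigraph G" "adj G a b"
  shows "a \<in> verts G" "b \<in> verts G" "a \<noteq> b"
  using assms by (auto simp: adj_def dest: multigraph_ends)

lemma multigraph_induced: "multigraph G \<Longrightarrow> S \<subseteq> verts G \<Longrightarrow> multigraph (induced G S)"
  by (auto simp: multigraph_def edges_within_def intro: finite_subset)

lemma multigraph_delete_edges: "multigraph G \<Longrightarrow> multigraph (delete_edges G F)"
  by (auto simp: multigraph_def)

lemma connected_multigraph_iff_connected_on:
  assumes "multigraph G"
  shows "connected_multigraph G \<longleftrightarrow> connected_on G (verts G)"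
proof -
  have "edges_within G (verts G) = edges G"
    using multigraph_ends(1)[OF assms] by (auto simp: edges_within_def)
  then have "adjacency (induced G (verts G)) (edges_within G (verts G)) = adjacency G (edges G)"
    by (simp add: adjacency_def)
  then show ?thesis
    using \<open>edges_within G (verts G) = edges G\<close>
    by (simp add: connected_on_def connected_multigraph_def)
qed

lemma two_connected_multigraph: "two_connected G \<Longrightarrow> multigraph G"
  by (simp add: two_connected_def)

lemma two_connected_finite:
  assumes "two_connected G"
  shows "finite (verts G)" "finite (edges G)"
  using multigraph_finite[OF two_connected_multigraph[OF assms]] by simp_all

lemma two_connected_card_verts: "two_connected G \<Longrightarrow> 2 \<le> card (verts G)"
  by (simp add: two_connected_def)

lemma two_connected_connected_on:
  assumes "two_connected G"
  shows "connected_on G (verts G)"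
    and "v \<in> verts G \<Longrightarrow> connected_on G (verts G - {v})"
    and "e \<in> edges G \<Longrightarrow> connected_on (delete_edges G {e}) (verts G)"
  using assms connected_multigraph_iff_connected_on[of G]
    connected_multigraph_iff_connected_on[OF multigraph_delete_edges, of G "{e}"]
  by (auto simp: two_connected_def connected_on_def)

lemma two_connected_degree:
  assumes "two_connected G" "v \<in> verts G"
  shows "2 \<le> degree G v"
proof -
  have "verts G \<noteq> {v}" using two_connected_card_verts[OF assms(1)] by auto
  then have edge_at: "\<exists>e\<in>edges H. v \<in> ends H e" if "connected_on H (verts G)"
    for H :: "('a, 'b) pre_multigraph"
    using connected_on_neighbour[OF that assms(2)] by (metis adj_def insertI1)
  from edge_at[OF two_connected_connected_on(1)[OF assms(1)]]
  obtain e where e: "e \<in> edges G" "v \<in> ends G e" by blast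
  from edge_at[OF two_connected_connected_on(3)[OF assms(1) e(1)]]
  obtain f where "f \<in> edges G" "f \<noteq> e" "v \<in> ends G f" by auto
  then have "card {e, f} \<le> degree G v"
    unfolding degree_def using e two_connected_finite[OF assms(1)] by (intro card_mono) auto
  with \<open>f \<noteq> e\<close> show ?thesis by simp
qed

lemma degree_le_card_edges: "multigraph G \<Longrightarrow> degree G v \<le> card (edges G)"
  unfolding degree_def by (intro card_mono) (auto simp: multigraph_finite)

lemma two_connected_card_edges:
  assumes "two_connected G"
  shows "2 \<le> card (edges G)"
proof -
  obtain v where "v \<in> verts G" using two_connected_card_verts[OF assms] by fastforce
  then show ?thesis
    using two_connected_degree[OF assms] degree_le_card_edges two_connected_multigraph[OF assms]
    by (meson order_trans)
qed

lemma two_connected_iff_two_verts: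
  assumes G: "multigraph G" and "card (verts G) = 2"
  shows "two_connected G \<longleftrightarrow> 2 \<le> card (edges G)"
proof
  assume edges_ge2: "2 \<le> card (edges G)"
  obtain a b where verts_G: "verts G = {a, b}" "a \<noteq> b" using assms(2) by (meson card_2_iff)
  have "adj H a b"
    if "edges H \<noteq> {}" "edges H \<subseteq> edges G" "ends H = ends G" for H :: "('a, 'b) pre_multigraph"
    using that verts_G multigraph_ends_two_verts[OF assms] by (fastforce simp: adj_def)
  then have connected: "connected_on H {a, b}"
    if "edges H \<noteq> {}" "edges H \<subseteq> edges G" "ends H = ends G" for H :: "('a, 'b) pre_multigraph"
    using that connected_on_adj[of H a b] by blast
  have "edges G - {e} \<noteq> {}" for e
    using edges_ge2 card_mono[of "{e}" "edges G"] by fastforce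
  then have "connected_on (delete_edges G {e}) {a, b}" for e by (intro connected) auto
  moreover have "connected_on G {a, b}" using edges_ge2 by (intro connected) auto
  moreover have "connected_on G (verts G - {v})" if "v \<in> verts G" for v
    using that verts_G by (auto simp: insert_Diff_if)
  ultimately show "two_connected G"
    using G assms(2) verts_G(1) multigraph_delete_edges[OF G]
    by (auto simp: two_connected_def connected_multigraph_iff_connected_on
        simp flip: connected_on_def)
qed (rule two_connected_card_edges)

lemma third_element:
  assumes "3 \<le> card X"
  obtains z where "z \<in> X" "z \<noteq> a" "z \<noteq> b"
proof -
  have "\<not> X \<subseteq> {a, b}"
    using assms card_mono[of "{a, b}" X] by (auto simp: card_insert_if split: if_splits)
  then show thesis using that by blast
qed

lemma two_connected_iff_ge3_verts:
  assumes G: "multigraph G" and ge3: "3 \<le> card (verts G)"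
  shows "two_connected G \<longleftrightarrow> (\<forall>v\<in>verts G. connected_on G (verts G - {v}))"
proof
  assume cut: "\<forall>v\<in>verts G. connected_on G (verts G - {v})"
  have union: "connected_on H (verts G)" if "a \<in> verts G" "b \<in> verts G" "a \<noteq> b"
    "connected_on H (verts G - {a})" "connected_on H (verts G - {b})"
    for a b and H :: "('a, 'b) pre_multigraph"
  proof -
    obtain z where "z \<in> verts G" "z \<noteq> a" "z \<noteq> b" using third_element[OF ge3] .
    then have "connected_on H ((verts G - {a}) \<union> (verts G - {b}))"
      by (intro connected_on_Un that) auto
    moreover have "(verts G - {a}) \<union> (verts G - {b}) = verts G" using that by auto
    ultimately show ?thesis by simp
  qed
  have "connected_on (delete_edges G {e}) (verts G)" if "e \<in> edges G" for e
  proof -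
    obtain a b where ends_e: "ends G e = {a, b}" "a \<noteq> b" "a \<in> verts G" "b \<in> verts G"
      by (rule multigraph_endsE[OF G \<open>e \<in> edges G\<close>])
    have "connected_on (delete_edges G {e}) (verts G - {z})" if "z \<in> {a, b}" for z
      by (rule connected_on_mono[of G])
        (use cut ends_e that in \<open>auto simp: doubleton_eq_iff intro!: adj_delete_edge\<close>)
    then show ?thesis using union[OF ends_e(3,4,2)] by simp
  qed
  moreover have "connected_on G (verts G)"
  proof -
    obtain a b where "a \<in> verts G" "b \<in> verts G" "a \<noteq> b" using ge3 by (metis third_element)
    then show ?thesis using union cut by blast
  qed
  ultimately show "two_connected G"
    using G ge3 cut multigraph_delete_edges[OF G]
    by (simp add: two_connected_def connected_multigraph_iff_connected_on flip: connected_on_def)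
qed (simp add: two_connected_connected_on)

lemma two_connected_iff:
  assumes "multigraph G"
  shows "two_connected G \<longleftrightarrow> card (verts G) = 2 \<and> 2 \<le> card (edges G) \<or>
    3 \<le> card (verts G) \<and> (\<forall>v\<in>verts G. connected_on G (verts G - {v}))"
proof -
  consider (small) "card (verts G) < 2" | "card (verts G) = 2" | "3 \<le> card (verts G)" by linarith
  then show ?thesis
  proof cases
    case small
    then show ?thesis using two_connected_card_verts[of G] by auto
  qed (use assms two_connected_iff_two_verts two_connected_iff_ge3_verts in auto)
qed

lemma two_connected_cong:
  assumes "multigraph G" "multigraph H" "verts G = verts H" "card (edges G) = card (edges H)"
    and adj: "\<And>a b. a \<in> verts G \<Longrightarrow> b \<in> verts G \<Longrightarrow> adj G a b \<longleftrightarrow> adj H a b"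
  shows "two_connected G \<longleftrightarrow> two_connected H"
proof -
  have "connected_on G (verts G - {v}) \<longleftrightarrow> connected_on H (verts G - {v})" for v
    by (rule connected_on_cong) (simp add: adj)
  then show ?thesis using assms(3,4) by (simp add: two_connected_iff assms(1,2))
qed

lemma two_connected_induced_iff:
  assumes "multigraph G" "S \<subseteq> verts G"
  shows "two_connected (induced G S) \<longleftrightarrow> card S = 2 \<and> 2 \<le> card (edges_within G S) \<or>
    3 \<le> card S \<and> (\<forall>v\<in>S. connected_on G (S - {v}))"
  by (simp add: two_connected_iff multigraph_induced[OF assms] connected_on_induced Diff_subset)

lemma two_connected_induced_connected_on:
  assumes "two_connected (induced G S)"
  shows "connected_on G S" "v \<in> S \<Longrightarrow> connected_on G (S - {v})"
  using two_connected_connected_on(1,2)[OF assms]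
  by (simp_all add: connected_on_induced Diff_subset)

lemma connected_on_insert_separated_part:
  assumes G: "two_connected G" and verts_ab: "a \<in> verts G" "b \<in> verts G" "a \<noteq> b"
    and separation: "disconnection G (verts G - {a, b}) W U"
  shows "connected_on G (insert a W)"
proof -
  have "connected_on G ({a} \<union> W)"
  proof (rule connected_on_Un_closed)
    show "connected_on G (verts G - {b})" using G verts_ab(2) by (rule two_connected_connected_on)
  qed (use verts_ab separation in \<open>auto simp: disconnection_def\<close>)
  then show ?thesis by simp
qed

section \<open>Deletion, contraction and good flats\<close>

definition spans :: "('v, 'e) pre_multigraph \<Rightarrow> 'e set \<Rightarrow> 'v set \<Rightarrow> bool" where
  "spans G F S \<longleftrightarrow> F \<subseteq> edges_within G S \<and>
     connected_multigraph \<lparr>verts = S, edges = F, ends = ends G\<rparr>"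

lemma spans_edges_within: "connected_on G S \<Longrightarrow> spans G (edges_within G S) S"
  by (simp add: spans_def connected_on_def induced_def)

lemma spans_edge:
  assumes "e \<in> edges G" "ends G e = {a, b}"
  shows "spans G {e} {a, b}"
  using assms
  by (auto simp: spans_def edges_within_def connected_multigraph_def adjacency_def insert_commute)

locale contracted_set =
  fixes G :: "('v, 'e) pre_multigraph" and F :: "'e set" and S :: "'v set"
  assumes multigraph: "multigraph G" and S_subset: "S \<subseteq> verts G" and spans: "spans G F S"
begin

definition class_of :: "'v \<Rightarrow> 'v set" where
  "class_of v = (if v \<in> S then S else {v})"

lemma S_nonempty: "S \<noteq> {}"
  using spans by (simp add: spans_def connected_multigraph_def)

lemma F_subset: "F \<subseteq> edges_within G S"
  using spans by (simp add: spans_def)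

lemma reachable_class: "(adjacency G F)\<^sup>* `` {v} = class_of v"
proof -
  have step: "a \<in> S \<and> b \<in> S" if "(a, b) \<in> adjacency G F" for a b
    using that F_subset by (auto simp: adjacency_def edges_within_def)
  have "b \<in> class_of v" if "(v, b) \<in> (adjacency G F)\<^sup>*" for b
    using that
    by (induction rule: rtrancl_induct)
      (auto simp: class_of_def dest: step split: if_splits)
  moreover have "(v, b) \<in> (adjacency G F)\<^sup>*" if "v \<in> S" "b \<in> S" for b
    using that spans by (simp add: spans_def connected_multigraph_def adjacency_def)
  ultimately show ?thesis by (auto simp: class_of_def)
qed

lemma contract_sel:
  "verts (contract G F) = class_of ` verts G"
  "edges (contract G F) = edges G - F"
  "ends (contract G F) e = class_of ` ends G e"
  by (simp_all add: contract_def Let_def reachable_class)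

lemma verts_contract: "verts (contract G F) = insert S ((\<lambda>v. {v}) ` (verts G - S))"
  using S_subset S_nonempty by (auto simp: contract_sel class_of_def image_iff)

lemma card_verts_contract: "card (verts (contract G F)) = Suc (card (verts G - S))"
proof -
  have "S \<notin> (\<lambda>v. {v}) ` (verts G - S)" by auto
  then show ?thesis
    using multigraph_finite(1)[OF multigraph] by (simp add: verts_contract card_image)
qed

lemma multigraph_contract_iff: "multigraph (contract G F) \<longleftrightarrow> F = edges_within G S"
proof
  assume C: "multigraph (contract G F)"
  have "e \<in> F" if "e \<in> edges_within G S" for e
  proof (rule ccontr)
    assume "e \<notin> F"
    then have "card (ends (contract G F) e) = 2"
      using that multigraph_ends(2)[OF C] by (simp add: contract_sel edges_within_def)
    moreover have "ends (contract G F) e \<subseteq> {S}"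
      using that by (auto simp: contract_sel class_of_def edges_within_def)
    ultimately show False using card_mono[of "{S}" "ends (contract G F) e"] by simp
  qed
  then show "F = edges_within G S" using F_subset by blast
next
  assume F: "F = edges_within G S"
  have "ends (contract G F) e \<subseteq> verts (contract G F) \<and> card (ends (contract G F) e) = 2"
    if e: "e \<in> edges (contract G F)" for e
  proof -
    have "e \<in> edges G" using e by (simp add: contract_sel)
    then obtain a b where ends_e: "ends G e = {a, b}" "a \<noteq> b" "a \<in> verts G" "b \<in> verts G"
      by (rule multigraph_endsE[OF multigraph])
    then have "\<not> (a \<in> S \<and> b \<in> S)" using e F contract_sel(2) by (auto simp: edges_within_def)
    then have "class_of a \<noteq> class_of b" using ends_e(2) by (auto simp: class_of_def)
    then show ?thesis using ends_e by (auto simp: contract_sel)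
  qed
  moreover have "finite (verts (contract G F))" "finite (edges (contract G F))"
    using multigraph_finite[OF multigraph] by (simp_all add: contract_sel)
  ultimately show "multigraph (contract G F)" by (simp add: multigraph_def)
qed

lemma adj_contract:
  assumes "adj G a b"
  shows "class_of a = class_of b \<or> adj (contract G F) (class_of a) (class_of b)"
proof -
  obtain e where e: "e \<in> edges G" "ends G e = {a, b}" using assms by (auto simp: adj_def)
  show ?thesis
  proof (cases "e \<in> F")
    case True
    then have "{a, b} \<subseteq> S" using F_subset e by (auto simp: edges_within_def)
    then show ?thesis by (simp add: class_of_def)
  next
    case False
    then have "e \<in> edges (contract G F)" "ends (contract G F) e = {class_of a, class_of b}"
      using e by (simp_all add: contract_sel)
    then show ?thesis by (blast intro: adjI)
  qed
qed

lemma adj_contract_outside: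
  assumes "adj (contract G F) {a} {b}" "a \<notin> S" "b \<notin> S"
  shows "adj G a b"
proof -
  obtain e where e: "e \<in> edges G" "class_of ` ends G e = {{a}, {b}}"
    using assms(1) by (auto simp: adj_def contract_sel)
  obtain c d where ends_e: "ends G e = {c, d}" by (rule multigraph_endsE[OF multigraph e(1)])
  have "c \<notin> S" "d \<notin> S"
    using e(2) assms(2,3) by (auto simp: ends_e class_of_def doubleton_eq_iff split: if_splits)
  then have "{c, d} = {a, b}" using e(2) by (auto simp: ends_e class_of_def doubleton_eq_iff)
  then show ?thesis using e(1) ends_e by (blast intro: adjI)
qed

lemma connected_on_contract_outside:
  "connected_on (contract G F) (verts (contract G F) - {S}) \<longleftrightarrow> connected_on G (verts G - S)"
proof -
  have verts_outside: "verts (contract G F) - {S} = (\<lambda>v. {v}) ` (verts G - S)"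
    unfolding verts_contract by auto
  show ?thesis
  proof
    assume "connected_on (contract G F) (verts (contract G F) - {S})"
    then have "connected_on G (the_elem ` (verts (contract G F) - {S}))"
      by (rule connected_on_image) (auto simp: verts_outside intro: adj_contract_outside)
    then show "connected_on G (verts G - S)" by (simp add: verts_outside image_image)
  next
    assume "connected_on G (verts G - S)"
    then show "connected_on (contract G F) (verts (contract G F) - {S})"
      unfolding verts_outside
      by (rule connected_on_image) (use adj_contract in \<open>force simp: class_of_def\<close>)
  qed
qed

lemma connected_on_contract_remove:
  assumes "p \<in> verts G - S" "connected_on G (verts G - {p})"
  shows "connected_on (contract G F) (verts (contract G F) - {{p}})"
proof -
  have "verts (contract G F) - {{p}} = class_of ` (verts G - {p})"
    using assms(1) S_subset S_nonempty
    by (auto simp: contract_sel class_of_def split: if_splits)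
  moreover have "connected_on (contract G F) (class_of ` (verts G - {p}))"
    by (rule connected_on_image[OF assms(2)]) (rule adj_contract)
  ultimately show ?thesis by simp
qed

lemma edges_contract_single_outside:
  assumes "F = edges_within G S" "verts G - S = {p}"
  shows "edges (contract G F) = {e \<in> edges G. p \<in> ends G e}"
proof -
  have "verts G \<subseteq> insert p S" "p \<notin> S" using assms(2) by blast+
  then have "\<not> ends G e \<subseteq> S \<longleftrightarrow> p \<in> ends G e" if "e \<in> edges G" for e
    using multigraph_ends(1)[OF multigraph that] by blast
  then show ?thesis unfolding contract_sel(2) using assms(1) by (auto simp: edges_within_def)
qed

lemma two_connected_contract_single_outside:
  assumes G: "two_connected G" and F: "F = edges_within G S" and outside: "verts G - S = {p}"
  shows "two_connected (contract G F)"
proof -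
  have "2 \<le> card (edges (contract G F))"
    using two_connected_degree[OF G, of p] outside edges_contract_single_outside[OF F outside]
    by (auto simp: degree_def)
  moreover have "card (verts (contract G F)) = 2" unfolding card_verts_contract outside by simp
  moreover have "multigraph (contract G F)" using F multigraph_contract_iff by blast
  ultimately show ?thesis by (simp add: two_connected_iff_two_verts)
qed

lemma two_connected_contract_iff_outside_ge2:
  assumes G: "two_connected G" and F: "F = edges_within G S" and outside: "2 \<le> card (verts G - S)"
  shows "two_connected (contract G F) \<longleftrightarrow> connected_on G (verts G - S)"
proof -
  have "connected_on (contract G F) (verts (contract G F) - {{p}})" if "p \<in> verts G - S" for p
    using that connected_on_contract_remove two_connected_connected_on(2)[OF G] by simp
  then have "(\<forall>v\<in>verts (contract G F). connected_on (contract G F) (verts (contract G F) - {v}))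
      \<longleftrightarrow> connected_on G (verts G - S)"
    unfolding verts_contract connected_on_contract_outside[unfolded verts_contract, symmetric]
    by auto
  moreover have "3 \<le> card (verts (contract G F))"
    unfolding card_verts_contract using outside by simp
  moreover have "multigraph (contract G F)" using F multigraph_contract_iff by blast
  ultimately show ?thesis using two_connected_iff_ge3_verts by blast
qed

lemma two_connected_contract_iff:
  assumes G: "two_connected G"
  shows "two_connected (contract G F) \<longleftrightarrow>
    F = edges_within G S \<and> connected_on G (verts G - S)"
proof (cases "F = edges_within G S")
  case F: True
  consider (empty) "card (verts G - S) = 0" | (single) "card (verts G - S) = 1"
    | (large) "2 \<le> card (verts G - S)" by linarith
  then show ?thesis
  proof cases
    case empty
    then have "\<not> two_connected (contract G F)"
      using two_connected_card_verts[of "contract G F"] unfolding card_verts_contract by auto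
    moreover have "verts G - S = {}"
      using empty multigraph_finite(1)[OF multigraph] by (simp only: card_0_eq finite_Diff)
    ultimately show ?thesis using connected_on_nonempty by metis
  next
    case single
    then obtain p where p: "verts G - S = {p}" by (rule card_1_singletonE)
    then have "connected_on G (verts G - S)" by (simp only: connected_on_singleton)
    then show ?thesis using two_connected_contract_single_outside[OF G F p] F by blast
  next
    case large
    then show ?thesis using two_connected_contract_iff_outside_ge2[OF G F] F by blast
  qed
next
  case False
  then show ?thesis using two_connected_multigraph multigraph_contract_iff by blast
qed

end

lemma good_flat_iff:
  assumes G: "two_connected G"
  shows "good_flat G S \<longleftrightarrow>
    S \<subset> verts G \<and> two_connected (induced G S) \<and> connected_on G (verts G - S)"
proof -
  have "two_connected (contract G (edges_within G S)) \<longleftrightarrow> connected_on G (verts G - S)"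
    if "S \<subset> verts G" "two_connected (induced G S)"
  proof -
    have "contracted_set G (edges_within G S) S"
      using that two_connected_induced_connected_on(1) spans_edges_within
        two_connected_multigraph[OF G]
      by (intro contracted_set.intro) auto
    then show ?thesis using contracted_set.two_connected_contract_iff[OF _ G] by blast
  qed
  then show ?thesis by (auto simp: good_flat_def)
qed

lemma good_flat_psubset: "good_flat G S \<Longrightarrow> S \<subset> verts G"
  by (simp add: good_flat_def)

lemma good_flat_two_connected: "good_flat G S \<Longrightarrow> two_connected (induced G S)"
  by (simp add: good_flat_def)

lemma good_flat_card: "good_flat G S \<Longrightarrow> 2 \<le> card S"
  using two_connected_card_verts[OF good_flat_two_connected] by simp

lemma two_connected_contract_edge_iff:
  assumes G: "two_connected G" and e: "e \<in> edges G"
  shows "two_connected (contract G {e}) \<longleftrightarrow>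
    edges_within G (ends G e) = {e} \<and> connected_on G (verts G - ends G e)"
proof -
  note multigraph_G = two_connected_multigraph[OF G]
  obtain a b where ends_e: "ends G e = {a, b}" by (rule multigraph_endsE[OF multigraph_G e])
  interpret contracted_set G "{e}" "{a, b}"
    by unfold_locales
      (use multigraph_G multigraph_ends(1)[OF multigraph_G e] ends_e spans_edge[OF e ends_e] in auto)
  show ?thesis using two_connected_contract_iff[OF G] by (auto simp: ends_e)
qed

lemma connected_on_delete_edge_detour:
  assumes G: "connected_on G X" and "C \<subseteq> X" "connected_on (delete_edges G {e}) C" "ends G e \<subseteq> C"
  shows "connected_on (delete_edges G {e}) X"
proof (rule connected_on_detours[OF G subset_refl])
  show "\<exists>D\<subseteq>X. connected_on (delete_edges G {e}) D \<and> p \<in> D \<and> q \<in> D"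
    if pq: "p \<in> X" "q \<in> X" "adj G p q" for p q
  proof (cases "ends G e = {p, q}")
    case True
    then show ?thesis using assms(2-4) by auto
  next
    case False
    then show ?thesis
      using pq connected_on_adj[OF adj_delete_edge[OF pq(3) False]]
      by (intro exI[of _ "{p, q}"]) auto
  qed
  show "\<exists>D\<subseteq>X. connected_on (delete_edges G {e}) D \<and> y \<in> D \<and> D \<inter> X \<noteq> {}" if "y \<in> X" for y
    by (rule exI[of _ "{y}"]) (use that in auto)
qed

text \<open>Suppose that \<open>{a, b}\<close> separates \<open>G\<close> and that \<open>z\<close> is another vertex. A part of
  \<open>G - {a, b}\<close> avoiding \<open>z\<close> is a detour replacing the edge \<open>e\<close> between \<open>a\<close> and \<open>b\<close>.\<close>

lemma connected_on_delete_separating_edge: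
  assumes G: "two_connected G" and ends_e: "ends G e = {a, b}" "a \<in> verts G" "b \<in> verts G" "a \<noteq> b"
    and separation: "disconnection G (verts G - {a, b}) W U" and z: "z \<in> verts G - {a, b}" "z \<notin> W"
  shows "connected_on (delete_edges G {e}) (verts G - {z})"
proof -
  let ?H = "delete_edges G {e}"
  have W: "W \<subseteq> verts G - {a, b}" "W \<noteq> {}" using separation by (auto simp: disconnection_def)
  have separation_commuted: "disconnection G (verts G - {b, a}) W U"
    using separation by (simp add: insert_commute)
  have "connected_on ?H (insert a W)"
    by (rule connected_on_mono[OF connected_on_insert_separated_part[
            OF G ends_e(2,3,4) separation]], rule adj_delete_edge)
      (use ends_e W in \<open>auto simp: doubleton_eq_iff\<close>)
  moreover have "connected_on ?H (insert b W)"
    by (rule connected_on_mono[OF connected_on_insert_separated_part[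
            OF G ends_e(3,2) ends_e(4)[symmetric] separation_commuted]], rule adj_delete_edge)
      (use ends_e W in \<open>auto simp: doubleton_eq_iff\<close>)
  ultimately have detour: "connected_on ?H (insert a W \<union> insert b W)"
    by (rule connected_on_Un) (use W in auto)
  have "connected_on G (verts G - {z})"
    using two_connected_connected_on(2)[OF G] z(1) by simp
  then show ?thesis
    by (rule connected_on_delete_edge_detour[OF _ _ detour]) (use ends_e W z in auto)
qed

lemma connected_on_delete_noncontractible_edge:
  assumes G: "two_connected G" and e: "e \<in> edges G" "\<not> two_connected (contract G {e})"
    and z: "z \<in> verts G"
  shows "connected_on (delete_edges G {e}) (verts G - {z})"
proof -
  note multigraph_G = two_connected_multigraph[OF G]
  let ?H = "delete_edges G {e}"
  obtain a b where ends_e: "ends G e = {a, b}" "a \<noteq> b" "a \<in> verts G" "b \<in> verts G"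
    by (rule multigraph_endsE[OF multigraph_G e(1)])
  show ?thesis
  proof (cases "z \<in> {a, b} \<or> edges_within G {a, b} \<noteq> {e}")
    case True
    have "adj ?H p q" if pq: "p \<in> verts G - {z}" "q \<in> verts G - {z}" "adj G p q" for p q
    proof (cases "ends G e = {p, q}")
      case True
      then obtain f where "f \<in> edges_within G {a, b}" "f \<noteq> e"
        using pq ends_e e(1) \<open>z \<in> {a, b} \<or> _\<close> by (auto simp: edges_within_def doubleton_eq_iff)
      then show ?thesis
        using True ends_e multigraph_ends_eq[OF multigraph_G, of f a b]
        by (auto simp: adj_def edges_within_def)
    qed (rule adj_delete_edge[OF pq(3)])
    then show ?thesis using connected_on_mono two_connected_connected_on(2)[OF G z] by blast
  next
    case False
    then have "\<not> connected_on G (verts G - {a, b})"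
      using e(2) two_connected_contract_edge_iff[OF G e(1)] ends_e by simp
    then obtain W U where "disconnection G (verts G - {a, b}) W U"
      by (rule not_connected_onE) (use False z in auto)
    moreover from this have "disconnection G (verts G - {a, b}) U W" "z \<notin> W \<or> z \<notin> U"
      by (simp_all add: disconnection_commute) (auto simp: disconnection_def)
    ultimately show ?thesis
      using connected_on_delete_separating_edge[OF G ends_e(1,3,4,2)] z False by blast
  qed
qed

lemma two_connected_delete_or_contract:
  assumes G: "two_connected G" and e: "e \<in> edges G" and edges_ge3: "3 \<le> card (edges G)"
  shows "two_connected (delete_edges G {e}) \<or> two_connected (contract G {e})"
proof (rule disjCI)
  assume not_contract: "\<not> two_connected (contract G {e})"
  have H: "multigraph (delete_edges G {e})"
    by (rule multigraph_delete_edges[OF two_connected_multigraph[OF G]])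
  show "two_connected (delete_edges G {e})"
  proof (cases "card (verts G) = 2")
    case True
    then show ?thesis
      using edges_ge3 e two_connected_finite[OF G] by (simp add: two_connected_iff_two_verts[OF H])
  next
    case False
    then have "3 \<le> card (verts G)" using two_connected_card_verts[OF G] by linarith
    then show ?thesis
      using connected_on_delete_noncontractible_edge[OF G e not_contract]
      by (simp add: two_connected_iff_ge3_verts[OF H])
  qed
qed

section \<open>Weights and isomorphisms\<close>

definition tight :: "nat \<Rightarrow> ('v, 'e) pre_multigraph \<Rightarrow> ('e \<Rightarrow> nat) \<Rightarrow> 'v set \<Rightarrow> bool" where
  "tight \<delta> G w S \<longleftrightarrow> sum w (edges_within G S) + 1 = \<delta> * (card S - 1)"

text \<open>The requirements of \<open>weight_function\<close> on deletable and contractible edges are omitted: for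
  \<open>\<delta> > 2\<close> they follow, and without them the notion is inherited by both sides of a two-separation.\<close>

definition balanced :: "nat \<Rightarrow> ('v, 'e) pre_multigraph \<Rightarrow> ('e \<Rightarrow> nat) \<Rightarrow> bool" where
  "balanced \<delta> G w \<longleftrightarrow> (\<forall>e\<in>edges G. w e \<in> {1, \<delta> - 1}) \<and>
     sum w (edges G) = \<delta> * (card (verts G) - 1) \<and> (\<forall>S. good_flat G S \<longrightarrow> tight \<delta> G w S)"

definition spade_weighting :: "nat \<Rightarrow> ('v, 'e) pre_multigraph \<Rightarrow> ('e \<Rightarrow> nat) \<Rightarrow> bool" where
  "spade_weighting \<delta> G w \<longleftrightarrow> weight_function \<delta> G w \<and> balanced \<delta> G w"

lemma spade_iff_ex_weighting: "spade \<delta> G \<longleftrightarrow> (\<exists>w. spade_weighting \<delta> G w)"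
  unfolding spade_def spade_weighting_def balanced_def tight_def by (auto simp: weight_function_def)

lemma spade_weighting_cong:
  assumes "\<And>e. e \<in> edges G \<Longrightarrow> w e = w' e"
  shows "spade_weighting \<delta> G w \<longleftrightarrow> spade_weighting \<delta> G w'"
proof -
  have "sum w F = sum w' F" if "F \<subseteq> edges G" for F
    using assms that by (intro sum.cong) auto
  then show ?thesis
    using assms
    by (simp add: spade_weighting_def weight_function_def balanced_def tight_def
        edges_within_subset)
qed

lemma weight_function_unique:
  assumes "two_connected G" "e \<in> edges G" "3 \<le> card (edges G)"
    and "weight_function \<delta> G w" "weight_function \<delta> G w'"
  shows "w e = w' e"
  using two_connected_delete_or_contract[OF assms(1-3)] assms(2,4,5)
  unfolding weight_function_def by metis

locale graph_isomorphism =
  fixes f :: "'v \<Rightarrow> 'w" and g :: "'e \<Rightarrow> 'f" and G :: "('v, 'e) pre_multigraph"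
    and H :: "('w, 'f) pre_multigraph"
  assumes source: "multigraph G"
    and bij_verts: "bij_betw f (verts G) (verts H)"
    and bij_edges: "bij_betw g (edges G) (edges H)"
    and ends_map: "e \<in> edges G \<Longrightarrow> ends H (g e) = f ` ends G e"
begin

lemma inj_verts: "inj_on f (verts G)" and inj_edges: "inj_on g (edges G)"
  using bij_verts bij_edges by (auto simp: bij_betw_def)

lemma verts_eq: "verts H = f ` verts G" and edges_eq: "edges H = g ` edges G"
  using bij_verts bij_edges by (auto simp: bij_betw_def)

lemma card_eq: "card (verts H) = card (verts G)" "card (edges H) = card (edges G)"
  using bij_verts bij_edges bij_betw_same_card by metis+

lemma target: "multigraph H"
proof -
  have "finite (verts H)" "finite (edges H)"
    using multigraph_finite[OF source] by (simp_all add: verts_eq edges_eq)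
  moreover have "ends H (g e) \<subseteq> verts H \<and> card (ends H (g e)) = 2" if "e \<in> edges G" for e
    using multigraph_ends[OF source that] inj_on_subset[OF inj_verts]
    by (auto simp: ends_map[OF that] verts_eq card_image)
  ultimately show ?thesis by (auto simp: multigraph_def edges_eq)
qed

lemma inverse: "graph_isomorphism (the_inv_into (verts G) f) (the_inv_into (edges G) g) H G"
proof
  fix e' assume "e' \<in> edges H"
  then obtain e where e: "e \<in> edges G" "e' = g e" by (auto simp: edges_eq)
  have "the_inv_into (verts G) f ` f ` ends G e = ends G e"
    using multigraph_ends(1)[OF source e(1)] inj_verts
    by (force simp: image_image the_inv_into_f_f)
  then show "ends G (the_inv_into (edges G) g e') = the_inv_into (verts G) f ` ends H e'"
    using e inj_edges by (simp add: the_inv_into_f_f ends_map)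
qed (simp_all add: target bij_betw_the_inv_into bij_verts bij_edges)

lemma image_eq_iff: "A \<subseteq> verts G \<Longrightarrow> B \<subseteq> verts G \<Longrightarrow> f ` A = f ` B \<longleftrightarrow> A = B"
  using inj_verts by (rule inj_on_image_eq_iff)

lemma verts_Diff: "A \<subseteq> verts G \<Longrightarrow> verts H - f ` A = f ` (verts G - A)"
  using inj_verts by (simp add: verts_eq inj_on_image_set_diff)

lemma adj_map_iff:
  assumes "u \<in> verts G" "v \<in> verts G"
  shows "adj H (f u) (f v) \<longleftrightarrow> adj G u v"
proof -
  have "ends H (g e) = {f u, f v} \<longleftrightarrow> ends G e = {u, v}" if "e \<in> edges G" for e
    using image_eq_iff[of "ends G e" "{u, v}"] multigraph_ends(1)[OF source that] assms
    by (simp add: ends_map[OF that])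
  then show ?thesis by (auto simp: adj_def edges_eq)
qed

lemma connected_on_map_iff:
  assumes "X \<subseteq> verts G"
  shows "connected_on H (f ` X) \<longleftrightarrow> connected_on G X"
proof
  assume "connected_on G X"
  then show "connected_on H (f ` X)" by (rule connected_on_image) (use assms adj_map_iff in blast)
next
  have inv: "the_inv_into (verts G) f (f x) = x" if "x \<in> X" for x
    using that assms inj_verts by (auto simp: the_inv_into_f_f)
  assume "connected_on H (f ` X)"
  then have "connected_on G (the_inv_into (verts G) f ` f ` X)"
    by (rule connected_on_image) (use assms in \<open>auto simp: inv adj_map_iff subset_iff\<close>)
  then show "connected_on G X" using inv by (simp add: image_image)
qed

lemma edges_within_map:
  assumes "S \<subseteq> verts G"
  shows "edges_within H (f ` S) = g ` edges_within G S"
proof -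
  have "ends H (g e) \<subseteq> f ` S \<longleftrightarrow> ends G e \<subseteq> S" if "e \<in> edges G" for e
    using inj_on_image_mem_iff[OF inj_verts _ assms] multigraph_ends(1)[OF source that]
    by (simp add: ends_map[OF that] image_subset_iff) blast
  then show ?thesis by (auto simp: edges_within_def edges_eq)
qed

lemma induced_isomorphism:
  assumes "S \<subseteq> verts G"
  shows "graph_isomorphism f g (induced G S) (induced H (f ` S))"
proof
  show "multigraph (induced G S)" using source assms by (rule multigraph_induced)
  show "bij_betw f (verts (induced G S)) (verts (induced H (f ` S)))"
    using inj_on_subset[OF inj_verts assms] by (simp add: bij_betw_def)
  show "bij_betw g (edges (induced G S)) (edges (induced H (f ` S)))"
    using inj_on_subset[OF inj_edges edges_within_subset]
    by (simp add: bij_betw_def edges_within_map[OF assms])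
qed (simp add: edges_within_def ends_map)

lemma delete_edge_isomorphism:
  assumes "e \<in> edges G"
  shows "graph_isomorphism f g (delete_edges G {e}) (delete_edges H {g e})"
proof
  show "bij_betw g (edges (delete_edges G {e})) (edges (delete_edges H {g e}))"
    using assms inj_on_subset[OF inj_edges] inj_on_image_set_diff[OF inj_edges, of "edges G" "{e}"]
    by (simp add: bij_betw_def edges_eq)
qed (simp_all add: source multigraph_delete_edges bij_verts ends_map)

lemma two_connected_map_iff: "two_connected H \<longleftrightarrow> two_connected G"
proof -
  have "connected_on H (verts H - {f v}) \<longleftrightarrow> connected_on G (verts G - {v})" if "v \<in> verts G" for v
    using connected_on_map_iff[of "verts G - {v}"] verts_Diff[of "{v}"] that by auto
  then show ?thesis by (simp add: two_connected_iff source target card_eq) (simp add: verts_eq)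
qed

lemma two_connected_delete_edge_map_iff:
  "e \<in> edges G \<Longrightarrow> two_connected (delete_edges H {g e}) \<longleftrightarrow> two_connected (delete_edges G {e})"
  by (rule graph_isomorphism.two_connected_map_iff[OF delete_edge_isomorphism])

lemma two_connected_contract_edge_map_iff:
  assumes G: "two_connected G" and e: "e \<in> edges G"
  shows "two_connected (contract H {g e}) \<longleftrightarrow> two_connected (contract G {e})"
proof -
  have H: "two_connected H" "g e \<in> edges H"
    using G e by (simp_all add: two_connected_map_iff edges_eq)
  have ends_e: "ends G e \<subseteq> verts G" by (rule multigraph_ends(1)[OF source e])
  have "g ` edges_within G (ends G e) = g ` {e} \<longleftrightarrow> edges_within G (ends G e) = {e}"
    using e by (intro inj_on_image_eq_iff[OF inj_edges] edges_within_subset) simp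
  moreover have "connected_on H (verts H - ends H (g e)) \<longleftrightarrow> connected_on G (verts G - ends G e)"
    using connected_on_map_iff[of "verts G - ends G e"] verts_Diff[OF ends_e]
    by (simp add: ends_map e)
  ultimately show ?thesis
    by (simp add: two_connected_contract_edge_iff G H e ends_map edges_within_map ends_e)
qed

lemma good_flat_map_iff:
  assumes G: "two_connected G" and S: "S \<subseteq> verts G"
  shows "good_flat H (f ` S) \<longleftrightarrow> good_flat G S"
proof -
  have "two_connected H" using G by (simp add: two_connected_map_iff)
  moreover have "f ` S \<subset> verts H \<longleftrightarrow> S \<subset> verts G"
    using image_eq_iff[OF S subset_refl] S by (auto simp: verts_eq)
  moreover have "two_connected (induced H (f ` S)) \<longleftrightarrow> two_connected (induced G S)"
    by (rule graph_isomorphism.two_connected_map_iff[OF induced_isomorphism[OF S]])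
  ultimately show ?thesis
    using connected_on_map_iff[of "verts G - S"] verts_Diff[OF S] G by (simp add: good_flat_iff)
qed

lemma sum_map: "F \<subseteq> edges G \<Longrightarrow> sum w (g ` F) = sum (w \<circ> g) F"
  by (rule sum.reindex) (rule inj_on_subset[OF inj_edges])

lemma tight_map_iff:
  assumes "S \<subseteq> verts G"
  shows "tight \<delta> H w (f ` S) \<longleftrightarrow> tight \<delta> G (w \<circ> g) S"
  using assms inj_on_subset[OF inj_verts]
  by (simp add: tight_def edges_within_map sum_map edges_within_subset card_image)

lemma balanced_map_iff:
  assumes G: "two_connected G"
  shows "balanced \<delta> H w \<longleftrightarrow> balanced \<delta> G (w \<circ> g)"
proof -
  have "(\<forall>T. good_flat H T \<longrightarrow> tight \<delta> H w T) \<longleftrightarrow> (\<forall>S. good_flat G S \<longrightarrow> tight \<delta> G (w \<circ> g) S)"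
    (is "?H \<longleftrightarrow> ?G")
  proof
    assume ?H
    then show ?G
      using good_flat_map_iff[OF G] tight_map_iff good_flat_psubset by (metis psubset_imp_subset)
  next
    assume R: ?G
    show ?H
    proof (intro allI impI)
      fix T assume T: "good_flat H T"
      then obtain S where "S \<subseteq> verts G" "T = f ` S"
        using good_flat_psubset[OF T] unfolding verts_eq by (meson psubset_imp_subset subset_imageE)
      then show "tight \<delta> H w T" using T R good_flat_map_iff[OF G] tight_map_iff by blast
    qed
  qed
  then show ?thesis unfolding balanced_def by (simp add: edges_eq sum_map card_eq)
qed

lemma weight_function_map_iff:
  assumes "two_connected G"
  shows "weight_function \<delta> H w \<longleftrightarrow> weight_function \<delta> G (w \<circ> g)"
  unfolding weight_function_def
  by (simp add: edges_eq two_connected_delete_edge_map_iff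
      two_connected_contract_edge_map_iff[OF assms])

lemma spade_weighting_map_iff:
  "two_connected G \<Longrightarrow> spade_weighting \<delta> H w \<longleftrightarrow> spade_weighting \<delta> G (w \<circ> g)"
  by (simp add: spade_weighting_def balanced_map_iff weight_function_map_iff)

lemma spade_weighting_transport:
  assumes "two_connected G" "spade_weighting \<delta> G w"
  obtains w' where "spade_weighting \<delta> H w'" "\<forall>e\<in>edges G. w' (g e) = w e"
proof -
  interpret inv: graph_isomorphism "the_inv_into (verts G) f" "the_inv_into (edges G) g" H G
    by (rule inverse)
  show thesis
    by (rule that[of "w \<circ> the_inv_into (edges G) g"])
      (use assms inv.spade_weighting_map_iff inj_edges in
        \<open>simp_all add: two_connected_map_iff the_inv_into_f_f\<close>)
qed

end

lemma multigraph_iso_iff: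
  "multigraph G \<Longrightarrow> G \<simeq>\<^sub>m H \<longleftrightarrow> (\<exists>f g. graph_isomorphism f g G H)"
  unfolding multigraph_iso_def graph_isomorphism_def by blast

lemma multigraph_iso_sym: "multigraph G \<Longrightarrow> G \<simeq>\<^sub>m H \<Longrightarrow> H \<simeq>\<^sub>m G"
  by (metis multigraph_iso_iff graph_isomorphism.inverse graph_isomorphism.target)

lemma multigraph_if_iso: "multigraph G \<Longrightarrow> G \<simeq>\<^sub>m H \<Longrightarrow> multigraph H"
  by (metis multigraph_iso_iff graph_isomorphism.target)

lemma two_connected_iso: "multigraph G \<Longrightarrow> G \<simeq>\<^sub>m H \<Longrightarrow> two_connected G \<longleftrightarrow> two_connected H"
  by (metis multigraph_iso_iff graph_isomorphism.two_connected_map_iff)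

lemma spade_iso:
  assumes "two_connected G" "G \<simeq>\<^sub>m H"
  shows "spade \<delta> G \<longleftrightarrow> spade \<delta> H"
proof -
  note G = two_connected_multigraph[OF assms(1)]
  obtain f g where "graph_isomorphism f g G H"
    using assms(2) by (auto simp: multigraph_iso_iff[OF G])
  then interpret graph_isomorphism f g G H .
  show ?thesis
    unfolding spade_iff_ex_weighting
    using spade_weighting_map_iff[OF assms(1)] spade_weighting_transport[OF assms(1)] by metis
qed

lemma ex_nat_isomorphism:
  assumes "multigraph G"
  obtains f g and H :: "(nat, nat) pre_multigraph" where "graph_isomorphism f g G H"
proof -
  obtain f where f: "bij_betw f (verts G) {..<card (verts G)}"
    using ex_bij_betw_finite_nat[OF multigraph_finite(1)[OF assms]] by (auto simp: atLeast0LessThan)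
  obtain g where g: "bij_betw g (edges G) {..<card (edges G)}"
    using ex_bij_betw_finite_nat[OF multigraph_finite(2)[OF assms]] by (auto simp: atLeast0LessThan)
  have "graph_isomorphism f g G \<lparr>verts = {..<card (verts G)}, edges = {..<card (edges G)},
      ends = (\<lambda>n. f ` ends G (the_inv_into (edges G) g n))\<rparr>"
    using assms f g by unfold_locales (auto simp: bij_betw_def the_inv_into_f_f)
  then show thesis by (rule that)
qed

lemma iso_if_two_verts:
  assumes G: "multigraph G" "card (verts G) = 2" and H: "multigraph H" "card (verts H) = 2"
    and E: "card (edges G) = card (edges H)"
  shows "G \<simeq>\<^sub>m H"
proof -
  obtain f where f: "bij_betw f (verts G) (verts H)"
    using finite_same_card_bij[of "verts G" "verts H"] multigraph_finite(1) G H by metis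
  obtain g where g: "bij_betw g (edges G) (edges H)"
    using finite_same_card_bij[OF _ _ E] multigraph_finite(2) G(1) H(1) by metis
  have "ends H (g e) = f ` ends G e" if "e \<in> edges G" for e
    using multigraph_ends_two_verts[OF G that] f
      multigraph_ends_two_verts[OF H bij_betw_apply[OF g that]]
    by (simp add: bij_betw_def)
  then show ?thesis unfolding multigraph_iso_def using f g by blast
qed

section \<open>Two-separations\<close>

text \<open>\<open>None\<close> is the virtual edge of a side of the separation.\<close>

definition side ::
  "('v, 'e) pre_multigraph \<Rightarrow> 'v set \<Rightarrow> 'e set \<Rightarrow> 'v \<Rightarrow> 'v \<Rightarrow> ('v, 'e option) pre_multigraph" where
  "side G W F x y = \<lparr>verts = W, edges = insert None (Some ` F), ends = case_option {x, y} (ends G)\<rparr>"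

lemma verts_side [simp]: "verts (side G W F x y) = W"
  and edges_side [simp]: "edges (side G W F x y) = insert None (Some ` F)"
  and ends_side [simp]: "ends (side G W F x y) None = {x, y}"
    "ends (side G W F x y) (Some e) = ends G e"
  by (simp_all add: side_def)

lemma adj_side_iff: "adj (side G W F x y) a b \<longleftrightarrow> {a, b} = {x, y} \<or> (\<exists>e\<in>F. ends G e = {a, b})"
  by (auto simp: adj_def)

lemma edges_delete_None_side: "edges (delete_edges (side G W F x y) {None}) = Some ` F"
  by auto

lemma adj_delete_None_side_iff:
  "adj (delete_edges (side G W F x y) {None}) a b \<longleftrightarrow> (\<exists>e\<in>F. ends G e = {a, b})"
  by (auto simp: adj_def edges_delete_None_side simp del: edges_delete_edges)

lemma edges_within_side:
  "F \<subseteq> edges G \<Longrightarrow> edges_within (side G W F x y) T =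
     (if {x, y} \<subseteq> T then {None} else {}) \<union> Some ` (F \<inter> edges_within G T)"
  by (auto simp: edges_within_def)

locale two_separation =
  fixes G :: "('v, 'e) pre_multigraph" and V\<^sub>1 V\<^sub>2 :: "'v set" and E\<^sub>1 E\<^sub>2 :: "'e set" and x y :: 'v
  assumes multigraph: "multigraph G" and xy: "x \<noteq> y"
    and verts: "verts G = V\<^sub>1 \<union> V\<^sub>2" and verts_Int: "V\<^sub>1 \<inter> V\<^sub>2 = {x, y}"
    and edges: "edges G = E\<^sub>1 \<union> E\<^sub>2" and edges_Int: "E\<^sub>1 \<inter> E\<^sub>2 = {}"
    and edges_nonempty: "E\<^sub>1 \<noteq> {}" "E\<^sub>2 \<noteq> {}"
    and ends_subset: "e \<in> E\<^sub>1 \<Longrightarrow> ends G e \<subseteq> V\<^sub>1" "e \<in> E\<^sub>2 \<Longrightarrow> ends G e \<subseteq> V\<^sub>2"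

sublocale two_separation \<subseteq> swap: two_separation G V\<^sub>2 V\<^sub>1 E\<^sub>2 E\<^sub>1 x y
  by unfold_locales
    (use multigraph xy verts verts_Int edges edges_Int edges_nonempty ends_subset in auto)

abbreviation (in two_separation) "left_side \<equiv> side G V\<^sub>1 E\<^sub>1 x y"
abbreviation (in two_separation) "right_side \<equiv> side G V\<^sub>2 E\<^sub>2 x y"

lemma (in two_separation) xy_in_V1: "x \<in> V\<^sub>1" "y \<in> V\<^sub>1"
  using verts_Int by auto

lemma (in two_separation) in_both: "v \<in> V\<^sub>1 \<Longrightarrow> v \<in> V\<^sub>2 \<Longrightarrow> v = x \<or> v = y"
  using verts_Int by auto

lemma (in two_separation) finite_V1: "finite V\<^sub>1" and finite_E1: "finite E\<^sub>1"
  using multigraph_finite[OF multigraph] by (simp_all add: verts edges)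

lemma (in two_separation) V1_subset: "V\<^sub>1 \<subseteq> verts G" and E1_subset: "E\<^sub>1 \<subseteq> edges G"
  using verts edges by auto

lemma (in two_separation) card_V1_ge2: "2 \<le> card V\<^sub>1"
  using card_mono[of V\<^sub>1 "{x, y}"] finite_V1 xy_in_V1 xy by auto

lemma (in two_separation) multigraph_left: "multigraph left_side"
  using multigraph_ends(2)[OF multigraph] finite_V1 finite_E1 E1_subset ends_subset(1) xy xy_in_V1
  by (auto simp: multigraph_def)

lemma (in two_separation) card_edges_left: "card (edges left_side) = Suc (card E\<^sub>1)"
  using finite_E1 by (simp add: card_image)

subsection \<open>Connectivity of the sides\<close>

lemma (in two_separation) adj_V1D:
  assumes "adj G a b" "a \<in> V\<^sub>1" "b \<in> V\<^sub>1"
  shows "adj left_side a b"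
proof -
  obtain e where e: "e \<in> E\<^sub>1 \<or> e \<in> E\<^sub>2" "ends G e = {a, b}"
    using assms(1) by (auto simp: adj_def edges)
  show ?thesis
  proof (cases "e \<in> E\<^sub>1")
    case True
    then show ?thesis using e(2) by (auto simp: adj_side_iff)
  next
    case False
    then have "{a, b} \<subseteq> {x, y}" using e ends_subset(2)[of e] assms(2,3) verts_Int by auto
    moreover have "a \<noteq> b" using multigraph_adj(3)[OF multigraph assms(1)] .
    ultimately have "{a, b} = {x, y}" by auto
    then show ?thesis by (simp add: adj_side_iff)
  qed
qed

lemma (in two_separation) adj_leftD: "adj left_side a b \<Longrightarrow> {a, b} \<noteq> {x, y} \<Longrightarrow> adj G a b"
  by (auto simp: adj_side_iff adj_def edges)

lemma (in two_separation) adj_inner: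
  assumes "adj G a b" "a \<in> V\<^sub>1" "a \<notin> {x, y}"
  shows "b \<in> V\<^sub>1"
proof -
  obtain e where e: "e \<in> E\<^sub>1 \<union> E\<^sub>2" "ends G e = {a, b}" using assms(1) by (auto simp: adj_def edges)
  then have "e \<notin> E\<^sub>2" using ends_subset(2)[of e] assms(2,3) verts_Int by auto
  then show ?thesis using e ends_subset(1)[of e] by auto
qed

lemma (in two_separation) connected_on_left_iff:
  assumes "X \<subseteq> V\<^sub>1" "\<not> {x, y} \<subseteq> X"
  shows "connected_on left_side X \<longleftrightarrow> connected_on G X"
proof (rule connected_on_cong)
  fix a b assume "a \<in> X" "b \<in> X"
  moreover from this have "{a, b} \<noteq> {x, y}" using assms(2) by auto
  ultimately show "adj left_side a b \<longleftrightarrow> adj G a b" using adj_V1D adj_leftD assms(1) by blast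
qed

lemma (in two_separation) connected_on_V1_Diff:
  assumes "two_connected left_side" and Z: "Z \<subseteq> V\<^sub>2" "\<not> {x, y} \<subseteq> Z"
  shows "connected_on G (V\<^sub>1 - Z)"
proof (cases "Z \<inter> {x, y} = {}")
  case True
  then have "V\<^sub>1 - Z = V\<^sub>1" using Z(1) verts_Int by auto
  moreover have "connected_on (delete_edges left_side {None}) V\<^sub>1"
    using two_connected_connected_on(3)[OF assms(1), of None] by simp
  then have "connected_on G V\<^sub>1"
    by (rule connected_on_mono) (auto simp: adj_delete_None_side_iff edges intro: adjI)
  ultimately show ?thesis by simp
next
  case False
  then obtain u where u: "u \<in> {x, y}" "Z \<inter> {x, y} = {u}" using Z(2) by blast
  then have "V\<^sub>1 - Z = V\<^sub>1 - {u}" using Z(1) verts_Int by auto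
  moreover have "connected_on left_side (V\<^sub>1 - {u})"
    using two_connected_connected_on(2)[OF assms(1), of u] u xy_in_V1 by auto
  ultimately show ?thesis using connected_on_left_iff[of "V\<^sub>1 - {u}"] u(1) by auto
qed

lemma (in two_separation) connected_on_Diff_if_left:
  assumes Z: "Z \<subseteq> V\<^sub>1" "\<not> {x, y} \<subseteq> Z" and right: "two_connected right_side"
    and left: "connected_on left_side (V\<^sub>1 - Z)"
  shows "connected_on G (verts G - Z)"
proof (rule connected_on_detours[OF left])
  have connected_right: "connected_on G (V\<^sub>2 - Z)" by (rule swap.connected_on_V1_Diff[OF right Z])
  show "V\<^sub>1 - Z \<subseteq> verts G - Z" using verts by auto
  show "\<exists>C\<subseteq>verts G - Z. connected_on G C \<and> a \<in> C \<and> b \<in> C"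
    if ab: "a \<in> V\<^sub>1 - Z" "b \<in> V\<^sub>1 - Z" "adj left_side a b" for a b
  proof (cases "{a, b} = {x, y}")
    case True
    then have "{a, b} \<subseteq> V\<^sub>2" using swap.xy_in_V1 by auto
    then show ?thesis by (intro exI[of _ "V\<^sub>2 - Z"]) (use connected_right ab verts in auto)
  next
    case False
    then have "connected_on G {a, b}" using adj_leftD[OF ab(3)] connected_on_adj by metis
    then show ?thesis by (intro exI[of _ "{a, b}"]) (use ab verts in auto)
  qed
  show "\<exists>C\<subseteq>verts G - Z. connected_on G C \<and> v \<in> C \<and> C \<inter> (V\<^sub>1 - Z) \<noteq> {}"
    if v: "v \<in> verts G - Z" for v
  proof (cases "v \<in> V\<^sub>1")
    case True
    then show ?thesis by (intro exI[of _ "{v}"]) (use v in auto)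
  next
    case False
    then have "v \<in> V\<^sub>2 - Z" using v verts by auto
    moreover have "(V\<^sub>2 - Z) \<inter> (V\<^sub>1 - Z) \<noteq> {}" using Z(2) xy_in_V1 swap.xy_in_V1 by auto
    ultimately show ?thesis by (intro exI[of _ "V\<^sub>2 - Z"]) (use connected_right verts in auto)
  qed
qed

text \<open>Conversely, a side is the image of the whole graph under collapsing the other side onto one
  of its two attachment vertices.\<close>

lemma (in two_separation) connected_on_left_Diff:
  assumes Z: "Z \<subseteq> V\<^sub>1" "\<not> {x, y} \<subseteq> Z" and "connected_on G (verts G - Z)"
  shows "connected_on left_side (V\<^sub>1 - Z)"
proof -
  obtain r where r: "r \<in> {x, y}" "r \<notin> Z" using Z(2) by auto
  define collapse where "collapse = (\<lambda>v. if v \<in> V\<^sub>1 then v else r)"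
  have to_r: "b = r \<or> adj left_side b r" if "a \<notin> V\<^sub>1" "b \<in> V\<^sub>1" "adj G a b" for a b
  proof -
    have "a \<in> V\<^sub>2" using that(1) multigraph_adj(1)[OF multigraph that(3)] verts by auto
    then have "b \<in> V\<^sub>2" using swap.adj_inner[OF that(3)] that(1) xy_in_V1 by auto
    then have "b \<in> {x, y}" using that(2) verts_Int by auto
    then show ?thesis using r(1) by (auto simp: adj_side_iff)
  qed
  have "connected_on left_side (collapse ` (verts G - Z))"
  proof (rule connected_on_image[OF assms(3)])
    fix a b assume "adj G a b"
    moreover from this have "adj G b a" by (simp add: adj_commute)
    ultimately show "collapse a = collapse b \<or> adj left_side (collapse a) (collapse b)"
      using to_r adj_V1D adj_commute[of left_side] by (auto simp: collapse_def)
  qed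
  moreover have "collapse ` (verts G - Z) = V\<^sub>1 - Z"
    using r xy_in_V1 verts by (auto simp: collapse_def image_iff)
  ultimately show ?thesis by simp
qed

lemma (in two_separation) two_connected_left:
  assumes "two_connected G"
  shows "two_connected left_side"
proof (cases "card V\<^sub>1 = 2")
  case True
  have "0 < card E\<^sub>1" using edges_nonempty finite_E1 by (simp add: card_gt_0_iff)
  then show ?thesis
    using True card_edges_left by (simp add: two_connected_iff_two_verts[OF multigraph_left])
next
  case False
  then have "3 \<le> card V\<^sub>1" using card_V1_ge2 by linarith
  moreover have "connected_on left_side (V\<^sub>1 - {z})" if "z \<in> V\<^sub>1" for z
    using connected_on_left_Diff[of "{z}"] two_connected_connected_on(2)[OF assms, of z] that
      verts xy by auto
  ultimately show ?thesis by (simp add: two_connected_iff_ge3_verts[OF multigraph_left])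
qed

lemma (in two_separation) connected_on_remove_V1:
  assumes "two_connected left_side" "two_connected right_side" "z \<in> V\<^sub>1"
  shows "connected_on G (verts G - {z})"
  using connected_on_Diff_if_left[of "{z}"] two_connected_connected_on(2)[OF assms(1), of z]
    assms xy by auto

lemma (in two_separation) two_connected_if_sides:
  assumes left: "two_connected left_side" and right: "two_connected right_side"
  shows "two_connected G"
proof -
  have "card {x, y} \<le> card (verts G)"
    using multigraph_finite(1)[OF multigraph] V1_subset xy_in_V1 by (intro card_mono) auto
  then consider (two) "card (verts G) = 2" | (ge3) "3 \<le> card (verts G)" using xy by fastforce
  then show ?thesis
  proof cases
    case two
    have "card E\<^sub>1 > 0" "card E\<^sub>2 > 0"
      using edges_nonempty finite_E1 swap.finite_E1 by (simp_all add: card_gt_0_iff)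
    then have "2 \<le> card (edges G)"
      using edges edges_Int finite_E1 swap.finite_E1 by (simp add: card_Un_disjoint)
    then show ?thesis using two by (simp add: two_connected_iff_two_verts[OF multigraph])
  next
    case ge3
    have "connected_on G (verts G - {z})" if "z \<in> verts G" for z
      using that connected_on_remove_V1[OF left right]
        swap.connected_on_remove_V1[OF right left] verts by blast
    then show ?thesis using ge3 by (simp add: two_connected_iff_ge3_verts[OF multigraph])
  qed
qed

subsection \<open>Good flats of the sides\<close>

lemma (in two_separation) edges_within_inside:
  assumes "T \<subseteq> V\<^sub>1" "\<not> {x, y} \<subseteq> T"
  shows "edges_within G T = E\<^sub>1 \<inter> edges_within G T"
proof -
  have "e \<notin> E\<^sub>2" if "e \<in> edges_within G T" for e
  proof
    assume "e \<in> E\<^sub>2"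
    have e: "e \<in> edges G" "ends G e \<subseteq> T" using that by (auto simp: edges_within_def)
    then have "ends G e \<subseteq> {x, y}" using ends_subset(2)[OF \<open>e \<in> E\<^sub>2\<close>] assms(1) verts_Int by auto
    then have "ends G e = {x, y}" using multigraph_ends_eq[OF multigraph e(1)] by simp
    then show False using e(2) assms(2) by simp
  qed
  then show ?thesis using edges edges_within_subset[of G T] by auto
qed

lemma (in two_separation) edges_within_across:
  assumes "{x, y} \<subseteq> T" "T \<subseteq> V\<^sub>1"
  shows "edges_within G (T \<union> V\<^sub>2) = (E\<^sub>1 \<inter> edges_within G T) \<union> E\<^sub>2"
proof -
  have "ends G e \<subseteq> T" if "e \<in> E\<^sub>1" "ends G e \<subseteq> T \<union> V\<^sub>2" for e
    using ends_subset(1)[OF that(1)] that(2) verts_Int assms(1) by blast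
  then show ?thesis using ends_subset(2) edges by (auto simp: edges_within_def)
qed

lemma (in two_separation) two_connected_induced_left_inside_iff:
  assumes T: "T \<subseteq> V\<^sub>1" "\<not> {x, y} \<subseteq> T"
  shows "two_connected (induced left_side T) \<longleftrightarrow> two_connected (induced G T)"
proof (rule two_connected_cong)
  show "multigraph (induced left_side T)" using multigraph_induced[OF multigraph_left] T by simp
  show "multigraph (induced G T)" using multigraph_induced[OF multigraph] T V1_subset by blast
  show "card (edges (induced left_side T)) = card (edges (induced G T))"
    using T edges_within_inside[OF T] by (auto simp: edges_within_side[OF E1_subset] card_image)
  fix a b assume ab: "a \<in> verts (induced left_side T)" "b \<in> verts (induced left_side T)"
  then have "{a, b} \<noteq> {x, y}" using T by auto
  then show "adj (induced left_side T) a b \<longleftrightarrow> adj (induced G T) a b"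
    using ab T(1) adj_V1D[of a b] adj_leftD[of a b] unfolding adj_induced by auto
qed simp

lemma (in two_separation) two_connected_induced_across_iff:
  assumes T: "{x, y} \<subseteq> T" "T \<subseteq> V\<^sub>1" and inner: "E\<^sub>1 \<inter> edges_within G T \<noteq> {}"
    and right: "two_connected right_side"
  shows "two_connected (induced G (T \<union> V\<^sub>2)) \<longleftrightarrow> two_connected (induced left_side T)"
proof -
  let ?I = "induced G (T \<union> V\<^sub>2)" and ?F = "E\<^sub>1 \<inter> edges_within G T"
  interpret I: two_separation ?I T V\<^sub>2 ?F E\<^sub>2 x y
  proof
    show "multigraph ?I"
      by (rule multigraph_induced[OF multigraph]) (use T V1_subset swap.V1_subset in simp)
    show "T \<inter> V\<^sub>2 = {x, y}" using T verts_Int by blast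
    show "edges ?I = ?F \<union> E\<^sub>2" using edges_within_across[OF T] by simp
    show "ends ?I e \<subseteq> T" if "e \<in> ?F" for e using that by (simp add: edges_within_def)
    show "ends ?I e \<subseteq> V\<^sub>2" if "e \<in> E\<^sub>2" for e using that ends_subset(2) by simp
    show "?F \<inter> E\<^sub>2 = {}" using edges_Int by auto
  qed (simp_all add: xy inner edges_nonempty)
  have "side ?I T ?F x y = induced left_side T"
    using T edges_within_side[OF E1_subset, of V\<^sub>1 x y T] unfolding side_def induced_def by simp
  moreover have "side ?I V\<^sub>2 E\<^sub>2 x y = right_side"
    unfolding side_def induced_def by simp
  ultimately show ?thesis using I.two_connected_left I.two_connected_if_sides right by metis
qed

lemma (in two_separation) good_flat_left_inside_iff:
  assumes G: "two_connected G" and T: "T \<subseteq> V\<^sub>1" "\<not> {x, y} \<subseteq> T"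
  shows "good_flat left_side T \<longleftrightarrow> good_flat G T"
proof -
  have "connected_on left_side (V\<^sub>1 - T) \<longleftrightarrow> connected_on G (verts G - T)"
    using connected_on_left_Diff[OF T] connected_on_Diff_if_left[OF T swap.two_connected_left[OF G]]
    by blast
  moreover have "T \<subset> V\<^sub>1" "T \<subset> verts G" using T V1_subset xy_in_V1 by auto
  ultimately show ?thesis
    using two_connected_induced_left_inside_iff[OF T] two_connected_left[OF G] G
    by (simp add: good_flat_iff)
qed

lemma (in two_separation) good_flat_left_across_iff:
  assumes G: "two_connected G" and T: "{x, y} \<subseteq> T" "T \<subseteq> V\<^sub>1"
    and inner: "E\<^sub>1 \<inter> edges_within G T \<noteq> {}"
  shows "good_flat left_side T \<longleftrightarrow> good_flat G (T \<union> V\<^sub>2)"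
proof -
  have verts_outside: "verts G - (T \<union> V\<^sub>2) = V\<^sub>1 - T" using verts verts_Int T(1) by blast
  have "connected_on left_side (V\<^sub>1 - T) \<longleftrightarrow> connected_on G (verts G - (T \<union> V\<^sub>2))"
    unfolding verts_outside by (rule connected_on_left_iff) (use T(1) in auto)
  moreover have "T \<subset> V\<^sub>1 \<longleftrightarrow> T \<union> V\<^sub>2 \<subset> verts G" using verts_outside verts T(2) by blast
  ultimately show ?thesis
    using two_connected_induced_across_iff[OF T inner swap.two_connected_left[OF G]]
      two_connected_left[OF G] G
    by (simp add: good_flat_iff)
qed

lemma (in two_separation) good_flat_inside_cases:
  assumes S: "good_flat G S" and not_xy: "\<not> {x, y} \<subseteq> S"
  shows "S \<subseteq> V\<^sub>1 \<or> S \<subseteq> V\<^sub>2"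
proof (cases "S \<subseteq> {x, y}")
  case False
  consider "S - {x, y} = S" | "x \<in> S" "S - {x, y} = S - {x}" | "y \<in> S" "S - {x, y} = S - {y}"
    using not_xy by fast
  then have "connected_on G (S - {x, y})"
    by cases (simp_all only: two_connected_induced_connected_on[OF good_flat_two_connected[OF S]])
  then have "S - {x, y} \<subseteq> V\<^sub>1 - {x, y} \<or> (V\<^sub>1 - {x, y}) \<inter> (S - {x, y}) = {}"
  proof (rule connected_on_disjoint_or_subset)
    show "b \<in> V\<^sub>1 - {x, y}" if "a \<in> V\<^sub>1 - {x, y}" "b \<in> S - {x, y}" "adj G a b" for a b
      using adj_inner[OF that(3)] that(1,2) by simp
  qed
  moreover have "S \<subseteq> V\<^sub>1 \<union> V\<^sub>2" using good_flat_psubset[OF S] verts by auto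
  ultimately show ?thesis using xy_in_V1 swap.xy_in_V1 by auto
qed (use xy_in_V1 in auto)

lemma (in two_separation) good_flat_across_cases:
  assumes G: "two_connected G" and S: "good_flat G S" and xy_S: "{x, y} \<subseteq> S"
  shows "V\<^sub>1 \<subseteq> S \<or> V\<^sub>2 \<subseteq> S"
proof -
  have "connected_on G (verts G - S)" using S by (simp add: good_flat_iff[OF G])
  then have "verts G - S \<subseteq> V\<^sub>1 - {x, y} \<or> (V\<^sub>1 - {x, y}) \<inter> (verts G - S) = {}"
  proof (rule connected_on_disjoint_or_subset)
    show "b \<in> V\<^sub>1 - {x, y}" if "a \<in> V\<^sub>1 - {x, y}" "b \<in> verts G - S" "adj G a b" for a b
      using adj_inner[OF that(3)] that(1,2) xy_S by auto
  qed
  then show ?thesis using verts xy_S in_both by blast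
qed

lemma (in two_separation) two_connected_delete_None_iff:
  assumes "verts H = V\<^sub>1" "edges H = E\<^sub>1" "ends H = ends G"
  shows "two_connected (delete_edges left_side {None}) \<longleftrightarrow> two_connected H"
proof (rule two_connected_cong)
  show "multigraph (delete_edges left_side {None})"
    by (rule multigraph_delete_edges[OF multigraph_left])
  show "multigraph H"
    using assms multigraph_ends(2)[OF multigraph] finite_V1 finite_E1 E1_subset ends_subset(1)
    by (auto simp: multigraph_def)
  show "card (edges (delete_edges left_side {None})) = card (edges H)"
    unfolding edges_delete_None_side by (simp add: assms(2) card_image)
  show "adj (delete_edges left_side {None}) a b \<longleftrightarrow> adj H a b" for a b
    unfolding adj_delete_None_side_iff by (simp add: adj_def assms)
qed (simp add: assms(1))

lemma (in two_separation) good_flat_covering_V2: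
  assumes G: "two_connected G" and S: "good_flat G S" and "V\<^sub>2 \<subseteq> S"
  obtains T where "{x, y} \<subseteq> T" "T \<subseteq> V\<^sub>1" "S = T \<union> V\<^sub>2" "good_flat left_side T"
  | "S = V\<^sub>2" "edges_within G S = E\<^sub>2" "two_connected (delete_edges right_side {None})"
proof -
  define T where "T = S \<inter> V\<^sub>1"
  have T: "{x, y} \<subseteq> T" "T \<subseteq> V\<^sub>1" "S = T \<union> V\<^sub>2"
    using good_flat_psubset[OF S] assms(3) verts xy_in_V1 swap.xy_in_V1 by (auto simp: T_def)
  show thesis
  proof (cases "E\<^sub>1 \<inter> edges_within G T = {}")
    case False
    then show ?thesis using that(1)[OF T] good_flat_left_across_iff[OF G T(1,2)] S T(3) by simp
  next
    case True
    then have E: "edges_within G S = E\<^sub>2" using edges_within_across[OF T(1,2)] T(3) by simp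
    have "s \<in> V\<^sub>2" if "s \<in> S" for s
    proof -
      have "2 \<le> degree (induced G S) s"
        using two_connected_degree[OF good_flat_two_connected[OF S]] that by simp
      then have "{e \<in> E\<^sub>2. s \<in> ends G e} \<noteq> {}" by (intro notI) (simp add: degree_def E)
      then show ?thesis using ends_subset(2) by auto
    qed
    then have "S = V\<^sub>2" using assms(3) by auto
    moreover from this have "two_connected (delete_edges right_side {None})"
      using swap.two_connected_delete_None_iff[of "induced G S"] E good_flat_two_connected[OF S]
      by simp
    ultimately show ?thesis using that(2) E by blast
  qed
qed

section \<open>Weights on the sides of a two-separation\<close>

lemma (in two_separation) card_verts: "card (verts G) + 2 = card V\<^sub>1 + card V\<^sub>2"
  using card_Un_Int[OF finite_V1 swap.finite_V1] xy by (simp add: verts verts_Int)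

lemma (in two_separation) card_edges: "card (edges G) = card E\<^sub>1 + card E\<^sub>2"
  unfolding edges by (rule card_Un_disjoint[OF finite_E1 swap.finite_E1 edges_Int])

lemma (in two_separation) sum_edges: "sum w (edges G) = sum w E\<^sub>1 + sum w E\<^sub>2"
  unfolding edges by (rule sum.union_disjoint[OF finite_E1 swap.finite_E1 edges_Int])

lemma (in two_separation) total_weight_iff:
  assumes "c + sum w E\<^sub>1 = \<delta> * (card V\<^sub>1 - 1)"
  shows "sum w (edges G) = \<delta> * (card (verts G) - 1) \<longleftrightarrow> sum w E\<^sub>2 = \<delta> * (card V\<^sub>2 - 2) + c"
proof -
  obtain p q where cards: "card V\<^sub>1 = p + 2" "card V\<^sub>2 = q + 2"
    using card_V1_ge2 swap.card_V1_ge2 by (metis le_add_diff_inverse2)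
  then have "card (verts G) = p + q + 2" using card_verts by simp
  then show ?thesis
    using assms cards sum_edges[of w] by (simp add: algebra_simps) linarith
qed

lemma (in two_separation) sum_left: "sum (case_option c w) (edges left_side) = c + sum w E\<^sub>1"
  using finite_E1 by (simp add: sum.reindex)

lemma (in two_separation) sum_within_left:
  "sum (case_option c w) (edges_within left_side T) =
    (if {x, y} \<subseteq> T then c else 0) + sum w (E\<^sub>1 \<inter> edges_within G T)"
  using finite_E1 by (simp add: edges_within_side[OF E1_subset] sum.reindex)

lemma (in two_separation) tight_left_inside_iff:
  assumes "T \<subseteq> V\<^sub>1" "\<not> {x, y} \<subseteq> T"
  shows "tight \<delta> left_side (case_option c w) T \<longleftrightarrow> tight \<delta> G w T"
  using assms(2) edges_within_inside[OF assms] unfolding tight_def sum_within_left by auto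

lemma (in two_separation) tight_left_across_iff:
  assumes T: "{x, y} \<subseteq> T" "T \<subseteq> V\<^sub>1" and weight_V2: "sum w E\<^sub>2 = \<delta> * (card V\<^sub>2 - 2) + c"
  shows "tight \<delta> left_side (case_option c w) T \<longleftrightarrow> tight \<delta> G w (T \<union> V\<^sub>2)"
proof -
  have "finite T" using T(2) finite_V1 by (rule finite_subset)
  have "T \<inter> V\<^sub>2 = {x, y}" using T verts_Int by auto
  then have card: "card (T \<union> V\<^sub>2) + 2 = card T + card V\<^sub>2"
    using card_Un_Int[OF \<open>finite T\<close> swap.finite_V1] xy by simp
  have "2 \<le> card T" using card_mono[OF \<open>finite T\<close> T(1)] xy by simp
  then obtain p q where "card T = p + 2" "card V\<^sub>2 = q + 2"
    using swap.card_V1_ge2 by (metis le_add_diff_inverse2)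
  moreover from this have "card (T \<union> V\<^sub>2) = p + q + 2" using card by simp
  moreover have "sum w (edges_within G (T \<union> V\<^sub>2)) = sum w (E\<^sub>1 \<inter> edges_within G T) + sum w E\<^sub>2"
    unfolding edges_within_across[OF T]
    by (rule sum.union_disjoint) (use finite_E1 swap.finite_E1 edges_Int in auto)
  ultimately show ?thesis
    using T(1) weight_V2 by (simp add: tight_def sum_within_left algebra_simps)
qed

lemma (in two_separation) balanced_left:
  assumes G: "two_connected G" and w: "balanced \<delta> G w" and c: "c \<in> {1, \<delta> - 1}"
    and weight_V1: "c + sum w E\<^sub>1 = \<delta> * (card V\<^sub>1 - 1)"
  shows "balanced \<delta> left_side (case_option c w)"
proof -
  have weight_V2: "sum w E\<^sub>2 = \<delta> * (card V\<^sub>2 - 2) + c"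
    using w total_weight_iff[OF weight_V1] by (simp add: balanced_def)
  have "tight \<delta> left_side (case_option c w) T" if T: "good_flat left_side T" for T
  proof -
    have T_subset: "T \<subseteq> V\<^sub>1" using good_flat_psubset[OF T] by auto
    show ?thesis
    proof (cases "{x, y} \<subseteq> T")
      case True
      have "edges_within left_side T \<noteq> {None}"
        using two_connected_card_edges[OF good_flat_two_connected[OF T]] by (intro notI) simp
      then have "E\<^sub>1 \<inter> edges_within G T \<noteq> {}"
        unfolding edges_within_side[OF E1_subset] using True by auto
      then have "good_flat G (T \<union> V\<^sub>2)" using good_flat_left_across_iff[OF G True T_subset] T by simp
      then show ?thesis
        using w tight_left_across_iff[OF True T_subset weight_V2] by (simp add: balanced_def)
    next
      case False
      then show ?thesis
        using w T good_flat_left_inside_iff[OF G T_subset False]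
          tight_left_inside_iff[OF T_subset False]
        by (simp add: balanced_def)
    qed
  qed
  moreover have "\<forall>e\<in>edges left_side. case_option c w e \<in> {1, \<delta> - 1}"
    using c w E1_subset unfolding balanced_def by auto
  ultimately show ?thesis using weight_V1 unfolding balanced_def sum_left by simp
qed

subsection \<open>Deletable and contractible edges of the sides\<close>

lemma (in two_separation) two_connected_delete_left:
  assumes del: "two_connected (delete_edges G {e})" and e: "e \<in> E\<^sub>1" "E\<^sub>1 \<noteq> {e}"
  shows "two_connected (delete_edges left_side {Some e})"
proof -
  have "E\<^sub>1 - {e} \<noteq> {}" using e by auto
  then interpret del: two_separation "delete_edges G {e}" V\<^sub>1 V\<^sub>2 "E\<^sub>1 - {e}" E\<^sub>2 x y
    by unfold_locales
      (use multigraph_delete_edges[OF multigraph] xy verts verts_Int edges edges_Int edges_nonempty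
          ends_subset e(1) in auto)
  have "side (delete_edges G {e}) V\<^sub>1 (E\<^sub>1 - {e}) x y = delete_edges left_side {Some e}"
    unfolding side_def delete_edges_def by auto
  then show ?thesis using del.two_connected_left[OF del] by simp
qed

lemma (in two_separation) single_edge_left:
  assumes "two_connected left_side" "E\<^sub>1 = {e}"
  shows "V\<^sub>1 = {x, y}" "ends G e = {x, y}"
proof -
  have "z \<in> {x, y}" if "z \<in> V\<^sub>1" for z
  proof (rule ccontr)
    assume "z \<notin> {x, y}"
    then have "{f \<in> edges left_side. z \<in> ends left_side f} \<subseteq> {Some e}" using assms(2) by auto
    then have "degree left_side z \<le> 1" unfolding degree_def using card_mono[of "{Some e}"] by auto
    then show False using two_connected_degree[OF assms(1), of z] that by simp
  qed
  then show verts_left: "V\<^sub>1 = {x, y}" using xy_in_V1 by auto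
  show "ends G e = {x, y}"
    by (rule multigraph_ends_eq[OF multigraph])
      (use assms(2) E1_subset ends_subset(1)[of e] verts_left in auto)
qed

lemma (in two_separation) two_connected_delete_single:
  assumes left: "two_connected left_side" "E\<^sub>1 = {e}" and del: "two_connected (delete_edges G {e})"
  shows "two_connected (delete_edges right_side {None})"
proof -
  have "verts G = V\<^sub>2" using single_edge_left(1)[OF left] verts swap.xy_in_V1 by auto
  moreover have "edges G - {e} = E\<^sub>2" using left(2) edges edges_Int by auto
  ultimately show ?thesis
    using swap.two_connected_delete_None_iff[of "delete_edges G {e}"] del by simp
qed

lemma (in two_separation) contractible_not_attached:
  assumes G: "two_connected G" and contractible: "two_connected (contract G {e})"
    and e: "e \<in> E\<^sub>1" "E\<^sub>1 \<noteq> {e}"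
  shows "\<not> {x, y} \<subseteq> ends G e"
proof
  have e_in_G: "e \<in> edges G" using e(1) edges by simp
  assume "{x, y} \<subseteq> ends G e"
  moreover have "finite (ends G e)" "card (ends G e) = 2"
    using multigraph_ends(2)[OF multigraph e_in_G] by (auto intro: card_ge_0_finite)
  ultimately have ends_e: "ends G e = {x, y}" using xy card_seteq[of "ends G e" "{x, y}"] by simp
  have only_e: "edges_within G {x, y} = {e}" and "connected_on G (verts G - {x, y})"
    using contractible by (simp_all add: two_connected_contract_edge_iff[OF G e_in_G] ends_e)
  from this(2) have "verts G - {x, y} \<subseteq> V\<^sub>1 - {x, y} \<or> (V\<^sub>1 - {x, y}) \<inter> (verts G - {x, y}) = {}"
  proof (rule connected_on_disjoint_or_subset)
    show "b \<in> V\<^sub>1 - {x, y}" if "a \<in> V\<^sub>1 - {x, y}" "b \<in> verts G - {x, y}" "adj G a b" for a b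
      using adj_inner[OF that(3)] that(1,2) by simp
  qed
  then have "V\<^sub>2 \<subseteq> {x, y} \<or> V\<^sub>1 \<subseteq> {x, y}" using verts in_both by blast
  then have "E\<^sub>2 \<subseteq> edges_within G {x, y} \<or> E\<^sub>1 \<subseteq> edges_within G {x, y}"
    using ends_subset edges by (fastforce simp: edges_within_def)
  then show False using only_e e edges_Int edges_nonempty by auto
qed

lemma (in two_separation) two_connected_contract_left:
  assumes G: "two_connected G" and contractible: "two_connected (contract G {e})"
    and e: "e \<in> E\<^sub>1" "E\<^sub>1 \<noteq> {e}"
  shows "two_connected (contract left_side {Some e})"
proof -
  have not_xy: "\<not> {x, y} \<subseteq> ends G e" by (rule contractible_not_attached[OF assms])
  have ends_e: "ends G e \<subseteq> V\<^sub>1" by (rule ends_subset(1)[OF e(1)])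
  have "edges_within G (ends G e) = {e}" "connected_on G (verts G - ends G e)"
    using contractible e(1) edges by (simp_all add: two_connected_contract_edge_iff[OF G])
  then have "edges_within left_side (ends G e) = {Some e}"
    "connected_on left_side (V\<^sub>1 - ends G e)"
    using e(1) not_xy connected_on_left_Diff[OF ends_e not_xy]
    by (auto simp: edges_within_side[OF E1_subset])
  then show ?thesis
    using e(1) two_connected_contract_edge_iff[OF two_connected_left[OF G], of "Some e"] by simp
qed

lemma (in two_separation) two_connected_contract_single:
  assumes G: "two_connected G" and contractible: "two_connected (contract G {e})" and e: "E\<^sub>1 = {e}"
  shows "two_connected (contract right_side {None})"
proof -
  note single = single_edge_left[OF two_connected_left[OF G] e]
  have "verts G = V\<^sub>2" using single(1) verts swap.xy_in_V1 by auto
  moreover have within: "edges_within G {x, y} = {e}" and "connected_on G (verts G - {x, y})"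
    using contractible e edges single(2) by (simp_all add: two_connected_contract_edge_iff[OF G])
  ultimately have "connected_on right_side (V\<^sub>2 - {x, y})"
    using swap.connected_on_left_iff[of "V\<^sub>2 - {x, y}"] by auto
  moreover have "edges_within right_side {x, y} = {None}"
    using within e edges_Int by (auto simp: edges_within_side[OF swap.E1_subset])
  ultimately show ?thesis
    using two_connected_contract_edge_iff[OF swap.two_connected_left[OF G], of None] by simp
qed

subsection \<open>Gluing weights\<close>

locale weighted_two_separation = two_separation +
  fixes \<delta> :: nat and w c d
  assumes two_connected: "two_connected G"
    and left: "spade_weighting \<delta> left_side (case_option c w)"
    and right: "spade_weighting \<delta> right_side (case_option d w)"
    and virtual_sum: "c + d = \<delta>"

sublocale weighted_two_separation \<subseteq> swap: weighted_two_separation G V\<^sub>2 V\<^sub>1 E\<^sub>2 E\<^sub>1 x y \<delta> w d c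
  by unfold_locales (use two_connected left right virtual_sum in auto)

lemma (in weighted_two_separation) sum_E1: "c + sum w E\<^sub>1 = \<delta> * (card V\<^sub>1 - 1)"
  using left sum_left[of c w] by (simp add: spade_weighting_def balanced_def)

lemma (in weighted_two_separation) sum_E2: "sum w E\<^sub>2 = \<delta> * (card V\<^sub>2 - 2) + c"
proof -
  obtain q where "card V\<^sub>2 = q + 2" using swap.card_V1_ge2 by (metis le_add_diff_inverse2)
  then show ?thesis using swap.sum_E1 virtual_sum by (simp add: algebra_simps)
qed

lemma (in weighted_two_separation) tight_inside:
  assumes "good_flat G S" "S \<subseteq> V\<^sub>1" "\<not> {x, y} \<subseteq> S"
  shows "tight \<delta> G w S"
  using assms(1) left good_flat_left_inside_iff[OF two_connected assms(2,3)]
    tight_left_inside_iff[OF assms(2,3), of \<delta> c w]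
  by (simp add: spade_weighting_def balanced_def)

lemma (in weighted_two_separation) tight_covering_V2:
  assumes "good_flat G S" "V\<^sub>2 \<subseteq> S"
  shows "tight \<delta> G w S"
  using two_connected assms
proof (rule good_flat_covering_V2)
  fix T assume T: "{x, y} \<subseteq> T" "T \<subseteq> V\<^sub>1" "S = T \<union> V\<^sub>2" "good_flat left_side T"
  then show ?thesis
    using left tight_left_across_iff[OF T(1,2) sum_E2]
    by (simp add: spade_weighting_def balanced_def)
next
  assume S: "S = V\<^sub>2" "edges_within G S = E\<^sub>2" "two_connected (delete_edges right_side {None})"
  have "d = 1" using right S(3) by (auto simp: spade_weighting_def weight_function_def)
  then show ?thesis using S(1,2) swap.sum_E1 by (simp add: tight_def)
qed

lemma (in weighted_two_separation) single_edge_weight: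
  assumes "E\<^sub>1 = {e}"
  shows "w e = d"
  using sum_E1 single_edge_left(1)[OF two_connected_left[OF two_connected] assms] assms xy
    virtual_sum by simp

lemma (in weighted_two_separation) weight_of_E1:
  assumes e: "e \<in> E\<^sub>1"
  shows "w e \<in> {1, \<delta> - 1}" "two_connected (delete_edges G {e}) \<Longrightarrow> w e = 1"
    "two_connected (contract G {e}) \<Longrightarrow> w e = \<delta> - 1"
proof -
  have left_weight: "w e \<in> {1, \<delta> - 1}"
    "two_connected (delete_edges left_side {Some e}) \<Longrightarrow> w e = 1"
    "two_connected (contract left_side {Some e}) \<Longrightarrow> w e = \<delta> - 1"
    using left e by (auto simp: spade_weighting_def weight_function_def)
  have right_weight: "two_connected (delete_edges right_side {None}) \<Longrightarrow> d = 1"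
    "two_connected (contract right_side {None}) \<Longrightarrow> d = \<delta> - 1"
    using right by (auto simp: spade_weighting_def weight_function_def)
  note two_connected_left = two_connected_left[OF two_connected]
  show "w e \<in> {1, \<delta> - 1}" by (rule left_weight(1))
  show "w e = 1" if "two_connected (delete_edges G {e})"
    using that e left_weight(2) right_weight(1) single_edge_weight two_connected_delete_left
      two_connected_delete_single[OF two_connected_left] by blast
  show "w e = \<delta> - 1" if "two_connected (contract G {e})"
    using that e left_weight(3) right_weight(2) single_edge_weight
      two_connected_contract_left[OF two_connected] two_connected_contract_single[OF two_connected]
    by blast
qed

theorem (in weighted_two_separation) spade_weighting_glued: "spade_weighting \<delta> G w"
proof -
  have "weight_function \<delta> G w"
    unfolding weight_function_def edges using weight_of_E1 swap.weight_of_E1 by blast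
  moreover have "sum w (edges G) = \<delta> * (card (verts G) - 1)"
    using total_weight_iff[OF sum_E1] sum_E2 by simp
  moreover have "tight \<delta> G w S" if S: "good_flat G S" for S
    using good_flat_inside_cases[OF S] good_flat_across_cases[OF two_connected S]
      tight_inside[OF S] swap.tight_inside[OF S]
      tight_covering_V2[OF S] swap.tight_covering_V2[OF S]
    by blast
  ultimately show ?thesis by (auto simp: spade_weighting_def balanced_def weight_function_def)
qed

lemma (in two_separation) ex_spade_weighting_if_sides:
  assumes left: "two_connected left_side" "spade_weighting \<delta> left_side w\<^sub>1"
    and right: "two_connected right_side" "spade_weighting \<delta> right_side w\<^sub>2"
    and virtual: "w\<^sub>1 None + w\<^sub>2 None = \<delta>"
  shows "\<exists>w. spade_weighting \<delta> G w \<and> (\<forall>e\<in>E\<^sub>1. w e = w\<^sub>1 (Some e))"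
proof -
  define w where "w e = (if e \<in> E\<^sub>1 then w\<^sub>1 (Some e) else w\<^sub>2 (Some e))" for e
  have "spade_weighting \<delta> left_side (case_option (w\<^sub>1 None) w)"
    using left(2) by (rule spade_weighting_cong[THEN iffD1, rotated]) (auto simp: w_def)
  moreover have "spade_weighting \<delta> right_side (case_option (w\<^sub>2 None) w)"
    using right(2) by (rule spade_weighting_cong[THEN iffD1, rotated])
      (use edges_Int in \<open>auto simp: w_def\<close>)
  ultimately interpret weighted_two_separation G V\<^sub>1 V\<^sub>2 E\<^sub>1 E\<^sub>2 x y \<delta> w "w\<^sub>1 None" "w\<^sub>2 None"
    by unfold_locales (use two_connected_if_sides left right virtual in auto)
  show ?thesis using spade_weighting_glued by (intro exI[of _ w]) (simp add: w_def)
qed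

section \<open>Two-terminal vertex sets\<close>

definition two_terminal :: "('v, 'e) pre_multigraph \<Rightarrow> 'v set \<Rightarrow> 'v \<Rightarrow> 'v \<Rightarrow> bool" where
  "two_terminal G S u v \<longleftrightarrow> S \<subset> verts G \<and> u \<in> S \<and> v \<in> S \<and> u \<noteq> v \<and> connected_on G S \<and>
     (\<forall>p\<in>S. \<forall>q\<in>verts G - S. adj G p q \<longrightarrow> p = u \<or> p = v)"

definition block :: "('v, 'e) pre_multigraph \<Rightarrow> 'v set \<Rightarrow> 'v \<Rightarrow> 'v \<Rightarrow> bool" where
  "block G S u v \<longleftrightarrow> two_terminal G S u v \<and> two_connected (induced G S)"

definition series_split ::
  "('v, 'e) pre_multigraph \<Rightarrow> 'v set \<Rightarrow> 'v \<Rightarrow> 'v \<Rightarrow> 'v \<Rightarrow> 'v set \<Rightarrow> 'v set \<Rightarrow> bool" where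
  "series_split G S u v z X Y \<longleftrightarrow> X \<union> Y = S \<and> X \<inter> Y = {z} \<and>
     two_terminal G X u z \<and> two_terminal G Y z v \<and> (\<forall>a\<in>X - {z}. \<forall>b\<in>Y - {z}. \<not> adj G a b)"

lemma two_terminal_commute: "two_terminal G S u v \<longleftrightarrow> two_terminal G S v u"
  by (auto simp: two_terminal_def)

lemma series_split_commute: "series_split G S u v z X Y \<longleftrightarrow> series_split G S v u z Y X"
  unfolding series_split_def
  using adj_commute[of G] two_terminal_commute[of G X] two_terminal_commute[of G Y]
  by (simp add: Un_commute Int_commute) blast

lemma two_terminal_finite:
  assumes "multigraph G" "two_terminal G S u v"
  shows "finite S"
  using assms multigraph_finite(1) by (auto simp: two_terminal_def intro: finite_subset)

lemma block_Un_component: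
  assumes G: "two_connected G" and T: "block G T u v" and D: "disconnection G (verts G - T) D U"
  shows "block G (T \<union> D) u v"
proof -
  note multigraph_G = two_connected_multigraph[OF G]
  have T_block: "T \<subset> verts G" "two_connected (induced G T)" "u \<in> T" "v \<in> T" "u \<noteq> v"
    using T by (auto simp: block_def two_terminal_def)
  have D_component: "D \<subseteq> verts G - T" "D \<noteq> {}" "T \<union> D \<subset> verts G"
    using D T_block(1) by (auto simp: disconnection_def)
  have finite_union: "finite (T \<union> D)"
    using D_component(3) two_connected_finite(1)[OF G] by (meson finite_subset psubset_imp_subset)
  have "2 \<le> card T" using two_connected_card_verts[OF T_block(2)] by simp
  moreover have "card T < card (T \<union> D)"
    using D_component finite_union by (intro psubset_card_mono) auto
  moreover have "connected_on G (T \<union> D - {z})" if z: "z \<in> T \<union> D" for z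
  proof -
    have "connected_on G (T - {z} \<union> (D - {z}))"
    proof (rule connected_on_Un_closed)
      show "connected_on G (verts G - {z})"
        using two_connected_connected_on(2)[OF G] z D_component(3) by auto
      show "connected_on G (T - {z})"
        using two_connected_induced_connected_on[OF T_block(2)] by (cases "z \<in> T") auto
      show "b \<in> D - {z} \<union> (T - {z})" if "a \<in> D - {z}" "b \<in> verts G - {z}" "adj G a b" for a b
        using D that by (auto simp: disconnection_def)
    qed (use D_component T_block(1) in auto)
    then show ?thesis by (simp add: Un_Diff)
  qed
  ultimately have two_connected_union: "two_connected (induced G (T \<union> D))"
    using two_connected_induced_iff[OF multigraph_G psubset_imp_subset[OF D_component(3)]] by auto
  have attached: "p = u \<or> p = v" if "p \<in> T \<union> D" "q \<in> verts G - (T \<union> D)" "adj G p q" for p q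
    using T D that by (auto simp: disconnection_def block_def two_terminal_def)
  show ?thesis
    using D_component(3) T_block two_connected_union attached
      two_connected_induced_connected_on(1)[OF two_connected_union]
    by (auto simp: block_def two_terminal_def)
qed

lemma block_extends_to_good_flat:
  assumes G: "two_connected G" and T: "block G T u v"
  shows "\<exists>S. good_flat G S \<and> block G S u v"
  using T
proof (induction "card (verts G - T)" arbitrary: T rule: less_induct)
  case less
  then have T: "T \<subset> verts G" "two_connected (induced G T)"
    by (auto simp: block_def two_terminal_def)
  show ?case
  proof (cases "connected_on G (verts G - T)")
    case True
    then show ?thesis using T less.prems by (auto simp: good_flat_iff[OF G])
  next
    case False
    then obtain D U where D: "disconnection G (verts G - T) D U"
      by (rule not_connected_onE) (use T in auto)
    have "card (verts G - (T \<union> D)) < card (verts G - T)"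
      using D two_connected_finite(1)[OF G]
      by (intro psubset_card_mono) (auto simp: disconnection_def)
    then show ?thesis using less.hyps block_Un_component[OF G less.prems D] by blast
  qed
qed

lemma block_if_parallel_edges:
  assumes G: "two_connected G" and "3 \<le> card (verts G)" and ab: "a \<in> verts G" "b \<in> verts G" "a \<noteq> b"
    and parallel: "2 \<le> card (edges_within G {a, b})"
  shows "block G {a, b} a b"
proof -
  have two_connected_ab: "two_connected (induced G {a, b})"
    using ab parallel by (simp add: two_connected_induced_iff[OF two_connected_multigraph[OF G]])
  moreover obtain z where "z \<in> verts G" "z \<noteq> a" "z \<noteq> b" using third_element[OF assms(2)] .
  ultimately show ?thesis
    using ab two_connected_induced_connected_on(1)[OF two_connected_ab]
    by (auto simp: block_def two_terminal_def)
qed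

subsection \<open>Series decomposition\<close>

lemma disconnection_meets_terminals:
  assumes G: "two_connected G" and S: "two_terminal G S u v"
    and z: "z \<in> S" "disconnection G (S - {z}) A B"
  shows "u \<in> A \<or> v \<in> A"
proof -
  have A_sub: "A \<subset> S" "A \<noteq> {}" "z \<notin> A" "S \<subset> verts G"
    using S z by (auto simp: two_terminal_def disconnection_def)
  then have "A \<subseteq> verts G - {z}" "A \<noteq> verts G - {z}" using z(1) by blast+
  moreover have "connected_on G (verts G - {z})"
    using two_connected_connected_on(2)[OF G] z(1) A_sub(4) by blast
  ultimately obtain a b where ab: "a \<in> A" "b \<in> verts G - {z} - A" "adj G a b"
    using A_sub(2) by (meson connected_on_crossing)
  moreover have "b \<notin> S" using ab z(2) by (auto simp: disconnection_def)
  ultimately show ?thesis using S A_sub(1) by (auto simp: two_terminal_def)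
qed

lemma two_terminal_insert_cut_vertex:
  assumes S: "two_terminal G S u v" and z: "z \<in> S" "disconnection G (S - {z}) A B"
    and uv: "u \<in> A" "v \<in> B"
  shows "two_terminal G (insert z A) u z"
proof -
  have A: "A \<subseteq> S - {z}" "v \<notin> A" "z \<noteq> v" using z uv by (auto simp: disconnection_def)
  have "connected_on G ({z} \<union> A)"
  proof (rule connected_on_Un_closed)
    show "connected_on G S" using S by (simp add: two_terminal_def)
    show "b \<in> A \<union> {z}" if "a \<in> A" "b \<in> S" "adj G a b" for a b
      using z(2) that by (auto simp: disconnection_def)
  qed (use A(1) z(1) in auto)
  then have "connected_on G (insert z A)" by simp
  moreover have "p = u \<or> p = z" if "p \<in> insert z A" "q \<in> verts G - insert z A" "adj G p q" for p q
  proof (cases "q \<in> S")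
    case True
    then show ?thesis using z(2) that by (auto simp: disconnection_def)
  next
    case False
    then show ?thesis using S that A by (auto simp: two_terminal_def)
  qed
  moreover have "insert z A \<subset> verts G" "u \<noteq> z"
    using S z(1) A uv(1) by (auto simp: two_terminal_def)
  ultimately show ?thesis using uv(1) by (simp add: two_terminal_def)
qed

lemma series_split_if_disconnection:
  assumes S: "two_terminal G S u v" and z: "z \<in> S" "disconnection G (S - {z}) A B"
    and uv: "u \<in> A" "v \<in> B"
  shows "series_split G S u v z (insert z A) (insert z B)"
proof -
  have "two_terminal G (insert z A) u z"
    using assms by (rule two_terminal_insert_cut_vertex)
  moreover have "two_terminal G (insert z B) z v"
    using S z uv two_terminal_insert_cut_vertex[of G S v u z B A]
    by (simp add: two_terminal_commute disconnection_commute)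
  ultimately show ?thesis using z by (auto simp: series_split_def disconnection_def)
qed

lemma ex_series_split:
  assumes G: "two_connected G" and S: "two_terminal G S u v" and ge3: "3 \<le> card S"
    and not_two_connected: "\<not> two_connected (induced G S)"
  obtains z X Y where "series_split G S u v z X Y"
proof -
  have "S \<subseteq> verts G" using S by (auto simp: two_terminal_def)
  then obtain z where z: "z \<in> S" "\<not> connected_on G (S - {z})"
    using ge3 not_two_connected
    by (auto simp: two_connected_induced_iff[OF two_connected_multigraph[OF G]])
  obtain A B where separation: "disconnection G (S - {z}) A B"
  proof (rule not_connected_onE[OF z(2)])
    have "u \<in> S" "v \<in> S" "u \<noteq> v" using S by (auto simp: two_terminal_def)
    then show "S - {z} \<noteq> {}" by blast
  qed
  then have separation_commuted: "disconnection G (S - {z}) B A"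
    by (simp add: disconnection_commute)
  have "u \<in> A \<and> v \<in> B \<or> u \<in> B \<and> v \<in> A"
    using disconnection_meets_terminals[OF G S z(1) separation]
      disconnection_meets_terminals[OF G S z(1) separation_commuted] separation
        by (auto simp: disconnection_def)
  then show thesis
    using that series_split_if_disconnection[OF S z(1)] separation separation_commuted by blast
qed

lemma series_splitD:
  assumes "series_split G S u v z X Y"
  shows "two_terminal G X u z" "two_terminal G Y z v" "X \<union> Y = S" "X \<inter> Y = {z}" "X \<subset> S" "Y \<subset> S"
proof -
  show XY: "two_terminal G X u z" "two_terminal G Y z v" "X \<union> Y = S" "X \<inter> Y = {z}"
    using assms by (simp_all add: series_split_def)
  have "u \<in> X - {z}" "v \<in> Y - {z}" using XY(1,2) by (auto simp: two_terminal_def)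
  then show "X \<subset> S" "Y \<subset> S" using XY(3,4) by blast+
qed

lemma series_split_edges:
  assumes G: "multigraph G" and split: "series_split G S u v z X Y"
  shows "edges_within G S = edges_within G X \<union> edges_within G Y"
    "edges_within G X \<inter> edges_within G Y = {}"
proof -
  note XY = series_splitD(3,4)[OF split]
  have no_adj: "\<not> adj G a b" if "a \<in> X - {z}" "b \<in> Y - {z}" for a b
    using split that by (simp add: series_split_def)
  have "ends G e \<subseteq> X \<or> ends G e \<subseteq> Y" if e: "e \<in> edges G" "ends G e \<subseteq> S" for e
  proof -
    obtain a b where ends_e: "ends G e = {a, b}" by (rule multigraph_endsE[OF G e(1)])
    then have "adj G a b" "adj G b a" using adjI[OF e(1)] by (auto simp: insert_commute)
    then show ?thesis using no_adj[of a b] no_adj[of b a] e(2) ends_e XY by auto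
  qed
  then show "edges_within G S = edges_within G X \<union> edges_within G Y"
    using XY(1) by (auto simp: edges_within_def)
  have False if e: "e \<in> edges G" "ends G e \<subseteq> X" "ends G e \<subseteq> Y" for e
  proof -
    have "ends G e \<subseteq> {z}" using e(2,3) XY(2) by blast
    then show False using card_mono[of "{z}" "ends G e"] multigraph_ends(2)[OF G e(1)] by simp
  qed
  then show "edges_within G X \<inter> edges_within G Y = {}" by (auto simp: edges_within_def)
qed

lemma series_split_connected_complement:
  assumes G: "two_connected G" and S: "connected_on G (verts G - S)" "S \<subset> verts G"
    and split: "series_split G S u v z X Y"
  shows "connected_on G (verts G - X)"
proof -
  note XY = series_splitD(3,4)[OF split]
  have "connected_on G ((verts G - S) \<union> (Y - {z}))"
  proof (rule connected_on_Un_closed)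
    show "connected_on G (verts G - {z})"
      using two_connected_connected_on(2)[OF G] XY S(2) by blast
    show "b \<in> Y - {z} \<union> (verts G - S)" if "a \<in> Y - {z}" "b \<in> verts G - {z}" "adj G a b" for a b
    proof -
      have "b \<notin> X - {z}" using split that adj_commute[of G a b] by (auto simp: series_split_def)
      then show ?thesis using that(2) XY(1) by blast
    qed
  qed (use S XY in \<open>auto simp: subset_iff\<close>)
  moreover have "(verts G - S) \<union> (Y - {z}) = verts G - X" using XY S(2) by blast
  ultimately show ?thesis by simp
qed

lemma two_terminal_single_edge:
  assumes G: "two_connected G" and terminals: "two_terminal G {u, v} u v"
    and not_two_connected: "\<not> two_connected (induced G {u, v})"
  obtains e where "edges_within G {u, v} = {e}"
proof -
  note multigraph_G = two_connected_multigraph[OF G]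
  have uv: "u \<noteq> v" "{u, v} \<subseteq> verts G" "connected_on G {u, v}"
    using terminals by (auto simp: two_terminal_def)
  obtain b where "b \<in> {u, v} - {u}" "adj G u b"
    by (rule connected_on_neighbour[OF uv(3), of u]) (use uv(1) in auto)
  then obtain e where "e \<in> edges_within G {u, v}" by (auto simp: adj_def edges_within_def)
  moreover have "card (edges_within G {u, v}) < 2"
    using not_two_connected uv(1) by (auto simp: two_connected_induced_iff[OF multigraph_G uv(2)])
  ultimately have "edges_within G {u, v} = {e}"
    using card_seteq[of "edges_within G {u, v}" "{e}"] multigraph_finite(3)[OF multigraph_G] by simp
  then show thesis by (rule that)
qed

lemma two_terminal_series_induct [consumes 2, case_names block edge series]:
  assumes G: "two_connected G" and S: "two_terminal G S u v"
    and block: "\<And>S u v. block G S u v \<Longrightarrow> P S u v"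
    and edge: "\<And>u v e. two_terminal G {u, v} u v \<Longrightarrow> edges_within G {u, v} = {e} \<Longrightarrow> P {u, v} u v"
    and series: "\<And>S u v z X Y. two_terminal G S u v \<Longrightarrow> \<not> two_connected (induced G S) \<Longrightarrow>
      series_split G S u v z X Y \<Longrightarrow> P X u z \<Longrightarrow> P Y z v \<Longrightarrow> P S u v"
  shows "P S u v"
  using S
proof (induction "card S" arbitrary: S u v rule: less_induct)
  case less
  note finite_S = two_terminal_finite[OF two_connected_multigraph[OF G] less.prems]
  have uv: "{u, v} \<subseteq> S" "u \<noteq> v" using less.prems by (auto simp: two_terminal_def)
  then have "2 \<le> card S" using card_mono[OF finite_S uv(1)] by simp
  then consider (is_block) "two_connected (induced G S)"
    | (splits) "\<not> two_connected (induced G S)" "3 \<le> card S"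
    | (two_verts) "\<not> two_connected (induced G S)" "card S = 2" by linarith
  then show ?case
  proof cases
    case is_block
    then show ?thesis using less.prems block by (simp add: block_def)
  next
    case splits
    obtain z X Y where split: "series_split G S u v z X Y"
      by (rule ex_series_split[OF G less.prems splits(2,1)])
    note XY = series_splitD[OF split]
    show ?thesis
      using less.prems splits(1) split less.hyps[OF psubset_card_mono[OF finite_S XY(5)] XY(1)]
        less.hyps[OF psubset_card_mono[OF finite_S XY(6)] XY(2)]
      by (rule series)
  next
    case two_verts
    then have S: "S = {u, v}" using uv finite_S card_subset_eq[of S "{u, v}"] by simp
    then obtain e where "edges_within G {u, v} = {e}"
      using two_terminal_single_edge[OF G] less.prems two_verts(1) by blast
    then show ?thesis using edge less.prems S by simp
  qed
qed

section \<open>Paths\<close>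

lemma is_path_Nil_iff: "is_path G vs [] \<longleftrightarrow> (\<exists>u\<in>verts G. vs = [u])"
  by (auto simp: is_path_def length_Suc_conv)

lemma is_path_Cons_iff:
  "is_path G (u # vs) (e # es) \<longleftrightarrow>
     u \<in> verts G \<and> e \<in> edges G \<and> u \<notin> set vs \<and> ends G e = {u, hd vs} \<and> is_path G vs es"
  by (cases vs) (auto simp: is_path_def All_less_Suc2)

lemma is_path_induct [consumes 1, case_names Nil Cons]:
  assumes "is_path G vs es"
    and "\<And>u. u \<in> verts G \<Longrightarrow> P [u] []"
    and "\<And>u vs e es. is_path G vs es \<Longrightarrow> u \<in> verts G \<Longrightarrow> e \<in> edges G \<Longrightarrow> u \<notin> set vs \<Longrightarrow>
      ends G e = {u, hd vs} \<Longrightarrow> P vs es \<Longrightarrow> P (u # vs) (e # es)"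
  shows "P vs es"
  using assms(1)
proof (induction es arbitrary: vs)
  case Nil
  then show ?case using assms(2) by (auto simp: is_path_Nil_iff)
next
  case (Cons e es)
  then obtain u ws where "vs = u # ws" by (cases vs) (auto simp: is_path_def)
  then show ?case using Cons assms(3) by (simp add: is_path_Cons_iff)
qed

lemma is_path_not_Nil: "is_path G vs es \<Longrightarrow> vs \<noteq> []"
  by (auto simp: is_path_def)

lemma is_path_endpoints:
  assumes "is_path G vs es"
  shows "hd vs \<in> set vs" "last vs \<in> set vs"
  using is_path_not_Nil[OF assms] by simp_all

lemma is_path_ends_subset:
  assumes "is_path G vs es" "e \<in> set es"
  shows "ends G e \<subseteq> set vs"
  using assms
proof (induction rule: is_path_induct)
  case (Cons u vs f es)
  then show ?case using is_path_endpoints(1)[OF Cons.hyps(1)] by auto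
qed simp

lemma is_path_distinct_edges:
  assumes "is_path G vs es"
  shows "distinct es"
  using assms
proof (induction rule: is_path_induct)
  case (Cons u vs e es)
  then show ?case using is_path_ends_subset[OF Cons.hyps(1), of e] by auto
qed simp

lemma is_path_connected_on:
  assumes "is_path G vs es"
  shows "connected_on G (set vs)"
  using assms
proof (induction rule: is_path_induct)
  case (Cons u vs e es)
  have "connected_on G ({u} \<union> set vs)"
    using Cons adjI[OF Cons.hyps(3)] is_path_endpoints(1)[OF Cons.hyps(1)]
    by (intro connected_on_Un_adj) auto
  then show ?case by simp
qed simp

lemma is_path_append:
  assumes "is_path G vs es" "is_path G vs' es'"
    and "last vs = hd vs'" "set vs \<inter> set vs' = {last vs}"
  shows "is_path G (vs @ tl vs') (es @ es')"
  using assms(1,3,4)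
proof (induction rule: is_path_induct)
  case (Nil u)
  have "u # tl vs' = vs'" using Nil(2) is_path_not_Nil[OF assms(2)] by simp
  then show ?case using assms(2) by simp
next
  case (Cons u vs e es)
  have vs: "vs \<noteq> []" "last vs \<in> set vs"
    using is_path_not_Nil[OF Cons.hyps(1)] is_path_endpoints(2)[OF Cons.hyps(1)] .
  have "set vs \<inter> set vs' = {last vs}" and "u \<notin> set vs'"
    using Cons.prems Cons.hyps(4) vs by auto
  moreover have "set (tl vs') \<subseteq> set vs'" by (cases vs') auto
  ultimately show ?case using Cons vs(1) by (auto simp: is_path_Cons_iff)
qed

lemma is_path_butlast: "is_path G vs es \<Longrightarrow> es \<noteq> [] \<Longrightarrow> is_path G (butlast vs) (butlast es)"
  by (auto simp: is_path_def nth_butlast distinct_butlast dest: in_set_butlastD)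

lemma is_path_tl: "is_path G vs es \<Longrightarrow> es \<noteq> [] \<Longrightarrow> is_path G (tl vs) (tl es)"
  by (cases vs; cases es) (auto simp: is_path_Cons_iff is_path_def)

lemma set_tl_butlast:
  assumes "distinct vs"
  shows "set (tl (butlast vs)) = set vs - {hd vs, last vs}"
proof (cases vs rule: rev_cases)
  case (snoc us v)
  then show ?thesis using assms by (cases us) auto
qed simp

lemma is_path_interior_connected_on:
  assumes "is_path G vs es" "2 \<le> length es"
  shows "connected_on G (set vs - {hd vs, last vs})"
proof -
  have "is_path G (butlast vs) (butlast es)"
    using assms by (intro is_path_butlast) auto
  moreover have "butlast es \<noteq> []" using assms(2) by (cases es rule: rev_cases) auto
  ultimately have "is_path G (tl (butlast vs)) (tl (butlast es))" by (rule is_path_tl)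
  moreover have "distinct vs" using assms(1) by (simp add: is_path_def)
  ultimately show ?thesis using is_path_connected_on set_tl_butlast by metis
qed

lemma is_path_hd_neq_last:
  assumes "is_path G vs es" "es \<noteq> []"
  shows "hd vs \<noteq> last vs"
proof -
  obtain u ws where vs: "vs = u # ws" using is_path_not_Nil[OF assms(1)] by (cases vs) auto
  then have "ws \<noteq> []" "u \<notin> set ws" using assms by (auto simp: is_path_def)
  then show ?thesis using last_in_set[of ws] vs by auto
qed

lemma is_path_edge_not_closing:
  assumes "is_path G vs es" "2 \<le> length es" "e \<in> set es"
  shows "ends G e \<noteq> {hd vs, last vs}"
proof
  assume e: "ends G e = {hd vs, last vs}"
  obtain f fs where es: "es = f # fs" using assms(2) by (cases es) auto
  then have "fs \<noteq> []" using assms(2) by auto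
  obtain u ws where vs: "vs = u # ws" using is_path_not_Nil[OF assms(1)] by (cases vs) auto
  have ws: "is_path G ws fs" "u \<notin> set ws" "ends G f = {u, hd ws}"
    using assms(1) by (simp_all add: vs es is_path_Cons_iff)
  show False
  proof (cases "e = f")
    case True
    then have "hd ws = last ws"
      using e ws(3) vs is_path_endpoints[OF ws(1)] is_path_not_Nil[OF ws(1)]
      by (auto simp: doubleton_eq_iff)
    then show False using is_path_hd_neq_last[OF ws(1) \<open>fs \<noteq> []\<close>] by simp
  next
    case False
    then have "ends G e \<subseteq> set ws" using is_path_ends_subset[OF ws(1)] assms(3) es by simp
    then show False using e ws(2) vs by simp
  qed
qed

lemma is_path_edges_at_hd:
  assumes "is_path G vs es"
  shows "card {e \<in> set es. hd vs \<in> ends G e} \<le> 1"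
  using assms
proof (induction rule: is_path_induct)
  case (Cons u vs e es)
  then have "{f \<in> set (e # es). u \<in> ends G f} \<subseteq> {e}"
    using is_path_ends_subset[OF Cons.hyps(1)] by auto
  then show ?case using card_mono[of "{e}"] by fastforce
qed simp

lemma is_path_edges_at_vertex_le:
  assumes "is_path G vs es"
  shows "card {e \<in> set es. v \<in> ends G e} \<le> 2"
  using assms
proof (induction rule: is_path_induct)
  case (Cons u vs e es)
  show ?case
  proof (cases "v \<in> {u, hd vs}")
    case True
    have "card {f \<in> set es. v \<in> ends G f} \<le> 1"
    proof (cases "v = u")
      case True
      then have "{f \<in> set es. v \<in> ends G f} = {}"
        using is_path_ends_subset[OF Cons.hyps(1)] Cons.hyps(4) by auto
      then show ?thesis by (simp only: card.empty)
    next
      case False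
      then show ?thesis using True is_path_edges_at_hd[OF Cons.hyps(1)] by simp
    qed
    moreover have "{f \<in> set (e # es). v \<in> ends G f} = insert e {f \<in> set es. v \<in> ends G f}"
      using True Cons.hyps(5) by auto
    ultimately show ?thesis by (simp add: card_insert_if)
  next
    case False
    then have "{f \<in> set (e # es). v \<in> ends G f} = {f \<in> set es. v \<in> ends G f}"
      using Cons.hyps(5) by auto
    then show ?thesis using Cons.IH by simp
  qed
qed simp

lemma is_path_edges_at_interior:
  assumes "is_path G vs es" "v \<in> set vs - {hd vs, last vs}"
  shows "2 \<le> card {e \<in> set es. v \<in> ends G e}"
  using assms
proof (induction rule: is_path_induct)
  case (Cons u vs e es)
  have vs: "vs \<noteq> []" by (rule is_path_not_Nil[OF Cons.hyps(1)])
  show ?case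
  proof (cases "v = hd vs")
    case True
    then have "es \<noteq> []" using Cons.prems Cons.hyps(1) by (auto simp: is_path_Nil_iff)
    then obtain w ws f fs where ws: "vs = w # ws" "es = f # fs"
      using vs by (meson neq_Nil_conv)
    then have "v \<in> ends G f" "f \<in> set es" using Cons.hyps(1) True by (auto simp: is_path_Cons_iff)
    moreover from this have "f \<noteq> e"
      using is_path_ends_subset[OF Cons.hyps(1)] Cons.hyps(4,5) by auto
    ultimately have "card {e, f} \<le> card {g \<in> set (e # es). v \<in> ends G g}"
      using True Cons.hyps(5) by (intro card_mono) auto
    then show ?thesis using \<open>f \<noteq> e\<close> by simp
  next
    case False
    then have "2 \<le> card {f \<in> set es. v \<in> ends G f}" using Cons.IH Cons.prems vs by auto
    also have "\<dots> \<le> card {f \<in> set (e # es). v \<in> ends G f}" by (intro card_mono) auto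
    finally show ?thesis .
  qed
qed simp

definition induced_path :: "('v, 'e) pre_multigraph \<Rightarrow> 'v set \<Rightarrow> 'v list \<Rightarrow> 'e list \<Rightarrow> bool" where
  "induced_path G S vs es \<longleftrightarrow> is_path G vs es \<and> set vs = S \<and> set es = edges_within G S"

lemma induced_path_series:
  assumes G: "multigraph G" and split: "series_split G S u v z X Y"
    and X: "induced_path G X vs es" "hd vs = u" "last vs = z"
    and Y: "induced_path G Y vs' es'" "hd vs' = z" "last vs' = v"
  shows "induced_path G S (vs @ tl vs') (es @ es')" "hd (vs @ tl vs') = u" "last (vs @ tl vs') = v"
proof -
  note split_props = series_splitD[OF split]
  have path: "is_path G vs es" "is_path G vs' es'"
    using X(1) Y(1) by (simp_all add: induced_path_def)
  have sets: "set vs = X" "set vs' = Y" using X(1) Y(1) by (simp_all add: induced_path_def)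
  have not_Nil: "vs \<noteq> []" "vs' \<noteq> []" using path is_path_not_Nil by auto
  have vs_Cons: "vs' = z # tl vs'" using not_Nil(2) Y(2) by (cases vs') auto
  have "tl vs' \<noteq> []"
    using vs_Cons Y(3) split_props(2) by (metis last.simps two_terminal_def)
  then show "hd (vs @ tl vs') = u" "last (vs @ tl vs') = v"
    using not_Nil X(2) Y(3) by (simp_all add: last_tl)
  have "is_path G (vs @ tl vs') (es @ es')"
    using path by (rule is_path_append) (use X(3) Y(2) sets split_props(4) in auto)
  moreover have "set (vs @ tl vs') = S"
  proof -
    have "set vs' = insert z (set (tl vs'))" using vs_Cons by (metis list.simps(15))
    then show ?thesis using sets split_props(3,4) by auto
  qed
  ultimately show "induced_path G S (vs @ tl vs') (es @ es')"
    using X(1) Y(1) series_split_edges(1)[OF G split] by (simp add: induced_path_def)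
qed

lemma block_or_induced_path:
  assumes G: "two_connected G" and S: "two_terminal G S u v"
  shows "(\<exists>T a b. block G T a b) \<or> (\<exists>vs es. induced_path G S vs es \<and> hd vs = u \<and> last vs = v)"
  using G S
proof (induction rule: two_terminal_series_induct)
  case (block S u v)
  then show ?case by blast
next
  case (edge u v e)
  then have "e \<in> edges G" "ends G e \<subseteq> {u, v}" by (auto simp: edges_within_def)
  then have "ends G e = {u, v}" using multigraph_ends_eq[OF two_connected_multigraph[OF G]] by blast
  then have "induced_path G {u, v} [u, v] [e]"
    using edge \<open>e \<in> edges G\<close> by (auto simp: induced_path_def is_path_def two_terminal_def)
  then show ?case by fastforce
next
  case (series S u v z X Y)
  then consider "\<exists>T a b. block G T a b" | vs es vs' es' where
    "induced_path G X vs es" "hd vs = u" "last vs = z"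
    "induced_path G Y vs' es'" "hd vs' = z" "last vs' = v" by blast
  then show ?case
    using induced_path_series[OF two_connected_multigraph[OF G] series(3)] by cases metis+
qed

text \<open>Every block of a chain of blocks has weight one less than \<open>\<delta>\<close> times its rank.\<close>

lemma series_weight_bound:
  assumes G: "two_connected G" and w: "balanced \<delta> G w" and \<delta>: "2 < \<delta>"
    and S: "two_terminal G S u v" "connected_on G (verts G - S)"
  shows "sum w (edges_within G S) + 1 \<le> \<delta> * (card S - 1) \<and>
    (\<not> two_connected (induced G S) \<and> 2 \<le> card (edges_within G S) \<longrightarrow>
      sum w (edges_within G S) + 2 \<le> \<delta> * (card S - 1))"
  using G S
proof (induction rule: two_terminal_series_induct)
  case (block S u v)
  then have "good_flat G S" by (simp add: good_flat_iff[OF G] block_def two_terminal_def)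
  then show ?case using w block(1) by (simp add: balanced_def tight_def block_def)
next
  case (edge u v e)
  have "w e \<le> \<delta> - 1" "u \<noteq> v"
    using w edge \<delta> edges_within_subset[of G "{u, v}"] by (auto simp: balanced_def two_terminal_def)
  then show ?case using edge(2) \<delta> by simp
next
  case (series S u v z X Y)
  note multigraph_G = two_connected_multigraph[OF G]
  note XY = series_splitD[OF series(3)]
  have "S \<subset> verts G" using series(1) by (simp add: two_terminal_def)
  then have "connected_on G (verts G - X)" "connected_on G (verts G - Y)"
    using series_split_connected_complement[OF G series.prems] series(3) series_split_commute
    by metis+
  then have bounds: "sum w (edges_within G X) + 1 \<le> \<delta> * (card X - 1)"
    "sum w (edges_within G Y) + 1 \<le> \<delta> * (card Y - 1)"
    using series.IH by blast+
  have finite_XY: "finite X" "finite Y" using XY(1,2) two_terminal_finite[OF multigraph_G] by blast+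
  have "card S + 1 = card X + card Y" using card_Un_Int[OF finite_XY] XY(3,4) by simp
  moreover have "1 \<le> card X" "1 \<le> card Y"
    using finite_XY XY(4) by (auto simp: Suc_le_eq card_gt_0_iff)
  ultimately have "card S - 1 = (card X - 1) + (card Y - 1)" by linarith
  then have "\<delta> * (card S - 1) = \<delta> * (card X - 1) + \<delta> * (card Y - 1)" by (simp add: distrib_left)
  moreover have "sum w (edges_within G S) = sum w (edges_within G X) + sum w (edges_within G Y)"
    using series_split_edges[OF multigraph_G series(3)] multigraph_finite(3)[OF multigraph_G]
    by (simp add: sum.union_disjoint)
  ultimately show ?case using bounds by linarith
qed

section \<open>Cycles and graphs with two vertices\<close>

lemma cycle_multigraph_sel [simp]:
  "verts (cycle_multigraph n) = {..<n}" "edges (cycle_multigraph n) = {..<n}"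
  "ends (cycle_multigraph n) i = {i, Suc i mod n}"
  by (simp_all add: cycle_multigraph_def)

lemma multigraph_cycle: "2 \<le> n \<Longrightarrow> multigraph (cycle_multigraph n)"
  by (auto simp: multigraph_def card_insert_if mod_Suc)

lemma hamiltonian_path_closed_iso:
  assumes path: "is_path G vs es" "set vs = verts G" "es \<noteq> []"
    and e: "edges G = insert e (set es)" "e \<notin> set es" "ends G e = {last vs, hd vs}"
  shows "G \<simeq>\<^sub>m cycle_multigraph (card (verts G))"
proof -
  let ?n = "length vs" and ?es = "es @ [e]"
  have len: "?n = Suc (length es)" and vs: "distinct vs" "vs \<noteq> []"
    and ends: "\<And>i. i < length es \<Longrightarrow> ends G (es ! i) = {vs ! i, vs ! Suc i}"
    using path(1) by (auto simp: is_path_def)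
  have es: "distinct ?es" using is_path_distinct_edges[OF path(1)] e(2) by simp
  have "2 \<le> ?n" using len path(3) by (cases es) auto
  then have C: "multigraph (cycle_multigraph ?n)" by (rule multigraph_cycle)
  have "graph_isomorphism ((!) vs) ((!) ?es) (cycle_multigraph ?n) G"
  proof
    show "bij_betw ((!) vs) (verts (cycle_multigraph ?n)) (verts G)"
      using bij_betw_nth[OF vs(1)] path(2) by simp
    show "bij_betw ((!) ?es) (edges (cycle_multigraph ?n)) (edges G)"
      using bij_betw_nth[OF es] e(1) len by simp
    fix i assume "i \<in> edges (cycle_multigraph ?n)"
    then have "i < length es \<or> i = length es" using len by auto
    then show "ends G (?es ! i) = (!) vs ` ends (cycle_multigraph ?n) i"
      using ends e(3) len vs(2) by (auto simp: nth_append last_conv_nth hd_conv_nth)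
  qed (rule C)
  then have "G \<simeq>\<^sub>m cycle_multigraph ?n"
    using multigraph_iso_sym[OF C] multigraph_iso_iff[OF C] by blast
  then show ?thesis using distinct_card[OF vs(1)] path(2) by simp
qed

lemma connected_on_cycle_interval:
  assumes "a < b" "b \<le> n"
  shows "connected_on (cycle_multigraph n) {a..<b}"
  using Suc_leI[OF assms(1)] assms(2)
proof (induction b rule: dec_induct)
  case (step b)
  have "adj (cycle_multigraph n) (b - 1) b"
    using step by (intro adjI[of "b - 1"]) auto
  then have "connected_on (cycle_multigraph n) ({a..<b} \<union> {b})"
    using step by (intro connected_on_Un_adj) auto
  moreover have "{a..<b} \<union> {b} = {a..<Suc b}" using step(1) by auto
  ultimately show ?case by simp
qed simp

lemma two_connected_cycle:
  assumes n: "3 \<le> n"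
  shows "two_connected (cycle_multigraph n)"
proof -
  let ?C = "cycle_multigraph n"
  have "connected_on ?C ({..<n} - {v})" if v: "v < n" for v
  proof -
    have split: "{..<n} - {v} = {Suc v..<n} \<union> {0..<v}" using v by auto
    consider (first) "v = 0" | (last) "Suc v = n" | (inner) "0 < v" "Suc v < n" using v by linarith
    then show ?thesis
    proof cases
      case first
      then show ?thesis unfolding split using n connected_on_cycle_interval[of 1 n n] by simp
    next
      case last
      then show ?thesis unfolding split using n connected_on_cycle_interval[of 0 v n] by simp
    next
      case inner
      have "adj ?C (n - 1) 0" using n by (intro adjI[of "n - 1"]) auto
      then show ?thesis
        unfolding split using inner
        by (intro connected_on_Un_adj[of _ _ _ "n - 1" 0] connected_on_cycle_interval) auto
    qed
  qed
  moreover have "multigraph ?C" using n by (intro multigraph_cycle) simp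
  ultimately show ?thesis using n by (simp add: two_connected_iff_ge3_verts)
qed

lemma degree_cycle_le: "degree (cycle_multigraph n) v \<le> 2"
proof -
  have "i \<in> {v, (v + n - 1) mod n}" if "i < n" "v = i \<or> v = Suc i mod n" for i
    using that by (cases "Suc i = n") auto
  then have "degree (cycle_multigraph n) v \<le> card {v, (v + n - 1) mod n}"
    unfolding degree_def by (intro card_mono) auto
  also have "\<dots> \<le> 2" by (simp add: card_insert_if)
  finally show ?thesis .
qed

lemma no_good_flat_if_degree_le_2:
  assumes G: "two_connected G" and deg: "\<And>v. v \<in> verts G \<Longrightarrow> degree G v \<le> 2"
  shows "\<not> good_flat G S"
proof
  assume S: "good_flat G S"
  note tS = good_flat_two_connected[OF S]
  obtain a b where ab: "a \<in> S" "b \<in> verts G - S" "adj G a b"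
    using connected_on_crossing[OF two_connected_connected_on(1)[OF G], of S]
      good_flat_psubset[OF S] two_connected_induced_connected_on(1)[OF tS] connected_on_nonempty
    by (metis psubset_eq)
  then obtain e where e: "e \<in> edges G" "ends G e = {a, b}" by (auto simp: adj_def)
  let ?A = "{f \<in> edges_within G S. a \<in> ends G f}"
  have "finite ?A" "e \<notin> ?A"
    using e ab two_connected_finite(2)[OF G] by (simp_all add: edges_within_def)
  then have "Suc (card ?A) = card (insert e ?A)" by simp
  also have "\<dots> \<le> degree G a"
    unfolding degree_def using e edges_within_subset[of G S] two_connected_finite(2)[OF G]
    by (intro card_mono) auto
  also have "\<dots> \<le> 2" using deg ab(1) good_flat_psubset[OF S] by auto
  finally show False using two_connected_degree[OF tS, of a] ab(1) by (simp add: degree_def)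
qed

lemma not_deletable_if_degree_le_2:
  assumes G: "two_connected G" and deg: "\<And>v. v \<in> verts G \<Longrightarrow> degree G v \<le> 2" and e: "e \<in> edges G"
  shows "\<not> two_connected (delete_edges G {e})"
proof
  assume del: "two_connected (delete_edges G {e})"
  obtain a b where ends_e: "ends G e = {a, b}" "a \<in> verts G"
    by (rule multigraph_endsE[OF two_connected_multigraph[OF G] e])
  have "degree (delete_edges G {e}) a < degree G a"
    unfolding degree_def using e ends_e two_connected_finite(2)[OF G]
    by (intro psubset_card_mono) auto
  then show False using two_connected_degree[OF del, of a] deg ends_e(2) by fastforce
qed

lemma sum_weights:
  assumes "finite F" "\<And>e. e \<in> F \<Longrightarrow> w e \<in> {1, \<delta> - 1 :: nat}"
  obtains k l where "card F = k + l" "sum w F = k + l * (\<delta> - 1)"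
    "k = 0 \<longrightarrow> (\<forall>e\<in>F. w e = \<delta> - 1)" "l = 0 \<longrightarrow> (\<forall>e\<in>F. w e = 1)"
proof -
  let ?A = "{e \<in> F. w e = 1}" and ?B = "{e \<in> F. w e \<noteq> 1}"
  have F: "F = ?A \<union> ?B" "?A \<inter> ?B = {}" "finite ?A" "finite ?B" using assms(1) by auto
  have "sum w ?B = (\<Sum>e\<in>?B. \<delta> - 1)" using assms(2) by (intro sum.cong) auto
  then have "sum w F = card ?A + card ?B * (\<delta> - 1)"
    using sum.union_disjoint[OF F(3,4,2), of w] F(1) by simp
  moreover have "card F = card ?A + card ?B" using card_Un_disjoint[OF F(3,4,2)] F(1) by simp
  moreover have "card ?A = 0 \<longrightarrow> (\<forall>e\<in>F. w e = \<delta> - 1)"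
    unfolding card_0_eq[OF F(3)] using assms(2) by blast
  moreover have "card ?B = 0 \<longrightarrow> (\<forall>e\<in>F. w e = 1)" using F(4) by auto
  ultimately show thesis by (intro that)
qed

lemma spade_weighting_cycle:
  assumes "2 < \<delta>"
  shows "spade_weighting \<delta> (cycle_multigraph \<delta>) (\<lambda>_. \<delta> - 1)"
proof -
  have C: "two_connected (cycle_multigraph \<delta>)" and deg: "degree (cycle_multigraph \<delta>) v \<le> 2" for v
    using two_connected_cycle assms degree_cycle_le by simp_all
  show ?thesis
    using no_good_flat_if_degree_le_2[OF C deg] not_deletable_if_degree_le_2[OF C deg]
    by (simp add: spade_weighting_def balanced_def weight_function_def)
qed

lemma balanced_cycle:
  assumes n: "3 \<le> n" and \<delta>: "2 < \<delta>" and w: "balanced \<delta> (cycle_multigraph n) w"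
  shows "n = \<delta>" "spade_weighting \<delta> (cycle_multigraph n) w"
proof -
  have "w e \<in> {1, \<delta> - 1}" if "e \<in> {..<n}" for e using w that by (simp add: balanced_def)
  then obtain k l where counts: "card {..<n} = k + l" "sum w {..<n} = k + l * (\<delta> - 1)"
    "k = 0 \<longrightarrow> (\<forall>e\<in>{..<n}. w e = \<delta> - 1)" "l = 0 \<longrightarrow> (\<forall>e\<in>{..<n}. w e = 1)"
    by (rule sum_weights[OF finite_lessThan])
  obtain d where delta_eq: "\<delta> = d + 3"
    using \<delta> by (metis add.commute le_Suc_ex Suc_leI numeral_3_eq_3 numeral_2_eq_2)
  obtain m where edges_eq: "k + l = m + 3"
    using n counts(1) by (metis card_lessThan le_add_diff_inverse2)
  have "k + l * (\<delta> - 1) = \<delta> * (n - 1)" using w counts(2) by (simp add: balanced_def)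
  then have "k + l * (d + 2) = (d + 3) * (m + 2)" using delta_eq edges_eq counts(1) by simp
  moreover have "(d + 2) * (k + l) = (d + 2) * (m + 3)" using edges_eq by simp
  ultimately have k_m_eq: "(d + 1) * k + m = d" by (simp add: algebra_simps)
  have "k = 0"
  proof (rule ccontr)
    assume "k \<noteq> 0"
    then have "d + 1 \<le> (d + 1) * k" using mult_le_mono2[of 1 k "d + 1"] by simp
    also have "\<dots> \<le> d" using le_add1[of "(d + 1) * k" m] by (simp only: k_m_eq)
    finally show False by simp
  qed
  then show "n = \<delta>" using k_m_eq edges_eq delta_eq counts(1) by simp
  have "\<forall>e\<in>edges (cycle_multigraph n). w e = \<delta> - 1" using counts(3) \<open>k = 0\<close> by simp
  then show "spade_weighting \<delta> (cycle_multigraph n) w"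
    using spade_weighting_cong[of "cycle_multigraph n" w "\<lambda>_. \<delta> - 1"]
      spade_weighting_cycle[OF \<delta>] \<open>n = \<delta>\<close> by simp
qed

lemma balanced_two_verts_iff:
  assumes "two_connected G" "card (verts G) = 2"
  shows "balanced \<delta> G w \<longleftrightarrow> (\<forall>e\<in>edges G. w e \<in> {1, \<delta> - 1}) \<and> sum w (edges G) = \<delta>"
proof -
  have "\<not> good_flat G S" for S
    using good_flat_psubset[of G S] good_flat_card[of G S] assms(2)
      psubset_card_mono[OF two_connected_finite(1)[OF assms(1)], of S] by auto
  then show ?thesis using assms(2) by (simp add: balanced_def)
qed

lemma weight_function_two_verts_iff:
  assumes G: "two_connected G" and two: "card (verts G) = 2"
  shows "weight_function \<delta> G w \<longleftrightarrow> (\<forall>e\<in>edges G. w e \<in> {1, \<delta> - 1}) \<and>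
    (3 \<le> card (edges G) \<longrightarrow> (\<forall>e\<in>edges G. w e = 1))"
proof -
  note multigraph_G = two_connected_multigraph[OF G]
  have "two_connected (delete_edges G {e}) \<longleftrightarrow> 3 \<le> card (edges G)" if "e \<in> edges G" for e
    using that two two_connected_finite(2)[OF G]
    by (auto simp: two_connected_iff_two_verts[OF multigraph_delete_edges[OF multigraph_G]])
  moreover have "\<not> two_connected (contract G {e})" if "e \<in> edges G" for e
    using multigraph_ends_two_verts[OF multigraph_G two that]
    by (auto simp: two_connected_contract_edge_iff[OF G that] dest: connected_on_nonempty)
  ultimately show ?thesis by (auto simp: weight_function_def)
qed

lemma balanced_two_verts:
  assumes G: "two_connected G" "card (verts G) = 2" and w: "balanced \<delta> G w" and \<delta>: "2 < \<delta>"
  shows "card (edges G) = 2 \<or> card (edges G) = \<delta>" "spade_weighting \<delta> G w"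
proof -
  have weights: "\<And>e. e \<in> edges G \<Longrightarrow> w e \<in> {1, \<delta> - 1}" "sum w (edges G) = \<delta>"
    using w balanced_two_verts_iff[OF G] by blast+
  obtain k l where counts: "card (edges G) = k + l" "sum w (edges G) = k + l * (\<delta> - 1)"
    "k = 0 \<longrightarrow> (\<forall>e\<in>edges G. w e = \<delta> - 1)" "l = 0 \<longrightarrow> (\<forall>e\<in>edges G. w e = 1)"
    by (rule sum_weights[OF two_connected_finite(2)[OF G(1)] weights(1)])
  have "l \<le> 1"
  proof (rule ccontr)
    assume "\<not> l \<le> 1"
    then have "2 * (\<delta> - 1) \<le> l * (\<delta> - 1)" by (intro mult_right_mono) auto
    then show False using counts(2) weights(2) \<delta> by linarith
  qed
  then have "l = 0 \<and> k = \<delta> \<or> l = 1 \<and> k = 1" using counts(2) weights(2) \<delta> by (cases l) auto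
  then show "card (edges G) = 2 \<or> card (edges G) = \<delta>" "spade_weighting \<delta> G w"
    using counts w weights(1)
    by (auto simp: spade_weighting_def weight_function_two_verts_iff[OF G])
qed

lemma ex_spade_weighting_digon:
  assumes G: "two_connected G" "card (verts G) = 2" "card (edges G) = 2" and \<delta>: "2 < \<delta>"
    and e: "e \<in> edges G" and k: "k \<in> {1, \<delta> - 1}"
  shows "\<exists>w. spade_weighting \<delta> G w \<and> w e = k"
proof -
  obtain f where f: "edges G = {e, f}" "f \<noteq> e"
    using G(3) e by (metis card_2_iff doubleton_eq_iff insert_iff singletonD)
  have "k \<le> \<delta>" "\<delta> - k \<in> {1, \<delta> - 1}" using k \<delta> by auto
  then have "spade_weighting \<delta> G (\<lambda>g. if g = e then k else \<delta> - k)"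
    using f k G(3)
    by (auto simp: spade_weighting_def weight_function_two_verts_iff[OF G(1,2)]
        balanced_two_verts_iff[OF G(1,2)])
  then show ?thesis by (intro exI[of _ "\<lambda>g. if g = e then k else \<delta> - k"]) simp
qed

lemma spade_weighting_bond:
  assumes "two_connected G" "card (verts G) = 2" "card (edges G) = \<delta>"
  shows "spade_weighting \<delta> G (\<lambda>_. 1)"
  using assms
  by (simp add: spade_weighting_def weight_function_two_verts_iff balanced_two_verts_iff)

section \<open>A balanced graph is a cycle or has a good flat attached at two vertices\<close>

lemma degree_two_vertex:
  assumes G: "two_connected G" and ge3: "3 \<le> card (verts G)" and p: "p \<in> verts G" "degree G p \<le> 2"
  obtains e f c d where "{g \<in> edges G. p \<in> ends G g} = {e, f}" "e \<noteq> f" "ends G e = {p, c}"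
    "ends G f = {p, d}" "two_terminal G (verts G - {p}) c d"
proof -
  note multigraph_G = two_connected_multigraph[OF G]
  have "degree G p = 2" using two_connected_degree[OF G p(1)] p(2) by simp
  then obtain e f where star: "{g \<in> edges G. p \<in> ends G g} = {e, f}" "e \<noteq> f"
    unfolding degree_def by (meson card_2_iff)
  then have e: "e \<in> edges G" "p \<in> ends G e" and f: "f \<in> edges G" "p \<in> ends G f" by auto
  obtain c where c: "ends G e = {p, c}" "c \<noteq> p" "c \<in> verts G"
    by (rule multigraph_other_end[OF multigraph_G e])
  obtain d where d: "ends G f = {p, d}" "d \<noteq> p" "d \<in> verts G"
    by (rule multigraph_other_end[OF multigraph_G f])
  have neighbour: "r = c \<or> r = d" if "adj G p r" for r
  proof -
    obtain g where "g \<in> edges G" "ends G g = {p, r}" using \<open>adj G p r\<close> by (auto simp: adj_def)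
    moreover from this have "g = e \<or> g = f" using star(1) by auto
    ultimately show ?thesis using c(1) d(1) by (auto simp: doubleton_eq_iff)
  qed
  have "c \<noteq> d"
  proof -
    obtain z where z: "z \<in> verts G" "z \<noteq> c" "z \<noteq> p" using third_element[OF ge3] .
    have "connected_on G (verts G - {c})" using G c(3) by (rule two_connected_connected_on)
    then obtain b where "b \<in> verts G - {c} - {p}" "adj G p b"
      by (rule connected_on_neighbour[of _ _ p]) (use p(1) c(2) z in auto)
    then show ?thesis using neighbour by blast
  qed
  then have "two_terminal G (verts G - {p}) c d"
    using p(1) c d two_connected_connected_on(2)[OF G p(1)] neighbour adj_commute[of G]
    by (auto simp: two_terminal_def)
  with star c(1) d(1) show thesis by (rule that)
qed

lemma block_or_cycle_if_degree_two:
  assumes G: "two_connected G" and "3 \<le> card (verts G)" and p: "p \<in> verts G" "degree G p \<le> 2"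
  shows "(\<exists>T a b. block G T a b) \<or> G \<simeq>\<^sub>m cycle_multigraph (card (verts G))"
proof -
  note multigraph_G = two_connected_multigraph[OF G]
  let ?S = "verts G - {p}"
  obtain e f c d where star: "{g \<in> edges G. p \<in> ends G g} = {e, f}" "e \<noteq> f" "ends G e = {p, c}"
    "ends G f = {p, d}" and terminals: "two_terminal G ?S c d"
    by (rule degree_two_vertex[OF assms])
  have "G \<simeq>\<^sub>m cycle_multigraph (card (verts G))"
    if vs: "induced_path G ?S vs es" "hd vs = c" "last vs = d" for vs es
  proof (rule hamiltonian_path_closed_iso)
    have path: "is_path G vs es" "set vs = ?S" "set es = edges_within G ?S"
      using vs(1) by (simp_all add: induced_path_def)
    have star_edges: "e \<in> edges G" "f \<in> edges G" "e \<notin> edges_within G ?S" "f \<notin> edges_within G ?S"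
      using star by (auto simp: edges_within_def)
    show "is_path G (p # vs) (e # es)"
      using path(1,2) vs(2) p(1) star_edges star(3) by (simp add: is_path_Cons_iff)
    show "set (p # vs) = verts G" using path(2) p(1) by auto
    have "g \<in> {e, f} \<or> g \<in> edges_within G ?S" if "g \<in> edges G" for g
      using that star(1) multigraph_ends(1)[OF multigraph_G that] by (auto simp: edges_within_def)
    then show "edges G = insert f (set (e # es))"
      using star_edges path(3) edges_within_subset[of G ?S] by auto
    show "f \<notin> set (e # es)" using star_edges(4) path(3) star(2) by simp
    show "ends G f = {last (p # vs), hd (p # vs)}"
      using star(4) vs(3) is_path_not_Nil[OF path(1)] by (simp add: insert_commute)
  qed simp
  then show ?thesis using block_or_induced_path[OF G terminals] by blast
qed

lemma block_or_cycle_if_two_terminal: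
  assumes G: "two_connected G" and ge3: "3 \<le> card (verts G)"
    and S: "two_terminal G S u v" "3 \<le> card S"
  shows "(\<exists>T a b. block G T a b) \<or> G \<simeq>\<^sub>m cycle_multigraph (card (verts G))"
  using block_or_induced_path[OF G S(1)]
proof
  assume "\<exists>vs es. induced_path G S vs es \<and> hd vs = u \<and> last vs = v"
  then obtain vs es where path: "is_path G vs es" "set es = edges_within G S"
    by (auto simp: induced_path_def)
  obtain p where p: "p \<in> S" "p \<noteq> u" "p \<noteq> v" using third_element[OF S(2)] .
  then have p_in_G: "p \<in> verts G" using S(1) by (auto simp: two_terminal_def)
  have "g \<in> set es" if g: "g \<in> edges G" "p \<in> ends G g" for g
  proof -
    obtain c where c: "ends G g = {p, c}" "c \<in> verts G"
      by (rule multigraph_other_end[OF two_connected_multigraph[OF G] g])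
    then have "c \<in> S" using S(1) p adjI[OF g(1) c(1)] by (auto simp: two_terminal_def)
    then show ?thesis using c(1) p(1) g(1) path(2) by (simp add: edges_within_def)
  qed
  then have "degree G p \<le> card {g \<in> set es. p \<in> ends G g}"
    unfolding degree_def by (intro card_mono) auto
  also have "\<dots> \<le> 2" by (rule is_path_edges_at_vertex_le[OF path(1)])
  finally show ?thesis by (rule block_or_cycle_if_degree_two[OF G ge3 p_in_G])
qed simp

lemma block_or_cycle_three_verts:
  assumes G: "two_connected G" and three: "card (verts G) = 3"
  shows "(\<exists>T a b. block G T a b) \<or> G \<simeq>\<^sub>m cycle_multigraph (card (verts G))"
proof (cases "\<exists>a\<in>verts G. \<exists>b\<in>verts G. a \<noteq> b \<and> 2 \<le> card (edges_within G {a, b})")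
  case True
  then show ?thesis using block_if_parallel_edges[OF G] three by (metis order_refl)
next
  case False
  note multigraph_G = two_connected_multigraph[OF G]
  obtain p c d where verts_G: "verts G = {p, c, d}" "p \<noteq> c" "p \<noteq> d"
    using three by (auto simp: card_3_iff)
  have "{g \<in> edges G. p \<in> ends G g} \<subseteq> edges_within G {p, c} \<union> edges_within G {p, d}"
  proof
    fix g assume "g \<in> {g \<in> edges G. p \<in> ends G g}"
    then have g: "g \<in> edges G" "p \<in> ends G g" by simp_all
    obtain q where "ends G g = {p, q}" "q \<noteq> p" "q \<in> verts G"
      by (rule multigraph_other_end[OF multigraph_G g])
    then show "g \<in> edges_within G {p, c} \<union> edges_within G {p, d}"
      using g(1) verts_G(1) by (auto simp: edges_within_def)
  qed
  then have "degree G p \<le> card (edges_within G {p, c} \<union> edges_within G {p, d})"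
    unfolding degree_def using multigraph_finite(3)[OF multigraph_G] by (intro card_mono) auto
  also have "\<dots> \<le> card (edges_within G {p, c}) + card (edges_within G {p, d})"
    by (rule card_Un_le)
  also have "\<dots> \<le> 1 + 1"
    using False verts_G by (intro add_mono) (auto simp: not_le less_Suc_eq_le numeral_2_eq_2)
  finally show ?thesis using block_or_cycle_if_degree_two[OF G _ _, of p] three verts_G(1) by simp
qed

lemma block_or_cycle_if_not_three_connected:
  assumes G: "two_connected G" and ge3: "3 \<le> card (verts G)" and x: "x \<in> verts G"
    and not_two_connected: "\<not> two_connected (induced G (verts G - {x}))"
  shows "(\<exists>T a b. block G T a b) \<or> G \<simeq>\<^sub>m cycle_multigraph (card (verts G))"
proof (cases "card (verts G) = 3")
  case True
  then show ?thesis by (rule block_or_cycle_three_verts[OF G])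
next
  case False
  then have "3 \<le> card (verts G - {x})" using ge3 x two_connected_finite(1)[OF G] by simp
  then obtain y where y: "y \<in> verts G" "y \<noteq> x" "\<not> connected_on G (verts G - {x} - {y})"
    using not_two_connected
    by (auto simp: two_connected_induced_iff[OF two_connected_multigraph[OF G]])
  have verts_minus_xy: "verts G - {x} - {y} = verts G - {x, y}" by auto
  obtain z where "z \<in> verts G" "z \<noteq> x" "z \<noteq> y" using third_element[OF ge3] .
  then obtain A B where separation: "disconnection G (verts G - {x, y}) A B"
    using y(3) unfolding verts_minus_xy by (blast elim: not_connected_onE)
  then have separation_commuted: "disconnection G (verts G - {y, x}) A B"
    by (simp add: insert_commute)
  have A: "A \<subseteq> verts G - {x, y}" "A \<noteq> {}" and B: "B \<subseteq> verts G - {x, y} - A" "B \<noteq> {}"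
    using separation by (auto simp: disconnection_def)
  have "connected_on G (insert x A \<union> insert y A)"
    using connected_on_insert_separated_part[OF G x y(1) y(2)[symmetric] separation]
      connected_on_insert_separated_part[OF G y(1) x y(2) separation_commuted]
    by (rule connected_on_Un) (use A in auto)
  moreover have "insert x A \<union> insert y A = insert x (insert y A)" by auto
  moreover have "p = x \<or> p = y"
    if "p \<in> insert x (insert y A)" "q \<in> verts G - insert x (insert y A)" "adj G p q" for p q
    using separation that by (auto simp: disconnection_def)
  moreover have "insert x (insert y A) \<subset> verts G" using A B x y(1) by blast
  ultimately have S: "two_terminal G (insert x (insert y A)) x y"
    using y(2) by (simp add: two_terminal_def)
  obtain a where "a \<in> A" using A(2) by blast
  then have "card {x, y, a} \<le> card (insert x (insert y A))"
    using two_terminal_finite[OF two_connected_multigraph[OF G] S] by (intro card_mono) auto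
  moreover have "a \<noteq> x" "a \<noteq> y" using A(1) \<open>a \<in> A\<close> by auto
  then have "card {x, y, a} = 3" using y(2) by simp
  ultimately have "3 \<le> card (insert x (insert y A))" by simp
  with S show ?thesis by (rule block_or_cycle_if_two_terminal[OF G ge3])
qed

lemma sum_stars:
  assumes "multigraph G"
  shows "(\<Sum>x\<in>verts G. sum w {e \<in> edges G. x \<in> ends G e}) = 2 * (sum w (edges G) :: nat)"
proof -
  have "(\<Sum>x\<in>verts G. sum w {e \<in> edges G. x \<in> ends G e}) =
      (\<Sum>e\<in>edges G. \<Sum>x\<in>{x \<in> verts G. x \<in> ends G e}. w e)"
    using multigraph_finite[OF assms] by (intro sum.swap_restrict)
  also have "\<dots> = (\<Sum>e\<in>edges G. 2 * w e)"
  proof (rule sum.cong[OF refl])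
    fix e assume e: "e \<in> edges G"
    have "{x \<in> verts G. x \<in> ends G e} = ends G e" using multigraph_ends(1)[OF assms e] by auto
    then show "(\<Sum>x\<in>{x \<in> verts G. x \<in> ends G e}. w e) = 2 * w e"
      using multigraph_ends(2)[OF assms e] by simp
  qed
  finally show ?thesis by (simp add: sum_distrib_left)
qed

lemma star_weight:
  assumes G: "multigraph G" and x: "x \<in> verts G" and ge3: "3 \<le> card (verts G)"
    and total: "sum w (edges G) = \<delta> * (card (verts G) - 1)" and tight: "tight \<delta> G w (verts G - {x})"
  shows "sum w {e \<in> edges G. x \<in> ends G e} = \<delta> + 1"
proof -
  have "edges G = edges_within G (verts G - {x}) \<union> {e \<in> edges G. x \<in> ends G e}"
    using multigraph_ends(1)[OF G] by (auto simp: edges_within_def)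
  moreover have "edges_within G (verts G - {x}) \<inter> {e \<in> edges G. x \<in> ends G e} = {}"
    by (auto simp: edges_within_def)
  ultimately have "sum w (edges G) =
      sum w (edges_within G (verts G - {x})) + sum w {e \<in> edges G. x \<in> ends G e}"
    using sum.union_disjoint[of "edges_within G (verts G - {x})" "{e \<in> edges G. x \<in> ends G e}" w]
      multigraph_finite[OF G] by simp
  moreover obtain m where "card (verts G) = m + 3" using ge3 by (metis le_add_diff_inverse2)
  ultimately show ?thesis
    using total tight x multigraph_finite(1)[OF G] by (simp add: tight_def)
qed

text \<open>If every \<open>G - x\<close> is two-connected, then all these sets are good flats and every star has
  weight \<open>\<delta> + 1\<close>, so that \<open>n * (\<delta> + 1) = 2 * \<delta> * (n - 1)\<close> for the number \<open>n\<close> of vertices.\<close>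

lemma all_vertex_deletions_two_connected:
  assumes G: "two_connected G" and w: "balanced \<delta> G w" and \<delta>: "2 < \<delta>" and ge3: "3 \<le> card (verts G)"
    and all: "\<And>x. x \<in> verts G \<Longrightarrow> two_connected (induced G (verts G - {x}))"
  shows "card (verts G) = 3"
proof -
  note multigraph_G = two_connected_multigraph[OF G]
  have total: "sum w (edges G) = \<delta> * (card (verts G) - 1)" using w by (simp add: balanced_def)
  have "sum w {e \<in> edges G. x \<in> ends G e} = \<delta> + 1" if x: "x \<in> verts G" for x
  proof (rule star_weight[OF multigraph_G x ge3 total])
    have "verts G - (verts G - {x}) = {x}" using x by auto
    then have "good_flat G (verts G - {x})" using all[OF x] x by (auto simp: good_flat_iff[OF G])
    then show "tight \<delta> G w (verts G - {x})" using w by (simp add: balanced_def)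
  qed
  then have "card (verts G) * (\<delta> + 1) = 2 * (\<delta> * (card (verts G) - 1))"
    using sum_stars[OF multigraph_G, of w] total by simp
  moreover obtain m where card_eq: "card (verts G) = m + 3"
    using ge3 by (metis le_add_diff_inverse2)
  ultimately have delta_m_eq: "\<delta> * (m + 1) = m + 3" by (simp add: algebra_simps)
  have "3 * (m + 1) \<le> \<delta> * (m + 1)" using \<delta> by (intro mult_right_mono) auto
  also have "\<dots> = m + 3" by (rule delta_m_eq)
  finally show ?thesis using card_eq by simp
qed

theorem good_flat_or_cycle:
  assumes G: "two_connected G" and w: "balanced \<delta> G w" and \<delta>: "2 < \<delta>" and ge3: "3 \<le> card (verts G)"
  shows "(\<exists>S u v. good_flat G S \<and> block G S u v) \<or> G \<simeq>\<^sub>m cycle_multigraph (card (verts G))"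
proof -
  have "(\<exists>T u v. block G T u v) \<or> G \<simeq>\<^sub>m cycle_multigraph (card (verts G))"
  proof (cases "\<forall>x\<in>verts G. two_connected (induced G (verts G - {x}))")
    case True
    then have "card (verts G) = 3" using all_vertex_deletions_two_connected[OF G w \<delta> ge3] by simp
    then show ?thesis by (rule block_or_cycle_three_verts[OF G])
  next
    case False
    then show ?thesis using block_or_cycle_if_not_three_connected[OF G ge3] by blast
  qed
  then show ?thesis using block_extends_to_good_flat[OF G] by blast
qed

section \<open>Balanced graphs are obtainable from cycles\<close>

lemma multigraph_iso_trans:
  assumes "G \<simeq>\<^sub>m H" "H \<simeq>\<^sub>m K"
  shows "G \<simeq>\<^sub>m K"
proof -
  obtain f g where iso_GH: "bij_betw f (verts G) (verts H)" "bij_betw g (edges G) (edges H)"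
    "\<forall>e\<in>edges G. ends H (g e) = f ` ends G e" using assms(1) by (auto simp: multigraph_iso_def)
  obtain f' g' where iso_HK: "bij_betw f' (verts H) (verts K)" "bij_betw g' (edges H) (edges K)"
    "\<forall>e\<in>edges H. ends K (g' e) = f' ` ends H e" using assms(2) by (auto simp: multigraph_iso_def)
  have "ends K ((g' \<circ> g) e) = (f' \<circ> f) ` ends G e" if "e \<in> edges G" for e
    using iso_GH(3) iso_HK(3) bij_betw_apply[OF iso_GH(2) that] that by (simp add: image_comp)
  then show ?thesis
    using bij_betw_trans[OF iso_GH(1) iso_HK(1)] bij_betw_trans[OF iso_GH(2) iso_HK(2)]
    unfolding multigraph_iso_def by blast
qed

lemma obtainable_if_iso: "obtainable_from_cycles \<delta> H \<Longrightarrow> G \<simeq>\<^sub>m H \<Longrightarrow> obtainable_from_cycles \<delta> G"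
  unfolding obtainable_from_cycles_def using multigraph_iso_trans by blast

lemma constructible_if_obtainable:
  assumes "obtainable_from_cycles \<delta> G"
  shows "constructible \<delta> G"
proof -
  obtain H where "constructible \<delta> H" "G \<simeq>\<^sub>m H" using assms by (auto simp: obtainable_from_cycles_def)
  then show ?thesis by cases (blast intro: constructible.intros multigraph_iso_trans)+
qed

lemma obtainable_if_copies_constructible:
  assumes "multigraph H" "\<And>K :: (nat, nat) pre_multigraph. K \<simeq>\<^sub>m H \<Longrightarrow> constructible \<delta> K"
  shows "obtainable_from_cycles \<delta> H"
proof -
  obtain f g and K :: "(nat, nat) pre_multigraph" where "graph_isomorphism f g H K"
    by (rule ex_nat_isomorphism[OF assms(1)])
  then have "H \<simeq>\<^sub>m K" using multigraph_iso_iff[OF assms(1)] by blast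
  then show ?thesis
    using assms(2) multigraph_iso_sym[OF assms(1)] unfolding obtainable_from_cycles_def by blast
qed

lemma constructible_cycle: "constructible \<delta> (cycle_multigraph \<delta>)"
  by (rule constructible.cycle) (auto simp: multigraph_iso_def intro!: exI[of _ id])

lemma obtainable_if_iso_cycle: "G \<simeq>\<^sub>m cycle_multigraph \<delta> \<Longrightarrow> obtainable_from_cycles \<delta> G"
  using constructible_cycle unfolding obtainable_from_cycles_def by blast

subsection \<open>Gluing\<close>

definition merge :: "'v \<Rightarrow> 'v \<Rightarrow> 'w \<Rightarrow> 'w \<Rightarrow> 'w \<Rightarrow> 'v + 'w" where
  "merge x\<^sub>1 y\<^sub>1 x\<^sub>2 y\<^sub>2 v = (if v = y\<^sub>2 then Inl y\<^sub>1 else if v = x\<^sub>2 then Inl x\<^sub>1 else Inr v)"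

lemma glue_sel [simp]:
  "verts (glue G x\<^sub>1 y\<^sub>1 H x\<^sub>2 y\<^sub>2) = Inl ` verts G \<union> merge x\<^sub>1 y\<^sub>1 x\<^sub>2 y\<^sub>2 ` verts H"
  "edges (glue G x\<^sub>1 y\<^sub>1 H x\<^sub>2 y\<^sub>2) = Inl ` edges G \<union> Inr ` edges H"
  "ends (glue G x\<^sub>1 y\<^sub>1 H x\<^sub>2 y\<^sub>2) (Inl e) = Inl ` ends G e"
  "ends (glue G x\<^sub>1 y\<^sub>1 H x\<^sub>2 y\<^sub>2) (Inr f) = merge x\<^sub>1 y\<^sub>1 x\<^sub>2 y\<^sub>2 ` ends H f"
  by (auto simp: glue_def identify_vertices_def disjoint_union_def merge_def image_Un image_image
      intro!: image_cong)

lemma add_parallel_edges_sel [simp]: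
  "verts (add_parallel_edges k x y G) = verts G"
  "edges (add_parallel_edges k x y G) = Inl ` edges G \<union> Inr ` {..<k}"
  "ends (add_parallel_edges k x y G) (Inl e) = ends G e"
  "ends (add_parallel_edges k x y G) (Inr n) = {x, y}"
  by (simp_all add: add_parallel_edges_def)

subsection \<open>Digons and bonds\<close>

lemma construction_C_cycle:
  assumes \<delta>: "2 < \<delta>"
  obtains H where "construction_C \<delta> (cycle_multigraph \<delta>) H" "multigraph H" "card (verts H) = 2"
    "card (edges H) = 2"
proof -
  let ?C = "cycle_multigraph \<delta>" and ?vs = "[0..<\<delta>]" and ?es = "[0..<\<delta> - 1]"
  let ?I = "set ?vs - {hd ?vs, last ?vs}"
  define H where "H = add_parallel_edges 1 (hd ?vs) (last ?vs)
    (delete_edges (induced ?C (verts ?C - ?I)) (set ?es))"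
  have C: "two_connected ?C" using two_connected_cycle \<delta> by simp
  have "is_path ?C ?vs ?es" using \<delta> by (auto simp: is_path_def)
  moreover have "\<forall>v\<in>?I. degree ?C v = 2"
    using two_connected_degree[OF C] degree_cycle_le[of \<delta>] by (auto intro!: antisym)
  ultimately have "construction_C \<delta> ?C H"
    unfolding construction_C_def Let_def H_def using C by (metis length_upt diff_zero)
  have endpoints: "hd ?vs = 0" "last ?vs = \<delta> - 1" using \<delta> by simp_all
  have "verts ?C - ?I = {0, \<delta> - 1}" using \<delta> endpoints by auto
  moreover have "edges_within ?C {0, \<delta> - 1} - set ?es = {\<delta> - 1}"
    using \<delta> by (auto simp: edges_within_def)
  ultimately have H: "verts H = {0, \<delta> - 1}" "edges H = {Inr 0, Inl (\<delta> - 1)}"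
    "ends H (Inl (\<delta> - 1)) = {\<delta> - 1, 0}" "ends H (Inr 0) = {0, \<delta> - 1}"
    using \<delta> endpoints by (simp_all add: H_def add_parallel_edges_def lessThan_Suc)
  moreover from this have "multigraph H" using \<delta> by (auto simp: multigraph_def)
  ultimately show thesis using that[OF \<open>construction_C \<delta> ?C H\<close>] \<delta> by simp
qed

lemma obtainable_digon:
  assumes \<delta>: "2 < \<delta>" and G: "multigraph G" "card (verts G) = 2" "card (edges G) = 2"
  shows "obtainable_from_cycles \<delta> G"
proof -
  obtain H where H: "construction_C \<delta> (cycle_multigraph \<delta>) H" "multigraph H" "card (verts H) = 2"
    "card (edges H) = 2" by (rule construction_C_cycle[OF \<delta>])
  have "obtainable_from_cycles \<delta> H"
    using H(2) constructible.C[OF constructible_cycle H(1)]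
    by (rule obtainable_if_copies_constructible)
  moreover have "G \<simeq>\<^sub>m H" using G H by (intro iso_if_two_verts) simp_all
  ultimately show ?thesis by (rule obtainable_if_iso)
qed

lemma obtainable_bond:
  assumes \<delta>: "2 < \<delta>" and G: "multigraph G" "card (verts G) = 2" "card (edges G) = \<delta>"
  shows "obtainable_from_cycles \<delta> G"
proof -
  define D :: "(nat, nat) pre_multigraph" where
    "D = \<lparr>verts = {0, 1}, edges = {0, 1}, ends = (\<lambda>_. {0, 1})\<rparr>"
  have D: "verts D = {0, 1}" "edges D = {0, 1}" "ends D e = {0, 1}" for e by (simp_all add: D_def)
  have multigraph_D: "multigraph D" by (simp add: multigraph_def D)
  have two_connected_D: "two_connected D" by (simp add: two_connected_iff[OF multigraph_D] D)
  have constructible_D: "constructible \<delta> D"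
    by (rule constructible_if_obtainable[OF obtainable_digon[OF \<delta> multigraph_D]]) (simp_all add: D)
  have "weight_function \<delta> D (\<lambda>_. \<delta> - 1)"
    by (simp add: weight_function_two_verts_iff[OF two_connected_D] D)
  then have weight: "has_weight \<delta> D 0 (\<delta> - 1)" unfolding has_weight_def by blast
  define H where "H = add_parallel_edges (\<delta> - 2) (Inl 0) (Inl 1)
    (delete_edges (glue D 0 1 D 0 1) {Inl 0, Inr 0})"
  have B: "construction_B \<delta> D D H"
    unfolding construction_B_def H_def using two_connected_D weight D by blast
  have "Inl ` {0 :: nat, 1} \<union> Inr ` {0 :: nat, 1} - {Inl 0, Inr 0} = {Inl 1, Inr 1}" by auto
  then have H: "verts H = {Inl 0, Inl 1}" "edges H = {Inl (Inl 1), Inl (Inr 1)} \<union> Inr ` {..<\<delta> - 2}"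
    by (auto simp: H_def D merge_def)
  have "ends H e = {Inl 0, Inl 1}" if "e \<in> edges H" for e
    using that unfolding H(2) by (auto simp: H_def D merge_def)
  then have multigraph_H: "multigraph H" by (auto simp: multigraph_def H)
  then have "obtainable_from_cycles \<delta> H"
    using constructible.B[OF constructible_D constructible_D B]
    by (rule obtainable_if_copies_constructible)
  moreover have "card (edges H) = \<delta>"
    unfolding H(2) using \<delta> by (subst card_Un_disjoint) (auto simp: card_image)
  then have "G \<simeq>\<^sub>m H" using G multigraph_H by (intro iso_if_two_verts) (simp_all add: H(1))
  ultimately show ?thesis by (rule obtainable_if_iso)
qed

subsection \<open>Two-separations and construction A\<close>

locale side_copies = two_separation G V\<^sub>1 V\<^sub>2 E\<^sub>1 E\<^sub>2 x y
  + left: graph_isomorphism f\<^sub>1 g\<^sub>1 "side G V\<^sub>1 E\<^sub>1 x y" K\<^sub>1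
  + right: graph_isomorphism f\<^sub>2 g\<^sub>2 "side G V\<^sub>2 E\<^sub>2 x y" K\<^sub>2
  for G :: "('v, 'e) pre_multigraph" and V\<^sub>1 V\<^sub>2 E\<^sub>1 E\<^sub>2 x y
    and f\<^sub>1 :: "'v \<Rightarrow> 'a" and g\<^sub>1 :: "'e option \<Rightarrow> 'b" and K\<^sub>1
    and f\<^sub>2 :: "'v \<Rightarrow> 'c" and g\<^sub>2 :: "'e option \<Rightarrow> 'd" and K\<^sub>2
begin

abbreviation glued :: "('a + 'c, 'b + 'd) pre_multigraph" where
  "glued \<equiv> delete_edges (glue K\<^sub>1 (f\<^sub>1 x) (f\<^sub>1 y) K\<^sub>2 (f\<^sub>2 x) (f\<^sub>2 y)) {Inl (g\<^sub>1 None), Inr (g\<^sub>2 None)}"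

definition map_vertex :: "'v \<Rightarrow> 'a + 'c" where
  "map_vertex v = (if v \<in> V\<^sub>1 then Inl (f\<^sub>1 v) else Inr (f\<^sub>2 v))"

definition map_edge :: "'e \<Rightarrow> 'b + 'd" where
  "map_edge e = (if e \<in> E\<^sub>1 then Inl (g\<^sub>1 (Some e)) else Inr (g\<^sub>2 (Some e)))"

lemma map_vertex_V1: "v \<in> V\<^sub>1 \<Longrightarrow> map_vertex v = Inl (f\<^sub>1 v)"
  by (simp add: map_vertex_def)

lemma map_vertex_V2:
  assumes "v \<in> V\<^sub>2"
  shows "map_vertex v = merge (f\<^sub>1 x) (f\<^sub>1 y) (f\<^sub>2 x) (f\<^sub>2 y) (f\<^sub>2 v)"
proof -
  have inj: "f\<^sub>2 u = f\<^sub>2 v \<longleftrightarrow> u = v" if "u \<in> V\<^sub>2" for u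
    using inj_on_eq_iff[OF right.inj_verts] that assms by simp
  show ?thesis
  proof (cases "v = x \<or> v = y")
    case True
    then show ?thesis
      using xy xy_in_V1 inj[OF swap.xy_in_V1(1)] inj[OF swap.xy_in_V1(2)]
      by (auto simp: map_vertex_def merge_def)
  next
    case False
    then have "v \<notin> V\<^sub>1" using in_both assms by blast
    then show ?thesis
      using False inj[OF swap.xy_in_V1(1)] inj[OF swap.xy_in_V1(2)]
      by (auto simp: map_vertex_def merge_def)
  qed
qed

lemma bij_map_vertex: "bij_betw map_vertex (verts G) (verts glued)"
proof -
  have "inj_on map_vertex (verts G)"
    using left.inj_verts right.inj_verts by (auto simp: map_vertex_def inj_on_def verts)
  moreover have "map_vertex ` V\<^sub>1 = Inl ` f\<^sub>1 ` V\<^sub>1"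
    by (simp add: image_image map_vertex_V1)
  moreover have "map_vertex ` V\<^sub>2 = merge (f\<^sub>1 x) (f\<^sub>1 y) (f\<^sub>2 x) (f\<^sub>2 y) ` f\<^sub>2 ` V\<^sub>2"
    by (simp add: image_image map_vertex_V2)
  ultimately show ?thesis
    by (simp add: bij_betw_def verts image_Un left.verts_eq right.verts_eq)
qed

lemma bij_map_edge: "bij_betw map_edge (edges G) (edges glued)"
proof -
  have inj: "inj_on map_edge (edges G)"
    using left.inj_edges right.inj_edges by (auto simp: map_edge_def inj_on_def edges)
  have "map_edge ` E\<^sub>1 = Inl ` g\<^sub>1 ` Some ` E\<^sub>1"
    by (simp add: image_image map_edge_def)
  moreover have "map_edge ` E\<^sub>2 = Inr ` g\<^sub>2 ` Some ` E\<^sub>2"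
    unfolding image_image using edges_Int by (intro image_cong) (auto simp: map_edge_def)
  moreover have "g\<^sub>1 None \<notin> g\<^sub>1 ` Some ` E\<^sub>1" "g\<^sub>2 None \<notin> g\<^sub>2 ` Some ` E\<^sub>2"
    using left.inj_edges right.inj_edges by (auto dest!: inj_onD)
  then have "edges glued = Inl ` g\<^sub>1 ` Some ` E\<^sub>1 \<union> Inr ` g\<^sub>2 ` Some ` E\<^sub>2"
    by (auto simp: left.edges_eq right.edges_eq)
  ultimately have "map_edge ` edges G = edges glued" unfolding edges by (simp only: image_Un)
  with inj show ?thesis by (simp only: bij_betw_def)
qed

lemma ends_map_edge:
  assumes "e \<in> edges G"
  shows "ends glued (map_edge e) = map_vertex ` ends G e"
proof (cases "e \<in> E\<^sub>1")
  case True
  have "map_vertex ` ends G e = Inl ` f\<^sub>1 ` ends G e"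
    unfolding image_image using ends_subset(1)[OF True] map_vertex_V1 by (intro image_cong) auto
  then show ?thesis using True left.ends_map[of "Some e"] by (simp add: map_edge_def)
next
  case False
  then have e: "e \<in> E\<^sub>2" using assms edges by simp
  have "map_vertex ` ends G e = merge (f\<^sub>1 x) (f\<^sub>1 y) (f\<^sub>2 x) (f\<^sub>2 y) ` f\<^sub>2 ` ends G e"
    unfolding image_image using ends_subset(2)[OF e] map_vertex_V2 by (intro image_cong) auto
  then show ?thesis using False e right.ends_map[of "Some e"] by (simp add: map_edge_def)
qed

lemma iso_glued: "G \<simeq>\<^sub>m glued"
  unfolding multigraph_iso_def using bij_map_vertex bij_map_edge ends_map_edge by blast

lemma construction_A_glued:
  assumes "two_connected K\<^sub>1" "two_connected K\<^sub>2"
    and "has_weight \<delta> K\<^sub>1 (g\<^sub>1 None) 1" "has_weight \<delta> K\<^sub>2 (g\<^sub>2 None) (\<delta> - 1)"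
  shows "construction_A \<delta> K\<^sub>1 K\<^sub>2 glued"
proof -
  have "g\<^sub>1 None \<in> edges K\<^sub>1" "ends K\<^sub>1 (g\<^sub>1 None) = {f\<^sub>1 x, f\<^sub>1 y}"
    "g\<^sub>2 None \<in> edges K\<^sub>2" "ends K\<^sub>2 (g\<^sub>2 None) = {f\<^sub>2 x, f\<^sub>2 y}"
    using left.ends_map[of None] right.ends_map[of None]
    by (simp_all add: left.edges_eq right.edges_eq)
  then show ?thesis unfolding construction_A_def using assms by blast
qed

end

lemma ex_constructible_copy:
  assumes G: "two_connected G" "obtainable_from_cycles \<delta> G" and w: "spade_weighting \<delta> G w"
  obtains f g K where "graph_isomorphism f g G K" "constructible \<delta> K" "two_connected K"
    "\<And>e. e \<in> edges G \<Longrightarrow> has_weight \<delta> K (g e) (w e)"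
proof -
  obtain K f g where K: "constructible \<delta> K" "graph_isomorphism f g G K"
    using G(2) multigraph_iso_iff[OF two_connected_multigraph[OF G(1)]]
    unfolding obtainable_from_cycles_def by blast
  interpret graph_isomorphism f g G K by (rule K(2))
  obtain w' where "spade_weighting \<delta> K w'" "\<forall>e\<in>edges G. w' (g e) = w e"
    by (rule spade_weighting_transport[OF G(1) w])
  then have "has_weight \<delta> K (g e) (w e)" if "e \<in> edges G" for e
    using that by (auto simp: has_weight_def spade_weighting_def)
  then show thesis using that K G(1) two_connected_map_iff by blast
qed

lemma (in two_separation) obtainable_if_sides:
  assumes G: "two_connected G"
    and left: "spade_weighting \<delta> left_side (case_option 1 w)" "obtainable_from_cycles \<delta> left_side"
    and right: "spade_weighting \<delta> right_side (case_option (\<delta> - 1) w)"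
      "obtainable_from_cycles \<delta> right_side"
  shows "obtainable_from_cycles \<delta> G"
proof -
  obtain f\<^sub>1 g\<^sub>1 K\<^sub>1 where K1: "graph_isomorphism f\<^sub>1 g\<^sub>1 left_side K\<^sub>1" "constructible \<delta> K\<^sub>1"
    "two_connected K\<^sub>1" "\<And>e. e \<in> edges left_side \<Longrightarrow> has_weight \<delta> K\<^sub>1 (g\<^sub>1 e) (case_option 1 w e)"
    using ex_constructible_copy[OF two_connected_left[OF G] left(2,1)] by blast
  obtain f\<^sub>2 g\<^sub>2 K\<^sub>2 where K2: "graph_isomorphism f\<^sub>2 g\<^sub>2 right_side K\<^sub>2" "constructible \<delta> K\<^sub>2"
    "two_connected K\<^sub>2"
    "\<And>e. e \<in> edges right_side \<Longrightarrow> has_weight \<delta> K\<^sub>2 (g\<^sub>2 e) (case_option (\<delta> - 1) w e)"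
    using ex_constructible_copy[OF swap.two_connected_left[OF G] right(2,1)] by blast
  interpret copies: side_copies G V\<^sub>1 V\<^sub>2 E\<^sub>1 E\<^sub>2 x y f\<^sub>1 g\<^sub>1 K\<^sub>1 f\<^sub>2 g\<^sub>2 K\<^sub>2
    by (intro side_copies.intro two_separation_axioms K1(1) K2(1))
  have "construction_A \<delta> K\<^sub>1 K\<^sub>2 copies.glued"
    using K1(3) K2(3) K1(4)[of None] K2(4)[of None] by (intro copies.construction_A_glued) simp_all
  then have "constructible \<delta> K" if "K \<simeq>\<^sub>m G" for K
    using constructible.A[OF K1(2) K2(2)] multigraph_iso_trans[OF that copies.iso_glued] by blast
  then show ?thesis by (rule obtainable_if_copies_constructible[OF multigraph])
qed

lemma (in two_separation) spade_weighting_obtainable_if_sides: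
  assumes G: "two_connected G" and \<delta>: "2 < \<delta>"
    and sides: "spade_weighting \<delta> left_side (case_option 1 w) \<and> obtainable_from_cycles \<delta> left_side"
      "spade_weighting \<delta> right_side (case_option (\<delta> - 1) w) \<and>
      obtainable_from_cycles \<delta> right_side"
  shows "spade_weighting \<delta> G w \<and> obtainable_from_cycles \<delta> G"
proof -
  interpret weighted_two_separation G V\<^sub>1 V\<^sub>2 E\<^sub>1 E\<^sub>2 x y \<delta> w 1 "\<delta> - 1"
    by unfold_locales (use G sides \<delta> in auto)
  show ?thesis using spade_weighting_glued obtainable_if_sides[OF G] sides by blast
qed

subsection \<open>Induction on the number of edges\<close>

lemma good_flat_two_separation:
  assumes G: "two_connected G" and S: "good_flat G S" and block: "block G S u v"
  shows "two_separation G S (verts G - S \<union> {u, v})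
      (edges_within G S) (edges G - edges_within G S) u v"
    and "2 \<le> card (edges G - edges_within G S)"
proof -
  note multigraph_G = two_connected_multigraph[OF G]
  have terminals: "S \<subset> verts G" "u \<in> S" "v \<in> S" "u \<noteq> v"
    "\<And>p q. p \<in> S \<Longrightarrow> q \<in> verts G - S \<Longrightarrow> adj G p q \<Longrightarrow> p = u \<or> p = v"
    using block by (auto simp: block_def two_terminal_def)
  obtain r where r: "r \<in> verts G" "r \<notin> S" using terminals by auto
  have "degree G r \<le> card (edges G - edges_within G S)"
    unfolding degree_def using r two_connected_finite(2)[OF G]
    by (intro card_mono) (auto simp: edges_within_def)
  then show two: "2 \<le> card (edges G - edges_within G S)"
    using two_connected_degree[OF G r(1)] by simp
  have outer: "ends G e \<subseteq> verts G - S \<union> {u, v}" if e: "e \<in> edges G - edges_within G S" for e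
  proof
    fix p assume p: "p \<in> ends G e"
    have e_in_G: "e \<in> edges G" using e by simp
    obtain q where q: "ends G e = {p, q}" "q \<in> verts G"
      by (rule multigraph_other_end[OF multigraph_G e_in_G p])
    then have "p \<notin> S \<or> q \<notin> S" using e by (auto simp: edges_within_def)
    then show "p \<in> verts G - S \<union> {u, v}"
      using terminals(5)[OF _ _ adjI[OF e_in_G q(1)]] q(2)
        multigraph_ends(1)[OF multigraph_G e_in_G] p by blast
  qed
  show "two_separation G S (verts G - S \<union> {u, v})
      (edges_within G S) (edges G - edges_within G S) u v"
  proof
    show "edges_within G S \<noteq> {}"
      using two_connected_card_edges[OF good_flat_two_connected[OF S]] by (intro notI) simp
    show "edges G - edges_within G S \<noteq> {}" using two by (intro notI) simp
  qed (use multigraph_G terminals outer in \<open>auto simp: edges_within_def\<close>)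
qed

lemma balanced_separation:
  assumes G: "two_connected G" and w: "balanced \<delta> G w" and \<delta>: "2 < \<delta>"
    and S: "good_flat G S" "block G S u v"
  obtains V\<^sub>1 V\<^sub>2 E\<^sub>1 E\<^sub>2 where "two_separation G V\<^sub>1 V\<^sub>2 E\<^sub>1 E\<^sub>2 u v" "2 \<le> card E\<^sub>1" "2 \<le> card E\<^sub>2"
    "balanced \<delta> (side G V\<^sub>1 E\<^sub>1 u v) (case_option 1 w)"
    "balanced \<delta> (side G V\<^sub>2 E\<^sub>2 u v) (case_option (\<delta> - 1) w)"
proof -
  let ?V2 = "verts G - S \<union> {u, v}" and ?E1 = "edges_within G S"
  interpret two_separation G S ?V2 ?E1 "edges G - ?E1" u v
    by (rule good_flat_two_separation[OF G S])
  have "2 \<le> card ?E1" using two_connected_card_edges[OF good_flat_two_connected[OF S(1)]] by simp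
  have weight_inside: "1 + sum w ?E1 = \<delta> * (card S - 1)"
    using w S(1) by (simp add: balanced_def tight_def)
  then have "sum w (edges G - ?E1) = \<delta> * (card ?V2 - 2) + 1"
    using w total_weight_iff[OF weight_inside] by (simp add: balanced_def)
  moreover obtain q where "card ?V2 = q + 2" using swap.card_V1_ge2 by (metis le_add_diff_inverse2)
  ultimately have weight_outside: "\<delta> - 1 + sum w (edges G - ?E1) = \<delta> * (card ?V2 - 1)"
    using \<delta> by (simp add: algebra_simps)
  show thesis
  proof (rule that)
    show "two_separation G S ?V2 ?E1 (edges G - ?E1) u v" by (rule two_separation_axioms)
    show "2 \<le> card ?E1" by fact
    show "2 \<le> card (edges G - ?E1)" by (rule good_flat_two_separation(2)[OF G S])
    show "balanced \<delta> left_side (case_option 1 w)"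
      by (rule balanced_left[OF G w _ weight_inside]) simp
    show "balanced \<delta> right_side (case_option (\<delta> - 1) w)"
      by (rule swap.balanced_left[OF G w _ weight_outside]) simp
  qed
qed

lemma balanced_via_nat_copy:
  assumes G: "two_connected G" and w: "balanced \<delta> G w"
    and copies: "\<And>(K :: (nat, nat) pre_multigraph) u.
      two_connected K \<Longrightarrow> card (edges K) = card (edges G) \<Longrightarrow> balanced \<delta> K u \<Longrightarrow>
      spade_weighting \<delta> K u \<and> obtainable_from_cycles \<delta> K"
  shows "spade_weighting \<delta> G w \<and> obtainable_from_cycles \<delta> G"
proof -
  note multigraph_G = two_connected_multigraph[OF G]
  obtain f g and K :: "(nat, nat) pre_multigraph" where "graph_isomorphism f g G K"
    by (rule ex_nat_isomorphism[OF multigraph_G])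
  then interpret graph_isomorphism f g G K .
  interpret inv: graph_isomorphism "the_inv_into (verts G) f" "the_inv_into (edges G) g" K G
    by (rule inverse)
  have K: "two_connected K" using G by (simp add: two_connected_map_iff)
  have "spade_weighting \<delta> K (w \<circ> the_inv_into (edges G) g) \<and> obtainable_from_cycles \<delta> K"
    using w by (intro copies K) (simp_all add: card_eq inv.balanced_map_iff[OF K])
  moreover have "G \<simeq>\<^sub>m K" using graph_isomorphism_axioms multigraph_iso_iff[OF multigraph_G] by blast
  ultimately show ?thesis
    using inv.spade_weighting_map_iff[OF K] obtainable_if_iso by blast
qed

lemma balanced_cycle_copy:
  assumes G: "two_connected G" and w: "balanced \<delta> G w" and \<delta>: "2 < \<delta>"
    and ge3: "3 \<le> card (verts G)" and cycle: "G \<simeq>\<^sub>m cycle_multigraph (card (verts G))"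
  shows "spade_weighting \<delta> G w \<and> obtainable_from_cycles \<delta> G"
proof -
  let ?C = "cycle_multigraph (card (verts G))"
  have C: "multigraph ?C" "two_connected ?C"
    using multigraph_cycle two_connected_cycle ge3 by simp_all
  obtain f g where "graph_isomorphism f g ?C G"
    using multigraph_iso_sym[OF two_connected_multigraph[OF G] cycle] multigraph_iso_iff[OF C(1)]
    by blast
  then interpret graph_isomorphism f g ?C G .
  have "balanced \<delta> ?C (w \<circ> g)" using w by (simp add: balanced_map_iff[OF C(2)])
  from balanced_cycle[OF ge3 \<delta> this] show ?thesis
    using cycle obtainable_if_iso_cycle spade_weighting_map_iff[OF C(2)] by simp
qed

lemma balanced_nat_spade_weighting_obtainable:
  fixes G :: "(nat, nat) pre_multigraph"
  assumes "two_connected G" "balanced \<delta> G w" and \<delta>: "2 < \<delta>"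
  shows "spade_weighting \<delta> G w \<and> obtainable_from_cycles \<delta> G"
  using assms(1,2)
proof (induction "card (edges G)" arbitrary: G w rule: less_induct)
  case less
  note G = less.prems(1) and w = less.prems(2)
  show ?case
  proof (cases "card (verts G) = 2")
    case True
    then show ?thesis
      using balanced_two_verts[OF G True w \<delta>] two_connected_multigraph[OF G]
        obtainable_digon[OF \<delta> _ True] obtainable_bond[OF \<delta> _ True] by blast
  next
    case False
    then have ge3: "3 \<le> card (verts G)" using two_connected_card_verts[OF G] by linarith
    consider (flat) S u v where "good_flat G S" "block G S u v"
      | (cycle) "G \<simeq>\<^sub>m cycle_multigraph (card (verts G))"
      using good_flat_or_cycle[OF G w \<delta> ge3] by blast
    then show ?thesis
    proof cases
      case (flat S u v)
      obtain V\<^sub>1 V\<^sub>2 E\<^sub>1 E\<^sub>2 where sep: "two_separation G V\<^sub>1 V\<^sub>2 E\<^sub>1 E\<^sub>2 u v" "2 \<le> card E\<^sub>1" "2 \<le> card E\<^sub>2"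
        and left: "balanced \<delta> (side G V\<^sub>1 E\<^sub>1 u v) (case_option 1 w)"
        and right: "balanced \<delta> (side G V\<^sub>2 E\<^sub>2 u v) (case_option (\<delta> - 1) w)"
        by (rule balanced_separation[OF G w \<delta> flat])
      interpret two_separation G V\<^sub>1 V\<^sub>2 E\<^sub>1 E\<^sub>2 u v by (rule sep(1))
      have "card (edges left_side) < card (edges G)" "card (edges right_side) < card (edges G)"
        using sep(2,3) card_edges card_edges_left swap.card_edges_left by simp_all
      then show ?thesis
        using less.hyps balanced_via_nat_copy[OF two_connected_left[OF G] left]
          balanced_via_nat_copy[OF swap.two_connected_left[OF G] right]
        by (intro spade_weighting_obtainable_if_sides[OF G \<delta>]) simp_all
    next
      case cycle
      then show ?thesis by (rule balanced_cycle_copy[OF G w \<delta> ge3])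
    qed
  qed
qed

theorem balanced_spade_weighting_obtainable:
  assumes "two_connected G" "balanced \<delta> G w" "2 < \<delta>"
  shows "spade_weighting \<delta> G w" "obtainable_from_cycles \<delta> G"
  using balanced_via_nat_copy[OF assms(1,2)]
    balanced_nat_spade_weighting_obtainable[OF _ _ assms(3)]
  by blast+

section \<open>Constructions A and B preserve the spade property\<close>

lemma two_edges_two_verts:
  assumes G: "two_connected G" and "card (edges G) = 2"
  shows "card (verts G) = 2"
proof -
  note multigraph_G = two_connected_multigraph[OF G]
  obtain e where e: "e \<in> edges G" using assms(2) by fastforce
  have "v \<in> ends G e" if "v \<in> verts G" for v
  proof -
    have "card (edges G) \<le> card {e \<in> edges G. v \<in> ends G e}"
      using two_connected_degree[OF G that] assms(2) by (simp add: degree_def)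
    then have "{e \<in> edges G. v \<in> ends G e} = edges G"
      using multigraph_finite(2)[OF multigraph_G] by (intro card_seteq) auto
    then show ?thesis using e by blast
  qed
  then have "verts G = ends G e" using multigraph_ends(1)[OF multigraph_G e] by blast
  then show ?thesis using multigraph_ends(2)[OF multigraph_G e] by simp
qed

text \<open>The weight of an edge is determined by the graph except in a digon, where both choices extend
  to a spade weighting.\<close>

lemma ex_spade_weighting_with_weight:
  assumes \<delta>: "2 < \<delta>" and G: "two_connected G" "spade \<delta> G" and e: "e \<in> edges G"
    and k: "has_weight \<delta> G e k"
  shows "\<exists>w. spade_weighting \<delta> G w \<and> w e = k"
proof -
  obtain w' where w': "weight_function \<delta> G w'" "w' e = k" using k by (auto simp: has_weight_def)
  show ?thesis
  proof (cases "card (edges G) = 2")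
    case True
    have "k \<in> {1, \<delta> - 1}" using w' e by (auto simp: weight_function_def)
    then show ?thesis
      using ex_spade_weighting_digon[OF G(1) two_edges_two_verts[OF G(1) True] True \<delta> e] by simp
  next
    case False
    then have "3 \<le> card (edges G)" using two_connected_card_edges[OF G(1)] by linarith
    moreover obtain w where "spade_weighting \<delta> G w"
      using G(2) by (auto simp: spade_iff_ex_weighting)
    ultimately show ?thesis
      using weight_function_unique[OF G(1) e] w' by (auto simp: spade_weighting_def)
  qed
qed

lemma isomorphism_onto_side:
  assumes G: "multigraph G" and e: "e \<in> edges G" "ends G e = {x, y}"
    and f: "inj_on f (verts G)" and g: "inj_on g (edges G - {e})"
    and ends: "\<And>e'. e' \<in> edges G - {e} \<Longrightarrow> ends H (g e') = f ` ends G e'"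
  shows "graph_isomorphism f (\<lambda>e'. if e' = e then None else Some (g e')) G
    (side H (f ` verts G) (g ` (edges G - {e})) (f x) (f y))" (is "graph_isomorphism f ?g G ?H")
proof
  have "inj_on ?g (edges G)" using g by (auto simp: inj_on_def)
  moreover have "?g ` edges G = edges ?H" using e(1) by (auto simp: image_iff)
  ultimately show "bij_betw ?g (edges G) (edges ?H)" by (simp add: bij_betw_def)
  show "ends ?H (?g e') = f ` ends G e'" if "e' \<in> edges G" for e'
    using that e(2) ends[of e'] by auto
qed (use G f in \<open>simp_all add: bij_betw_def\<close>)

lemma ends_distinct: "multigraph G \<Longrightarrow> e \<in> edges G \<Longrightarrow> ends G e = {x, y} \<Longrightarrow> x \<noteq> y"
  using multigraph_ends(2) by fastforce

lemma two_connected_other_edge: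
  assumes "two_connected G"
  shows "edges G - {e} \<noteq> {}"
  using two_connected_card_edges[OF assms] card_mono[of "{e}" "edges G"] by auto

locale glued_pair =
  fixes G\<^sub>1 :: "('v, 'e) pre_multigraph" and G\<^sub>2 :: "('w, 'f) pre_multigraph"
    and e\<^sub>1 e\<^sub>2 x\<^sub>1 y\<^sub>1 x\<^sub>2 y\<^sub>2
  assumes two_connected: "two_connected G\<^sub>1" "two_connected G\<^sub>2"
    and edge\<^sub>1: "e\<^sub>1 \<in> edges G\<^sub>1" "ends G\<^sub>1 e\<^sub>1 = {x\<^sub>1, y\<^sub>1}"
    and edge\<^sub>2: "e\<^sub>2 \<in> edges G\<^sub>2" "ends G\<^sub>2 e\<^sub>2 = {x\<^sub>2, y\<^sub>2}"
begin

abbreviation "incl \<equiv> merge x\<^sub>1 y\<^sub>1 x\<^sub>2 y\<^sub>2"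
abbreviation "glued \<equiv> delete_edges (glue G\<^sub>1 x\<^sub>1 y\<^sub>1 G\<^sub>2 x\<^sub>2 y\<^sub>2) {Inl e\<^sub>1, Inr e\<^sub>2}"

lemma multigraphs: "multigraph G\<^sub>1" "multigraph G\<^sub>2"
  using two_connected two_connected_multigraph by blast+

lemma distinct_ends: "x\<^sub>1 \<noteq> y\<^sub>1" "x\<^sub>2 \<noteq> y\<^sub>2"
  using ends_distinct[OF multigraphs(1) edge\<^sub>1] ends_distinct[OF multigraphs(2) edge\<^sub>2] .

lemma ends_in_verts: "x\<^sub>1 \<in> verts G\<^sub>1" "y\<^sub>1 \<in> verts G\<^sub>1" "x\<^sub>2 \<in> verts G\<^sub>2" "y\<^sub>2 \<in> verts G\<^sub>2"
  using multigraph_ends(1)[OF multigraphs(1) edge\<^sub>1(1)]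
    multigraph_ends(1)[OF multigraphs(2) edge\<^sub>2(1)]
  by (simp_all add: edge\<^sub>1(2) edge\<^sub>2(2))

lemma incl_ends [simp]: "incl x\<^sub>2 = Inl x\<^sub>1" "incl y\<^sub>2 = Inl y\<^sub>1"
  using distinct_ends by (simp_all add: merge_def)

lemma inj_incl: "inj_on incl A"
  using distinct_ends by (auto simp: inj_on_def merge_def split: if_splits)

lemma glued_sel [simp]:
  "verts glued = Inl ` verts G\<^sub>1 \<union> incl ` verts G\<^sub>2"
  "edges glued = Inl ` (edges G\<^sub>1 - {e\<^sub>1}) \<union> Inr ` (edges G\<^sub>2 - {e\<^sub>2})"
  by auto

lemma ends_glued_left:
  assumes "e \<in> Inl ` (edges G\<^sub>1 - {e\<^sub>1})"
  shows "ends glued e \<subseteq> Inl ` verts G\<^sub>1" "card (ends glued e) = 2"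
proof -
  obtain f where f: "e = Inl f" "f \<in> edges G\<^sub>1" using assms by auto
  show "ends glued e \<subseteq> Inl ` verts G\<^sub>1" "card (ends glued e) = 2"
    using multigraph_ends[OF multigraphs(1) f(2)] by (simp_all add: f(1) image_mono card_image)
qed

lemma ends_glued_right:
  assumes "e \<in> Inr ` (edges G\<^sub>2 - {e\<^sub>2})"
  shows "ends glued e \<subseteq> incl ` verts G\<^sub>2" "card (ends glued e) = 2"
proof -
  obtain f where f: "e = Inr f" "f \<in> edges G\<^sub>2" using assms by auto
  show "ends glued e \<subseteq> incl ` verts G\<^sub>2" "card (ends glued e) = 2"
    using multigraph_ends[OF multigraphs(2) f(2)]
    by (simp_all add: f(1) image_mono card_image inj_incl)
qed

lemma multigraph_glued: "multigraph glued"
proof -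
  have "ends glued e \<subseteq> verts glued \<and> card (ends glued e) = 2" if "e \<in> edges glued" for e
    using that ends_glued_left[of e] ends_glued_right[of e] unfolding glued_sel by blast
  moreover have "finite (verts glued)" "finite (edges glued)"
    using multigraph_finite[OF multigraphs(1)] multigraph_finite[OF multigraphs(2)] by simp_all
  ultimately show ?thesis by (simp add: multigraph_def)
qed

sublocale two_separation glued "Inl ` verts G\<^sub>1" "incl ` verts G\<^sub>2"
  "Inl ` (edges G\<^sub>1 - {e\<^sub>1})" "Inr ` (edges G\<^sub>2 - {e\<^sub>2})" "Inl x\<^sub>1" "Inl y\<^sub>1"
proof (rule two_separation.intro)
  show "Inl ` verts G\<^sub>1 \<inter> incl ` verts G\<^sub>2 = {Inl x\<^sub>1, Inl y\<^sub>1}"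
    using ends_in_verts incl_ends[symmetric] by (auto simp: merge_def split: if_splits)
  show "Inl ` (edges G\<^sub>1 - {e\<^sub>1}) \<noteq> {}" "Inr ` (edges G\<^sub>2 - {e\<^sub>2}) \<noteq> {}"
    using two_connected_other_edge two_connected by (metis image_is_empty)+
qed (use multigraph_glued distinct_ends ends_glued_left(1) ends_glued_right(1) in auto)

theorem spade_glued:
  assumes w\<^sub>1: "spade_weighting \<delta> G\<^sub>1 w\<^sub>1" and w\<^sub>2: "spade_weighting \<delta> G\<^sub>2 w\<^sub>2"
    and sum: "w\<^sub>1 e\<^sub>1 + w\<^sub>2 e\<^sub>2 = \<delta>"
  shows "two_connected glued" "spade \<delta> glued"
proof -
  interpret left: graph_isomorphism Inl "\<lambda>e. if e = e\<^sub>1 then None else Some (Inl e)" G\<^sub>1 left_side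
    by (rule isomorphism_onto_side[OF multigraphs(1) edge\<^sub>1]) auto
  have "graph_isomorphism incl (\<lambda>e. if e = e\<^sub>2 then None else Some (Inr e)) G\<^sub>2
      (side glued (incl ` verts G\<^sub>2) (Inr ` (edges G\<^sub>2 - {e\<^sub>2})) (incl x\<^sub>2) (incl y\<^sub>2))"
    by (rule isomorphism_onto_side[OF multigraphs(2) edge\<^sub>2 inj_incl]) auto
  then interpret right:
    graph_isomorphism incl "\<lambda>e. if e = e\<^sub>2 then None else Some (Inr e)" G\<^sub>2 right_side
    by simp
  obtain v\<^sub>1 where v\<^sub>1: "spade_weighting \<delta> left_side v\<^sub>1"
    "\<forall>e\<in>edges G\<^sub>1. v\<^sub>1 (if e = e\<^sub>1 then None else Some (Inl e)) = w\<^sub>1 e"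
    by (rule left.spade_weighting_transport[OF two_connected(1) w\<^sub>1])
  obtain v\<^sub>2 where v\<^sub>2: "spade_weighting \<delta> right_side v\<^sub>2"
    "\<forall>e\<in>edges G\<^sub>2. v\<^sub>2 (if e = e\<^sub>2 then None else Some (Inr e)) = w\<^sub>2 e"
    by (rule right.spade_weighting_transport[OF two_connected(2) w\<^sub>2])
  have virtual: "v\<^sub>1 None + v\<^sub>2 None = \<delta>"
    using bspec[OF v\<^sub>1(2) edge\<^sub>1(1)] bspec[OF v\<^sub>2(2) edge\<^sub>2(1)] sum by simp
  have sides: "two_connected left_side" "two_connected right_side"
    using two_connected left.two_connected_map_iff right.two_connected_map_iff by simp_all
  show "two_connected glued" by (rule two_connected_if_sides[OF sides])
  show "spade \<delta> glued"
    using ex_spade_weighting_if_sides[OF sides(1) v\<^sub>1(1) sides(2) v\<^sub>2(1) virtual]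
    unfolding spade_iff_ex_weighting by blast
qed

end

locale thickened_edge =
  fixes G :: "('v, 'e) pre_multigraph" and e x y and k :: nat
  assumes G: "two_connected G" and e: "e \<in> edges G" "ends G e = {x, y}"
begin

abbreviation "thick \<equiv> add_parallel_edges k x y G"

lemma multigraph_G: "multigraph G"
  by (rule two_connected_multigraph[OF G])

lemma ends_in_verts: "x \<in> verts G" "y \<in> verts G" and x_neq_y: "x \<noteq> y"
  using multigraph_ends(1)[OF multigraph_G e(1)] ends_distinct[OF multigraph_G e]
  by (simp_all add: e(2))

lemma multigraph_thick: "multigraph thick"
proof -
  have "ends thick f \<subseteq> verts thick \<and> card (ends thick f) = 2" if "f \<in> edges thick" for f
    using that multigraph_ends[OF multigraph_G] ends_in_verts x_neq_y by (cases f) auto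
  then show ?thesis using multigraph_finite[OF multigraph_G] by (simp add: multigraph_def)
qed

sublocale two_separation thick "{x, y}" "verts G" "insert (Inl e) (Inr ` {..<k})"
  "Inl ` (edges G - {e})" x y
proof (rule two_separation.intro)
  show "ends thick f \<subseteq> {x, y}" if "f \<in> insert (Inl e) (Inr ` {..<k})" for f
    using that by (auto simp: e(2))
  show "ends thick f \<subseteq> verts G" if "f \<in> Inl ` (edges G - {e})" for f
  proof -
    obtain g where "f = Inl g" "g \<in> edges G" using \<open>f \<in> _\<close> by auto
    then show ?thesis using multigraph_ends(1)[OF multigraph_G] by simp
  qed
  show "Inl ` (edges G - {e}) \<noteq> {}" using two_connected_other_edge[OF G] by simp
  show "verts thick = {x, y} \<union> verts G" "{x, y} \<inter> verts G = {x, y}" using ends_in_verts by auto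
  show "edges thick = insert (Inl e) (Inr ` {..<k}) \<union> Inl ` (edges G - {e})" using e(1) by auto
qed (use multigraph_thick x_neq_y in auto)

lemma card_left: "card (verts left_side) = 2" "card (edges left_side) = k + 2"
proof -
  have "card (insert (Inl e) (Inr ` {..<k}) :: ('e + nat) set) = k + 1"
    by (subst card_insert_disjoint) (auto simp: card_image)
  then show "card (edges left_side) = k + 2" using card_edges_left by simp
qed (use x_neq_y in simp)

lemma two_connected_left_thick: "two_connected left_side"
  using two_connected_iff_two_verts[OF multigraph_left card_left(1)] card_left(2) by simp

lemma right_isomorphism:
  "graph_isomorphism id (\<lambda>f. if f = e then None else Some (Inl f)) G right_side"
  using isomorphism_onto_side[OF multigraph_G e, of id Inl thick] by simp

lemma two_connected_thick: "two_connected thick"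
  using two_connected_left_thick graph_isomorphism.two_connected_map_iff[OF right_isomorphism] G
  by (intro two_connected_if_sides) simp_all

lemma ex_spade_weighting_thick:
  assumes w: "spade_weighting \<delta> G w" "w e = \<delta> - 1" and k: "k + 2 = \<delta>"
  shows "\<exists>w'. spade_weighting \<delta> thick w' \<and> w' (Inl e) = 1"
proof -
  interpret right: graph_isomorphism id "\<lambda>f. if f = e then None else Some (Inl f)" G right_side
    by (rule right_isomorphism)
  obtain v where v: "spade_weighting \<delta> right_side v"
    "\<forall>f\<in>edges G. v (if f = e then None else Some (Inl f)) = w f"
    by (rule right.spade_weighting_transport[OF G w(1)])
  have "v None = \<delta> - 1" using bspec[OF v(2) e(1)] w(2) by simp
  have left: "spade_weighting \<delta> left_side (\<lambda>_. 1)"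
    using spade_weighting_bond[OF two_connected_left_thick card_left(1)] card_left(2) k by simp
  have "two_connected right_side" using G right.two_connected_map_iff by simp
  then show ?thesis
    using ex_spade_weighting_if_sides[OF two_connected_left_thick left _ v(1)] \<open>v None = \<delta> - 1\<close> k
    by fastforce
qed

end

text \<open>Construction B is construction A after the edge \<open>e\<^sub>2\<close> of weight \<open>\<delta> - 1\<close> is thickened to
  \<open>\<delta> - 1\<close> parallel edges, which then have weight \<open>1\<close>.\<close>

lemma construction_B_iso_thick:
  fixes G\<^sub>1 :: "('v, 'e) pre_multigraph" and G\<^sub>2 :: "('w, 'f) pre_multigraph"
  assumes "x\<^sub>2 \<noteq> y\<^sub>2"
  shows "add_parallel_edges k (Inl x\<^sub>1) (Inl y\<^sub>1)
      (delete_edges (glue G\<^sub>1 x\<^sub>1 y\<^sub>1 G\<^sub>2 x\<^sub>2 y\<^sub>2) {Inl e\<^sub>1, Inr e\<^sub>2}) \<simeq>\<^sub>m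
    delete_edges (glue G\<^sub>1 x\<^sub>1 y\<^sub>1 (add_parallel_edges k x\<^sub>2 y\<^sub>2 G\<^sub>2) x\<^sub>2 y\<^sub>2) {Inl e\<^sub>1, Inr (Inl e\<^sub>2)}"
    (is "?B \<simeq>\<^sub>m ?A")
proof -
  define reassoc :: "('e + 'f) + nat \<Rightarrow> 'e + ('f + nat)" where
    "reassoc = case_sum (case_sum Inl (Inr \<circ> Inl)) (Inr \<circ> Inr)"
  have "inj reassoc" by (auto simp: reassoc_def inj_def split: sum.splits)
  then have inj: "inj_on reassoc (edges ?B)" by (rule inj_on_subset) simp
  have edges_B:
    "edges ?B = Inl ` (Inl ` (edges G\<^sub>1 - {e\<^sub>1}) \<union> Inr ` (edges G\<^sub>2 - {e\<^sub>2})) \<union> Inr ` {..<k}"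
    by auto
  have "reassoc ` edges ?B = edges ?A"
    unfolding edges_B by (auto simp: reassoc_def image_Un image_image)
  with inj have "bij_betw reassoc (edges ?B) (edges ?A)" by (simp only: bij_betw_def)
  moreover have "bij_betw id (verts ?B) (verts ?A)" by simp
  moreover have "ends ?A (reassoc e) = id ` ends ?B e" if "e \<in> edges ?B" for e
    using that assms unfolding edges_B by (auto simp: reassoc_def merge_def)
  ultimately show ?thesis unfolding multigraph_iso_def by blast
qed

lemma construction_A_spade:
  assumes \<delta>: "2 < \<delta>" and A: "construction_A \<delta> G\<^sub>1 G\<^sub>2 H" and spade: "spade \<delta> G\<^sub>1" "spade \<delta> G\<^sub>2"
  shows "two_connected H \<and> spade \<delta> H"
proof -
  obtain e\<^sub>1 e\<^sub>2 x\<^sub>1 y\<^sub>1 x\<^sub>2 y\<^sub>2 where G: "two_connected G\<^sub>1" "two_connected G\<^sub>2"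
    and e: "e\<^sub>1 \<in> edges G\<^sub>1" "e\<^sub>2 \<in> edges G\<^sub>2" "ends G\<^sub>1 e\<^sub>1 = {x\<^sub>1, y\<^sub>1}" "ends G\<^sub>2 e\<^sub>2 = {x\<^sub>2, y\<^sub>2}"
    and weight: "has_weight \<delta> G\<^sub>1 e\<^sub>1 1" "has_weight \<delta> G\<^sub>2 e\<^sub>2 (\<delta> - 1)"
    and H: "H = delete_edges (glue G\<^sub>1 x\<^sub>1 y\<^sub>1 G\<^sub>2 x\<^sub>2 y\<^sub>2) {Inl e\<^sub>1, Inr e\<^sub>2}"
    using A unfolding construction_A_def by blast
  interpret glued_pair G\<^sub>1 G\<^sub>2 e\<^sub>1 e\<^sub>2 x\<^sub>1 y\<^sub>1 x\<^sub>2 y\<^sub>2 by unfold_locales (use G e in auto)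
  obtain w\<^sub>1 w\<^sub>2 where "spade_weighting \<delta> G\<^sub>1 w\<^sub>1" "w\<^sub>1 e\<^sub>1 = 1" "spade_weighting \<delta> G\<^sub>2 w\<^sub>2" "w\<^sub>2 e\<^sub>2 = \<delta> - 1"
    using ex_spade_weighting_with_weight[OF \<delta>] G spade e(1,2) weight by metis
  then show ?thesis using spade_glued[of \<delta> w\<^sub>1 w\<^sub>2] \<delta> by (simp add: H)
qed

lemma construction_B_spade:
  assumes \<delta>: "2 < \<delta>" and B: "construction_B \<delta> G\<^sub>1 G\<^sub>2 H" and spade: "spade \<delta> G\<^sub>1" "spade \<delta> G\<^sub>2"
    and multigraph_H: "multigraph H"
  shows "two_connected H \<and> spade \<delta> H"
proof -
  obtain e\<^sub>1 e\<^sub>2 x\<^sub>1 y\<^sub>1 x\<^sub>2 y\<^sub>2 where G: "two_connected G\<^sub>1" "two_connected G\<^sub>2"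
    and e: "e\<^sub>1 \<in> edges G\<^sub>1" "e\<^sub>2 \<in> edges G\<^sub>2" "ends G\<^sub>1 e\<^sub>1 = {x\<^sub>1, y\<^sub>1}" "ends G\<^sub>2 e\<^sub>2 = {x\<^sub>2, y\<^sub>2}"
    and weight: "has_weight \<delta> G\<^sub>1 e\<^sub>1 (\<delta> - 1)" "has_weight \<delta> G\<^sub>2 e\<^sub>2 (\<delta> - 1)"
    and H: "H = add_parallel_edges (\<delta> - 2) (Inl x\<^sub>1) (Inl y\<^sub>1)
      (delete_edges (glue G\<^sub>1 x\<^sub>1 y\<^sub>1 G\<^sub>2 x\<^sub>2 y\<^sub>2) {Inl e\<^sub>1, Inr e\<^sub>2})"
    using B unfolding construction_B_def by blast
  interpret thickened: thickened_edge G\<^sub>2 e\<^sub>2 x\<^sub>2 y\<^sub>2 "\<delta> - 2" by unfold_locales (use G e in auto)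
  interpret glued_pair G\<^sub>1 thickened.thick e\<^sub>1 "Inl e\<^sub>2" x\<^sub>1 y\<^sub>1 x\<^sub>2 y\<^sub>2
    by unfold_locales (use G e thickened.two_connected_thick in auto)
  obtain w\<^sub>1 w\<^sub>2 where w: "spade_weighting \<delta> G\<^sub>1 w\<^sub>1" "w\<^sub>1 e\<^sub>1 = \<delta> - 1"
    "spade_weighting \<delta> G\<^sub>2 w\<^sub>2" "w\<^sub>2 e\<^sub>2 = \<delta> - 1"
    using ex_spade_weighting_with_weight[OF \<delta>] G spade e(1,2) weight by metis
  have "\<delta> - 2 + 2 = \<delta>" using \<delta> by simp
  then obtain w where "spade_weighting \<delta> thickened.thick w" "w (Inl e\<^sub>2) = 1"
    using thickened.ex_spade_weighting_thick[OF w(3,4)] by blast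
  then have "two_connected glued" "spade \<delta> glued" using spade_glued[OF w(1)] w(2) \<delta> by simp_all
  moreover have "H \<simeq>\<^sub>m glued" unfolding H by (rule construction_B_iso_thick[OF distinct_ends(2)])
  ultimately show ?thesis using two_connected_iso[OF multigraph_H] spade_iso by blast
qed

section \<open>Construction C preserves the spade property\<close>

locale degree_two_path =
  fixes G :: "('v, 'e) pre_multigraph" and vs es
  assumes G: "two_connected G" and path: "is_path G vs es" and length: "2 \<le> length es"
    and interior_degree: "v \<in> set vs - {hd vs, last vs} \<Longrightarrow> degree G v = 2"
begin

abbreviation "x \<equiv> hd vs"
abbreviation "y \<equiv> last vs"
abbreviation "interior \<equiv> set vs - {x, y}"
abbreviation "outer \<equiv> verts G - interior"

lemma multigraph_G: "multigraph G"
  by (rule two_connected_multigraph[OF G])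

lemma x_neq_y: "x \<noteq> y"
  by (rule is_path_hd_neq_last[OF path]) (use length in auto)

lemma set_vs: "set vs \<subseteq> verts G" and set_es: "set es \<subseteq> edges G"
  using path by (simp_all add: is_path_def)

lemma card_vs: "card (set vs) = Suc (length es)" and card_es: "card (set es) = length es"
  using path distinct_card[of vs] distinct_card[OF is_path_distinct_edges[OF path]]
  by (simp_all add: is_path_def)

lemma connected_on_interior: "connected_on G interior"
  by (rule is_path_interior_connected_on[OF path length])

lemma edge_at_interior:
  assumes "e \<in> edges G" "v \<in> ends G e" "v \<in> interior"
  shows "e \<in> set es"
proof -
  have "{f \<in> set es. v \<in> ends G f} = {f \<in> edges G. v \<in> ends G f}"
  proof (rule card_seteq)
    show "card {f \<in> edges G. v \<in> ends G f} \<le> card {f \<in> set es. v \<in> ends G f}"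
      using is_path_edges_at_interior[OF path assms(3)] interior_degree[OF assms(3)]
      by (simp add: degree_def)
  qed (use set_es multigraph_finite[OF multigraph_G] in auto)
  then show ?thesis using assms by blast
qed

lemma path_edge_not_outer: "edges_within G outer \<inter> set es = {}"
proof -
  have False if e: "e \<in> set es" "ends G e \<subseteq> outer" for e
  proof -
    have "ends G e \<subseteq> {x, y}" using is_path_ends_subset[OF path e(1)] e(2) by auto
    then have "ends G e = {x, y}"
      using multigraph_ends_eq[OF multigraph_G] e(1) set_es by blast
    then show False using is_path_edge_not_closing[OF path length e(1)] by simp
  qed
  then show ?thesis by (auto simp: edges_within_def)
qed

lemma edges_G: "edges G = edges_within G outer \<union> set es"
proof -
  have "ends G e \<subseteq> outer" if "e \<in> edges G" "e \<notin> set es" for e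
    using that edge_at_interior multigraph_ends(1)[OF multigraph_G that(1)] by blast
  then show ?thesis using set_es by (auto simp: edges_within_def)
qed

lemma edges_within_outer_nonempty: "edges_within G outer \<noteq> {}"
proof
  assume "edges_within G outer = {}"
  then have "degree G x \<le> 1"
    using is_path_edges_at_hd[OF path] edges_G by (simp add: degree_def)
  then show False
    using two_connected_degree[OF G, of x] is_path_endpoints(1)[OF path] set_vs by auto
qed

sublocale two_separation G outer "set vs" "edges_within G outer" "set es" x y
proof (rule two_separation.intro)
  show "verts G = outer \<union> set vs" "outer \<inter> set vs = {x, y}"
    using set_vs is_path_endpoints[OF path] by auto
  show "set es \<noteq> {}" using length by auto
  show "ends G e \<subseteq> outer" if "e \<in> edges_within G outer" for e
    using that by (simp add: edges_within_def)
qed (use multigraph_G x_neq_y edges_G path_edge_not_outer edges_within_outer_nonempty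
    is_path_ends_subset[OF path] in simp_all)

lemma two_terminal_outer: "two_terminal G outer x y"
proof -
  have "connected_on G outer"
    using connected_on_V1_Diff[OF two_connected_left[OF G], of "{}"] by simp
  moreover have "p = x \<or> p = y"
    if p: "p \<in> outer" and q: "q \<in> verts G - outer" and adj: "adj G p q" for p q
  proof -
    obtain e where e: "e \<in> edges G" "ends G e = {p, q}" using adj by (auto simp: adj_def)
    then have "p \<in> set vs" using edge_at_interior[of e q] q is_path_ends_subset[OF path] by auto
    then show ?thesis using p in_both by blast
  qed
  moreover have "outer \<subset> verts G"
    using connected_on_nonempty[OF connected_on_interior] set_vs by blast
  ultimately show ?thesis using xy_in_V1 x_neq_y unfolding two_terminal_def by blast
qed

lemma connected_on_outside: "connected_on G (verts G - outer)"
proof -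
  have "verts G - outer = interior" using set_vs by auto
  then show ?thesis using connected_on_interior by simp
qed

lemma two_connected_outer:
  assumes w: "balanced (Suc (length es)) G w" and E: "2 \<le> card (edges_within G outer)"
  shows "two_connected (induced G outer)"
proof (rule ccontr)
  assume "\<not> two_connected (induced G outer)"
  then have outer_weight: "sum w (edges_within G outer) + 2 \<le> Suc (length es) * (card outer - 1)"
    using series_weight_bound[OF G w _ two_terminal_outer connected_on_outside] length E by simp
  have "w e \<le> length es" if "e \<in> set es" for e
    using w that set_es length by (fastforce simp: balanced_def)
  then have path_weight: "sum w (set es) \<le> length es * length es"
    using sum_bounded_above[of "set es" w "length es"] card_es by simp
  have total:
    "sum w (edges_within G outer) + sum w (set es) = Suc (length es) * (card (verts G) - 1)"
    using w sum_edges[of w] by (simp add: balanced_def)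
  obtain s where "card outer = s + 2" using card_V1_ge2 by (metis le_add_diff_inverse2)
  moreover from this have "card (verts G) = s + length es + 1" using card_verts card_vs by simp
  ultimately show False using outer_weight path_weight total by (simp add: algebra_simps)
qed

lemma spade_left:
  assumes "spade (Suc (length es)) G"
  shows "spade (Suc (length es)) left_side"
proof (cases "card (edges_within G outer) = 1")
  case True
  then obtain e where "edges_within G outer = {e}" by (auto simp: card_1_singleton_iff)
  then have "card (verts left_side) = 2" "card (edges left_side) = 2"
    using single_edge_left(1)[OF two_connected_left[OF G]] x_neq_y True card_edges_left by simp_all
  then have "\<exists>w. spade_weighting (Suc (length es)) left_side w \<and> w None = 1"
    by (rule ex_spade_weighting_digon[OF two_connected_left[OF G]]) (use length in simp_all)
  then show ?thesis unfolding spade_iff_ex_weighting by blast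
next
  case False
  then have "2 \<le> card (edges_within G outer)"
    using edges_within_outer_nonempty finite_E1 by (cases "card (edges_within G outer)") auto
  moreover obtain w where w: "balanced (Suc (length es)) G w"
    using assms by (auto simp: spade_iff_ex_weighting spade_weighting_def)
  ultimately have "good_flat G outer"
    using two_connected_outer two_terminal_outer connected_on_outside
    by (simp add: good_flat_iff[OF G] two_terminal_def)
  then have "1 + sum w (edges_within G outer) = Suc (length es) * (card outer - 1)"
    using w by (simp add: balanced_def tight_def)
  then have balanced: "balanced (Suc (length es)) left_side (case_option 1 w)"
    by (intro balanced_left[OF G w]) simp_all
  have "2 < Suc (length es)" using length by simp
  with balanced_spade_weighting_obtainable(1)[OF two_connected_left[OF G] balanced]
  show ?thesis unfolding spade_iff_ex_weighting by blast
qed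

abbreviation "shortcut \<equiv>
  add_parallel_edges 1 x y (delete_edges (induced G outer) (set es))"

lemma shortcut_isomorphism: "graph_isomorphism id (case_option (Inr 0) Inl) left_side shortcut"
proof
  have "edges shortcut = insert (Inr 0) (Inl ` edges_within G outer)"
    using path_edge_not_outer by auto
  then show "bij_betw (case_option (Inr 0) Inl) (edges left_side) (edges shortcut)"
    by (auto simp: bij_betw_def inj_on_def image_image)
  show "ends shortcut (case_option (Inr 0) Inl e) = id ` ends left_side e" for e
    by (cases e) simp_all
  show "bij_betw id (verts left_side) (verts shortcut)" by simp
qed (rule multigraph_left)

end

lemma construction_C_spade:
  assumes \<delta>: "2 < \<delta>" and C: "construction_C \<delta> G H" and spade: "spade \<delta> G"
  shows "two_connected H \<and> spade \<delta> H"
proof -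
  obtain vs es where vs: "two_connected G" "is_path G vs es" "length es = \<delta> - 1"
    "\<forall>v\<in>set vs - {hd vs, last vs}. degree G v = 2"
    and H: "H = add_parallel_edges 1 (hd vs) (last vs)
      (delete_edges (induced G (verts G - (set vs - {hd vs, last vs}))) (set es))"
    using C unfolding construction_C_def Let_def by blast
  interpret degree_two_path G vs es by unfold_locales (use vs \<delta> in auto)
  have iso: "left_side \<simeq>\<^sub>m H"
    unfolding H using shortcut_isomorphism multigraph_iso_iff[OF multigraph_left] by blast
  have left: "two_connected left_side" by (rule two_connected_left[OF G])
  have "Suc (length es) = \<delta>" using vs(3) \<delta> by simp
  then have "spade \<delta> left_side" using spade_left spade by simp
  then show ?thesis
    using left two_connected_iso[OF multigraph_left iso] spade_iso[OF left iso] by simp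
qed

section \<open>The characterisation\<close>

text \<open>An isomorphic copy in the sense of \<open>multigraph_iso\<close> need not be a multigraph, since the
  endpoints of its edges may lie outside its vertex set.\<close>

lemma constructible_spade:
  assumes \<delta>: "2 < \<delta>" and "constructible \<delta> G" "multigraph G"
  shows "two_connected G \<and> spade \<delta> G"
  using assms(2,3)
proof induction
  case (cycle G)
  have "two_connected (cycle_multigraph \<delta>)" "spade \<delta> (cycle_multigraph \<delta>)"
    using two_connected_cycle spade_weighting_cycle[OF \<delta>] \<delta> by (auto simp: spade_iff_ex_weighting)
  then show ?case using two_connected_iso[OF cycle(2,1)] spade_iso cycle(1) by blast
next
  case (A G\<^sub>1 G\<^sub>2 H G)
  then have "two_connected G\<^sub>1" "two_connected G\<^sub>2" by (simp_all add: construction_A_def)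
  then have "spade \<delta> G\<^sub>1" "spade \<delta> G\<^sub>2" using A.IH two_connected_multigraph by blast+
  then have "two_connected H \<and> spade \<delta> H" by (rule construction_A_spade[OF \<delta> A.hyps(3)])
  then show ?case using two_connected_iso[OF A.prems A.hyps(4)] spade_iso A.hyps(4) by blast
next
  case (B G\<^sub>1 G\<^sub>2 H G)
  then have "two_connected G\<^sub>1" "two_connected G\<^sub>2" by (simp_all add: construction_B_def)
  then have "spade \<delta> G\<^sub>1" "spade \<delta> G\<^sub>2" using B.IH two_connected_multigraph by blast+
  then have "two_connected H \<and> spade \<delta> H"
    using multigraph_if_iso[OF B.prems B.hyps(4)] by (rule construction_B_spade[OF \<delta> B.hyps(3)])
  then show ?case using two_connected_iso[OF B.prems B.hyps(4)] spade_iso B.hyps(4) by blast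
next
  case (C G\<^sub>1 H G)
  then have "two_connected G\<^sub>1" by (simp add: construction_C_def)
  then have "spade \<delta> G\<^sub>1" using C.IH two_connected_multigraph by blast
  then have "two_connected H \<and> spade \<delta> H" by (rule construction_C_spade[OF \<delta> C.hyps(2)])
  then show ?case using two_connected_iso[OF C.prems C.hyps(3)] spade_iso C.hyps(3) by blast
qed

theorem theorem2p22:
  fixes \<delta> :: nat and G :: "('v, 'e) pre_multigraph"
  assumes "\<delta> > 2" and "two_connected G"
  shows "spade \<delta> G \<longleftrightarrow> obtainable_from_cycles \<delta> G"
proof
  assume "spade \<delta> G"
  then obtain w where "balanced \<delta> G w" by (auto simp: spade_iff_ex_weighting spade_weighting_def)
  then show "obtainable_from_cycles \<delta> G"
    using assms balanced_spade_weighting_obtainable(2) by blast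
next
  assume "obtainable_from_cycles \<delta> G"
  then obtain H where H: "constructible \<delta> H" "G \<simeq>\<^sub>m H" by (auto simp: obtainable_from_cycles_def)
  have "multigraph H" using two_connected_multigraph[OF assms(2)] H(2) by (rule multigraph_if_iso)
  then have "spade \<delta> H" using constructible_spade[OF assms(1) H(1)] by simp
  then show "spade \<delta> G" using spade_iso[OF assms(2) H(2)] by simp
qed

end
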